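(* For every $d\ge 3$, the critical parameter $h_{**}(d)$ of level-set percolation for the Gaussian free field on $\mathbb{Z}^d$ satisfies $$h_{**}(d)<\infty .$$ Moreover, for all $d\ge 3$ and all $h\in\mathbb{R}$ with $h>h_{**}(d)$, there exist constants $c(h)>0$, $c'(h)>0$, $c''(h)>0$ and $0<\rho<1$ (all depending on $d$ and $h$) such that $$\mathbb{P}\big[B(0,L)\stackrel{\ge h}{\longleftrightarrow}S(0,2L)\big]\le c(h)\,e^{-c'(h)L^{\rho}}\qquad\text{for all integers }L\ge 1 ,$$ and, in particular, the connectivity function of the excursion set above level $h$ has stretched exponential decay: $$\mathbb{P}\big[0\stackrel{\ge h}{\longleftrightarrow}x\big]\le c(h)\,e^{-c''(h)|x|^{\rho}}\qquad\text{for all }x\in\mathbb{Z}^d .$$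
   Context: $\mathbb{Z}^d$, $d\ge 3$, carries the nearest-neighbor graph structure ($x,y$ adjacent iff $|x-y|=1$), where $|\cdot|$ is the Euclidean norm and $|\cdot|_\infty$ the $\ell^\infty$-norm. Let $g(x,y)=\sum_{n\ge0}P_x[X_n=y]$ be the Green function of discrete-time simple random walk $(X_n)_{n\ge 0}$ on $\mathbb{Z}^d$ (with law $P_x$ when started at $x$). $\mathbb{P}$ is the law on $\mathbb{R}^{\mathbb{Z}^d}$ under which the canonical field $\varphi=(\varphi_x)_{x\in\mathbb{Z}^d}$ is a centered Gaussian field with covariance $\mathbb{E}[\varphi_x\varphi_y]=g(x,y)$ (the Gaussian free field). For $h\in\mathbb{R}$ the excursion set is $E_\varphi^{\ge h}=\{x\in\mathbb{Z}^d:\varphi_x\ge h\}$. For $K,K'\subset\mathbb{Z}^d$, $\{K\stackrel{\ge h}{\longleftrightarrow}K'\}$ is the event that there is a (finite, nearest-neighbor) path all of whose vertices lie in $E_\varphi^{\ge h}$, starting in $K$ and ending in $K'$; points are identified with singletons. $B(0,L)=\{y\in\mathbb{Z}^d:|y|_\infty\le L\}$ and $S(0,L)=\{y\in\mathbb{Z}^d:|y|_\infty=L\}$. Define $$h_{**}(d)=\inf\Big\{h\in\mathbb{R}:\ \text{for some }\alpha>0,\ \lim_{L\to\infty}L^{\alpha}\,\mathbb{P}\big[B(0,L)\stackrel{\ge h}{\longleftrightarrow}S(0,2L)\big]=0\Big\}$$ with $\inf\emptyset=\infty$, and $L$ ranging over positive integers. *)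

theory Defs
  imports "HOL-Probability.Probability"
begin

section \<open>The lattice\<close>

definition lat :: "int ^ 'd \<Rightarrow> real ^ 'd::finite" where
  "lat x = (\<chi> i. real_of_int (x $ i))"

definition adjacent :: "int ^ 'd::finite \<Rightarrow> int ^ 'd \<Rightarrow> bool" where
  "adjacent x y \<longleftrightarrow> norm (lat x - lat y) = 1"

definition Ball_inf :: "nat \<Rightarrow> (int ^ 'd::finite) set" where
  "Ball_inf L = {y. infnorm (lat y) \<le> real L}"

definition Sphere_inf :: "nat \<Rightarrow> (int ^ 'd::finite) set" where
  "Sphere_inf L = {y. infnorm (lat y) = real L}"


section \<open>Simple random walk and its Green function\<close>

text \<open>The walk is realised through i.i.d. increments, uniform on the neighbours of the origin;
  its law when started at \<open>x\<close> is that of \<open>srw x\<close> under \<open>srw_space\<close>.\<close>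

definition srw_space :: "(nat \<Rightarrow> int ^ 'd::finite) measure" where
  "srw_space = (\<Pi>\<^sub>M n\<in>UNIV. measure_pmf (pmf_of_set {e. adjacent 0 e}))"

definition srw :: "int ^ 'd::finite \<Rightarrow> nat \<Rightarrow> (nat \<Rightarrow> int ^ 'd) \<Rightarrow> int ^ 'd" where
  "srw x n \<omega> = x + (\<Sum>k<n. \<omega> k)"

text \<open>For \<open>CARD('d) \<ge> 3\<close> the walk is transient and the series converges; in dimensions 1 and 2
  it diverges and the value below is meaningless.\<close>

definition green :: "int ^ 'd::finite \<Rightarrow> int ^ 'd \<Rightarrow> real" where
  "green x y = (\<Sum>n. \<P>(\<omega> in srw_space. srw x n \<omega> = y))"


section \<open>The Gaussian free field\<close>

text \<open>Degenerate (almost surely constant) variables count as Gaussian.\<close>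

definition gaussian_rv :: "'a measure \<Rightarrow> ('a \<Rightarrow> real) \<Rightarrow> bool" where
  "gaussian_rv M X \<longleftrightarrow>
     (\<exists>\<mu> \<sigma>. 0 < \<sigma> \<and> distributed M lborel X (normal_density \<mu> \<sigma>)) \<or>
     (\<exists>\<mu>. X \<in> borel_measurable M \<and> (AE \<omega> in M. X \<omega> = \<mu>))"

definition gaussian_field_law :: "('x \<Rightarrow> real) measure \<Rightarrow> bool" where
  "gaussian_field_law M \<longleftrightarrow>
     prob_space M \<and> sets M = sets (\<Pi>\<^sub>M x\<in>UNIV. borel) \<and>
     (\<forall>F a. finite F \<longrightarrow> gaussian_rv M (\<lambda>\<phi>. \<Sum>x\<in>F. a x * \<phi> x))"

definition gff_law :: "(int ^ 'd::finite \<Rightarrow> real) measure \<Rightarrow> bool" where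
  "gff_law M \<longleftrightarrow>
     gaussian_field_law M \<and>
     (\<forall>x. (\<integral>\<phi>. \<phi> x \<partial>M) = 0) \<and>
     (\<forall>x y. (\<integral>\<phi>. \<phi> x * \<phi> y \<partial>M) = green x y)"


section \<open>Level-set percolation\<close>

definition excursion_set :: "real \<Rightarrow> (int ^ 'd::finite \<Rightarrow> real) \<Rightarrow> (int ^ 'd) set" where
  "excursion_set h \<phi> = {x. h \<le> \<phi> x}"

definition connected_above ::
    "real \<Rightarrow> (int ^ 'd::finite) set \<Rightarrow> (int ^ 'd) set \<Rightarrow> (int ^ 'd \<Rightarrow> real) \<Rightarrow> bool" where
  "connected_above h K K' \<phi> \<longleftrightarrow>
     (\<exists>p. p \<noteq> [] \<and> set p \<subseteq> excursion_set h \<phi> \<and> successively adjacent p \<and>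
          hd p \<in> K \<and> last p \<in> K')"

definition h_star_star :: "(int ^ 'd::finite \<Rightarrow> real) measure \<Rightarrow> ereal" where
  "h_star_star M = Inf (ereal ` {h. \<exists>\<alpha>>0.
     (\<lambda>L. real L powr \<alpha> *
        \<P>(\<phi> in M. connected_above h (Ball_inf L) (Sphere_inf (2 * L)) \<phi>)) \<longlonglongrightarrow> 0})"

end

theory Submission
  imports Defs "HOL-Real_Asymp.Real_Asymp"
begin

text \<open>
Let \<open>p L h\<close> be the probability that the box of radius \<open>L\<close> is connected above level \<open>h\<close> to the
sphere of twice its radius.  The proof is a multi-scale argument.  A crossing at scale \<open>64 L\<close>
contains crossings of two boxes of radius \<open>L\<close> that lie far apart, and the two boxes can be taken
from a collection whose size does not depend on \<open>L\<close>.  If the two small crossings were independent,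
\<open>p (64 L) h\<close> would be at most a constant times the square of \<open>p L h\<close>; iterating such a bound makes
\<open>p (64 ^ n L) h\<close> of order \<open>exp (- (2 ^ n))\<close>, which is stretched exponential decay with exponent
\<open>1/6\<close> because \<open>2 ^ 6 = 64\<close>.

The field is strongly correlated, and the independence has to be bought.  The Green function is the
sum over \<open>k\<close> of the heat kernels of the walk.  Cut this sum at \<open>2 L\<close> steps.  The first part vanishes
at distance \<open>2 L\<close>, since the walk cannot get there; the second part is at most of order
\<open>1 / sqrt L\<close>, since in dimension at least 3 the heat kernel decays like \<open>k\<close> to the power \<open>-3/2\<close> or
faster (\<open>heat_le\<close>).  Both parts are positive semidefinite, because the heat kernels of times \<open>2 n\<close>
and \<open>2 n + 1\<close> have a positive semidefinite sum.  So on two distant boxes the field has the law of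
a sum of two independent Gaussian fields, one of which is independent on the two boxes, while the
other one is uniformly below \<open>\<epsilon>\<close> outside an event of probability at most a constant times
\<open>L ^ d * exp (- c * \<epsilon>\<^sup>2 * sqrt L)\<close>.  All events considered are increasing, so discarding the
small field costs only a lowering of the level by \<open>2 \<epsilon>\<close> and this error
(\<open>sprinkled_decoupling\<close>).

Along the scales \<open>64 ^ n L\<close> the lowerings of the level can be chosen summable, with an arbitrarily
small sum \<open>\<delta>\<close>, while the errors stay below \<open>exp (- (2 ^ n))\<close> once the initial \<open>L\<close> is large.  The
outcome is \<open>crossing_prob_threshold\<close>: there is a constant \<open>\<eta> > 0\<close> such that \<open>p L h \<le> \<eta>\<close> at a single
large scale \<open>L\<close> implies stretched exponential decay at every level \<open>h + \<delta>\<close>.  Both claims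
follow.  At a fixed scale \<open>p L h\<close> tends to 0 as \<open>h\<close> grows, so decay occurs at some level and the
critical parameter is finite.  And above the critical parameter some smaller level has
\<open>p L h\<close> tending to 0, hence below \<open>\<eta>\<close> at large scales.

The laws that are compared are finite-dimensional, and for these it has to be known that a Gaussian
vector exists for every positive semidefinite covariance (\<open>gaussian_vector_exists\<close>) and that its law
is determined by the covariance (\<open>finite_dimensional_law_unique\<close>).
\<close>

section \<open>The sup norm on the lattice\<close>

definition sup_norm :: "int ^ 'd::finite \<Rightarrow> int" where
  "sup_norm x = Max (range (\<lambda>i. \<bar>x $ i\<bar>))"

lemma sup_norm_le_iff: "sup_norm x \<le> k \<longleftrightarrow> (\<forall>i. \<bar>x $ i\<bar> \<le> k)"
  unfolding sup_norm_def by (subst Max_le_iff) auto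

lemma component_le_sup_norm: "\<bar>x $ i\<bar> \<le> sup_norm x"
  using sup_norm_le_iff[of x "sup_norm x"] by simp

lemma sup_norm_nonneg: "0 \<le> sup_norm x"
  using component_le_sup_norm[of x undefined] by linarith

lemma sup_norm_zero [simp]: "sup_norm (0 :: int ^ 'd::finite) = 0"
  by (intro antisym sup_norm_nonneg) (simp add: sup_norm_le_iff)

lemma sup_norm_attained: obtains i where "sup_norm x = \<bar>x $ i\<bar>"
proof -
  have "sup_norm x \<in> range (\<lambda>i. \<bar>x $ i\<bar>)"
    unfolding sup_norm_def by (rule Max_in) auto
  then show thesis using that by auto
qed

lemma sup_norm_minus_commute: "sup_norm (x - y) = sup_norm (y - x)"
proof -
  have "(\<lambda>i. \<bar>(x - y) $ i\<bar>) = (\<lambda>i. \<bar>(y - x) $ i\<bar>)"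
    by (simp add: abs_minus_commute)
  then show ?thesis by (simp only: sup_norm_def)
qed

lemma sup_norm_triangle: "sup_norm (x + y) \<le> sup_norm x + sup_norm y"
  unfolding sup_norm_le_iff
proof
  fix i
  have "\<bar>(x + y) $ i\<bar> \<le> \<bar>x $ i\<bar> + \<bar>y $ i\<bar>" by simp
  then show "\<bar>(x + y) $ i\<bar> \<le> sup_norm x + sup_norm y"
    using component_le_sup_norm[of x i] component_le_sup_norm[of y i] by linarith
qed

lemma sup_norm_triangle_diff: "sup_norm (x - z) \<le> sup_norm (x - y) + sup_norm (y - z)"
  using sup_norm_triangle[of "x - y" "y - z"] by simp

lemma infnorm_lat: "infnorm (lat x) = real_of_int (sup_norm x)"
proof (rule antisym)
  have "Sup {\<bar>lat x $ i\<bar> |i. i \<in> UNIV} \<le> real_of_int (sup_norm x)"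
  proof (rule cSup_least)
    fix r assume "r \<in> {\<bar>lat x $ i\<bar> |i. i \<in> UNIV}"
    then obtain i where "r = \<bar>lat x $ i\<bar>" by auto
    then have "r = real_of_int \<bar>x $ i\<bar>" by (simp add: lat_def)
    then show "r \<le> real_of_int (sup_norm x)" using component_le_sup_norm[of x i] by linarith
  qed auto
  then show "infnorm (lat x) \<le> real_of_int (sup_norm x)" by (simp add: infnorm_cart)
next
  obtain i where "sup_norm x = \<bar>x $ i\<bar>" by (rule sup_norm_attained)
  then have "real_of_int (sup_norm x) = \<bar>lat x $ i\<bar>" by (simp add: lat_def)
  then show "real_of_int (sup_norm x) \<le> infnorm (lat x)"
    using component_le_infnorm_cart[of "lat x" i] by simp
qed

lemma Ball_inf_eq: "Ball_inf L = {y. sup_norm y \<le> int L}"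
proof -
  have "real_of_int a \<le> real L \<longleftrightarrow> a \<le> int L" for a by linarith
  then show ?thesis by (simp add: Ball_inf_def infnorm_lat)
qed

lemma Sphere_inf_eq: "Sphere_inf L = {y. sup_norm y = int L}"
proof -
  have "real_of_int a = real L \<longleftrightarrow> a = int L" for a by linarith
  then show ?thesis by (simp add: Sphere_inf_def infnorm_lat)
qed

lemma
  fixes k :: nat
  shows finite_sup_norm_ball: "finite {y::int ^ 'd::finite. sup_norm y \<le> int k}"
    and card_sup_norm_ball: "card {y::int ^ 'd. sup_norm y \<le> int k} = (2 * k + 1) ^ CARD('d)"
proof -
  have iff: "y \<in> {y. sup_norm y \<le> int k} \<longleftrightarrow> vec_nth y \<in> (\<Pi>\<^sub>E i\<in>(UNIV::'d set). {- int k..int k})"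
    for y :: "int ^ 'd"
  proof -
    have "\<bar>z\<bar> \<le> int k \<longleftrightarrow> z \<in> {- int k..int k}" for z by auto
    then show ?thesis by (simp add: sup_norm_le_iff PiE_iff)
  qed
  have eq: "{y::int ^ 'd. sup_norm y \<le> int k} = vec_lambda ` (\<Pi>\<^sub>E i\<in>(UNIV::'d set). {- int k..int k})"
    (is "?A = vec_lambda ` ?B")
  proof (intro set_eqI iffI)
    fix y assume "y \<in> ?A"
    then show "y \<in> vec_lambda ` ?B"
      by (intro image_eqI[of _ _ "vec_nth y"]) (simp_all only: iff vec_nth_inverse)
  next
    fix y assume "y \<in> vec_lambda ` ?B"
    then obtain f where "f \<in> ?B" "y = vec_lambda f" by blast
    then have "vec_nth y \<in> ?B" by (simp only: vec_lambda_inverse[OF UNIV_I])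
    then show "y \<in> ?A" by (simp only: iff)
  qed
  have "finite ?B" by (intro finite_PiE) auto
  then show "finite ?A" by (simp add: eq)
  have "card ?A = card ?B" unfolding eq
    by (intro card_image inj_onI) (simp only: vec_lambda_inject[OF UNIV_I UNIV_I])
  also have "\<dots> = (\<Prod>i\<in>(UNIV::'d set). card {- int k..int k})" by (rule card_PiE) simp
  also have "card {- int k..int k} = 2 * k + 1" unfolding card_atLeastAtMost_int by linarith
  also have "(\<Prod>i\<in>(UNIV::'d set). 2 * k + 1) = (2 * k + 1) ^ CARD('d)" by (rule prod_constant)
  finally show "card ?A = (2 * k + 1) ^ CARD('d)" .
qed

lemma sum_squares_eq_1_int:
  fixes e :: "int ^ 'd::finite"
  assumes "(\<Sum>i\<in>UNIV. (e $ i)\<^sup>2) = 1"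
  shows "\<exists>i. e = axis i 1 \<or> e = axis i (-1)"
proof -
  obtain i where i: "e $ i \<noteq> 0"
    using assms by (cases "\<forall>i. e $ i = 0") auto
  have ge: "1 \<le> (e $ i)\<^sup>2" using i
    by (smt (verit) zero_less_power2)
  have split: "(\<Sum>j\<in>UNIV. (e $ j)\<^sup>2) = (e $ i)\<^sup>2 + (\<Sum>j\<in>UNIV - {i}. (e $ j)\<^sup>2)"
    by (rule sum.remove) auto
  have nn: "0 \<le> (\<Sum>j\<in>UNIV - {i}. (e $ j)\<^sup>2)" by (intro sum_nonneg) auto
  have one: "(e $ i)\<^sup>2 = 1" and zero: "(\<Sum>j\<in>UNIV - {i}. (e $ j)\<^sup>2) = 0"
    using assms split ge nn by auto
  have z: "e $ j = 0" if "j \<noteq> i" for j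
    using zero that sum_nonneg_eq_0_iff[of "UNIV - {i}" "\<lambda>j. (e $ j)\<^sup>2"] by auto
  from one have "e $ i = 1 \<or> e $ i = -1" by (simp add: power2_eq_1_iff)
  with z show ?thesis by (auto simp: vec_eq_iff axis_def)
qed

text \<open>The squared distance of two lattice points is an integer sum of squares, and it is 1 only if a single
term is 1.\<close>

lemma adjacent_iff: "adjacent x y \<longleftrightarrow> (\<exists>i. y - x = axis i 1 \<or> y - x = axis i (-1))"
proof -
  have "adjacent x y \<longleftrightarrow> (norm (lat x - lat y))\<^sup>2 = 1"
    unfolding adjacent_def by (simp add: abs_square_eq_1)
  also have "(norm (lat x - lat y))\<^sup>2 = (\<Sum>i\<in>UNIV. (real_of_int (x $ i) - real_of_int (y $ i))\<^sup>2)"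
    by (simp add: norm_vec_def L2_set_def sum_nonneg lat_def)
  also have "\<dots> = (\<Sum>i\<in>UNIV. real_of_int (((y - x) $ i)\<^sup>2))"
    by (intro sum.cong) (auto simp: power2_commute)
  also have "\<dots> = real_of_int (\<Sum>i\<in>UNIV. ((y - x) $ i)\<^sup>2)" by simp
  also have "\<dots> = 1 \<longleftrightarrow> (\<Sum>i\<in>UNIV. ((y - x) $ i)\<^sup>2) = 1" by linarith
  also have "\<dots> \<longleftrightarrow> (\<exists>i. y - x = axis i 1 \<or> y - x = axis i (-1))"
  proof
    assume "\<exists>i. y - x = axis i 1 \<or> y - x = axis i (-1)"
    then obtain i s where s: "y - x = axis i s" "s\<^sup>2 = 1" by (auto simp: power2_eq_1_iff)
    have "(\<Sum>j\<in>UNIV. ((y - x) $ j)\<^sup>2) = (\<Sum>j\<in>UNIV. if j = i then 1 else 0)"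
      unfolding s(1) by (intro sum.cong) (auto simp: axis_def s(2))
    then show "(\<Sum>j\<in>UNIV. ((y - x) $ j)\<^sup>2) = 1" by simp
  qed (rule sum_squares_eq_1_int)
  finally show ?thesis .
qed

lemma sup_norm_axis: "\<bar>s\<bar> = 1 \<Longrightarrow> sup_norm (axis i s) \<le> 1"
  by (auto simp: sup_norm_le_iff axis_def)

lemma adjacent_sym: "adjacent x y \<longleftrightarrow> adjacent y x"
  unfolding adjacent_def by (simp add: norm_minus_commute)

lemma adjacent_sup_norm_le: "adjacent x y \<Longrightarrow> sup_norm (x - y) \<le> 1"
  unfolding sup_norm_minus_commute[of x y] adjacent_iff
  using sup_norm_axis[of 1] sup_norm_axis[of "-1"] by fastforce

lemma adjacent_translate: "adjacent (x + a) (y + a) \<longleftrightarrow> adjacent x y"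
  by (simp add: adjacent_iff)

section \<open>The heat kernel of simple random walk\<close>

lemma neighbours_eq: "{e :: int ^ 'd::finite. adjacent 0 e} = range (\<lambda>i. axis i 1) \<union> range (\<lambda>i. axis i (-1))"
  by (auto simp: adjacent_iff)

lemma finite_neighbours: "finite {e :: int ^ 'd::finite. adjacent 0 e}"
  unfolding neighbours_eq by simp

lemma sum_neighbours:
  fixes f :: "int ^ 'd::finite \<Rightarrow> 'b::comm_monoid_add"
  shows "(\<Sum>e | adjacent 0 e. f e) = (\<Sum>i\<in>UNIV. f (axis i 1) + f (axis i (-1)))"
proof -
  have "(\<Sum>e | adjacent 0 e. f e) = (\<Sum>e\<in>range (\<lambda>i. axis i 1). f e) + (\<Sum>e\<in>range (\<lambda>i. axis i (-1)). f e)"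
    unfolding neighbours_eq by (rule sum.union_disjoint) (auto simp: axis_eq_axis)
  also have "\<dots> = (\<Sum>i\<in>UNIV. f (axis i 1)) + (\<Sum>i\<in>UNIV. f (axis i (-1)))"
    by (subst (1 2) sum.reindex) (auto simp: inj_on_def axis_eq_axis)
  finally show ?thesis by (simp add: sum.distrib)
qed

lemma card_neighbours: "card {e :: int ^ 'd::finite. adjacent 0 e} = 2 * CARD('d)"
proof -
  have "card {e :: int ^ 'd::finite. adjacent 0 e} = (\<Sum>e | adjacent 0 (e :: int ^ 'd). 1)" by simp
  also have "\<dots> = 2 * CARD('d)" unfolding sum_neighbours by simp
  finally show ?thesis .
qed

definition heat :: "nat \<Rightarrow> int ^ 'd::finite \<Rightarrow> real" where
  "heat n z = \<P>(\<omega> in srw_space. (\<Sum>k<n. \<omega> k) = z)"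

lemma green_eq_heat: "green x y = (\<Sum>n. heat n (y - x))"
proof -
  have "srw x n \<omega> = y \<longleftrightarrow> (\<Sum>k<n. \<omega> k) = y - x" for n \<omega>
    unfolding srw_def by (auto simp: algebra_simps)
  then show ?thesis by (simp add: green_def heat_def)
qed

interpretation srw: sequence_space "measure_pmf (pmf_of_set {e :: int ^ 'd::finite. adjacent 0 e})"
  by unfold_locales

lemma space_srw_space [simp]: "space (srw_space :: (nat \<Rightarrow> int ^ 'd::finite) measure) = UNIV"
  by (auto simp: srw_space_def space_PiM)

lemma prob_space_srw_space: "prob_space (srw_space :: (nat \<Rightarrow> int ^ 'd::finite) measure)"
  unfolding srw_space_def by (rule srw.P.prob_space_axioms)

lemma heat_nonneg: "0 \<le> heat n z"
  by (simp add: heat_def)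

lemma heat_0: "heat 0 z = (if z = 0 then 1 else 0)"
  using prob_space.prob_space[OF prob_space_srw_space, where 'd1='a]
  by (auto simp: heat_def)

lemma measurable_walk [measurable]:
  "(\<lambda>\<omega> :: nat \<Rightarrow> int ^ 'd::finite. \<Sum>k<n. \<omega> k) \<in> measurable srw_space (count_space UNIV)"
proof (induction n)
  case (Suc n)
  have [measurable]: "(\<lambda>\<omega> :: nat \<Rightarrow> int ^ 'd. \<omega> n) \<in> measurable srw_space (count_space UNIV)"
    unfolding srw_space_def
    by (rule measurable_compose[OF measurable_component_singleton]) auto
  note Suc [measurable]
  show ?case by simp
qed simp

text \<open>The Markov property at time 1: the law of the increments is invariant under prepending an
independent increment.\<close>

lemma heat_Suc:
  fixes z :: "int ^ 'd::finite"
  shows "heat (Suc n) z = (\<Sum>e | adjacent 0 e. heat n (z - e)) / (2 * CARD('d))"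
proof -
  let ?M = "measure_pmf (pmf_of_set {e :: int ^ 'd. adjacent 0 e})"
  let ?S = "srw_space :: (nat \<Rightarrow> int ^ 'd) measure"
  interpret S: prob_space ?S by (rule prob_space_srw_space)
  let ?A = "\<lambda>n z. {\<omega> \<in> space ?S. (\<Sum>k<n. \<omega> k) = z}"
  have A: "?A n z \<in> sets ?S" for n z by measurable
  have em: "emeasure ?S (?A n z) = ennreal (heat n z)" for n z
    by (simp add: heat_def S.emeasure_eq_measure)
  have iter: "?S = distr (?M \<Otimes>\<^sub>M ?S) ?S (\<lambda>(s, \<omega>). case_nat s \<omega>)"
    unfolding srw_space_def by (rule srw.PiM_iter[symmetric])
  have meas: "(\<lambda>(s, \<omega>). case_nat s \<omega>) \<in> measurable (?M \<Otimes>\<^sub>M ?S) ?S"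
    unfolding srw_space_def by measurable
  have "emeasure ?S (?A (Suc n) z) = emeasure (distr (?M \<Otimes>\<^sub>M ?S) ?S (\<lambda>(s, \<omega>). case_nat s \<omega>)) (?A (Suc n) z)"
    using iter by simp
  also have "\<dots> = emeasure (?M \<Otimes>\<^sub>M ?S) ((\<lambda>(s, \<omega>). case_nat s \<omega>) -` ?A (Suc n) z \<inter> space (?M \<Otimes>\<^sub>M ?S))"
    by (rule emeasure_distr[OF meas A])
  also have "\<dots> = (\<integral>\<^sup>+s. emeasure ?S (Pair s -` ((\<lambda>(s, \<omega>). case_nat s \<omega>) -` ?A (Suc n) z \<inter> space (?M \<Otimes>\<^sub>M ?S))) \<partial>?M)"
    by (rule S.emeasure_pair_measure_alt[OF measurable_sets[OF meas A]])
  also have "\<dots> = (\<integral>\<^sup>+s. emeasure ?S (?A n (z - s)) \<partial>?M)"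
  proof (intro nn_integral_cong arg_cong2[where f=emeasure] refl)
    fix s
    have "s + x = z \<longleftrightarrow> x = z - s" for x by (auto simp: algebra_simps)
    then show "Pair s -` ((\<lambda>(s, \<omega>). case_nat s \<omega>) -` ?A (Suc n) z \<inter> space (?M \<Otimes>\<^sub>M ?S)) = ?A n (z - s)"
      by (auto simp: space_pair_measure sum.lessThan_Suc_shift simp del: sum.lessThan_Suc)
  qed
  also have "\<dots> = (\<Sum>e | adjacent 0 e. ennreal (heat n (z - e))) / ennreal (2 * CARD('d))"
    unfolding em
  proof (subst nn_integral_pmf_of_set)
    show "{e :: int ^ 'd. adjacent 0 e} \<noteq> {}" unfolding neighbours_eq by auto
  qed (auto simp: finite_neighbours card_neighbours ennreal_of_nat_eq_real_of_nat)
  also have "\<dots> = ennreal ((\<Sum>e | adjacent 0 e. heat n (z - e)) / (2 * CARD('d)))"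
    by (subst sum_ennreal) (auto simp: heat_nonneg divide_ennreal sum_nonneg)
  finally show ?thesis unfolding em
    by (subst (asm) ennreal_inj) (auto intro!: heat_nonneg divide_nonneg_nonneg sum_nonneg)
qed

lemma heat_Suc_axis:
  fixes z :: "int ^ 'd::finite"
  shows "heat (Suc n) z = (\<Sum>i\<in>UNIV. heat n (z - axis i 1) + heat n (z + axis i 1)) / (2 * CARD('d))"
proof -
  have "z - axis i (-1) = z + axis i 1" for i :: 'd
    by (simp add: vec_eq_iff axis_def)
  then show ?thesis by (simp only: heat_Suc sum_neighbours)
qed

section \<open>The one-dimensional walk\<close>

text \<open>The law after \<open>m\<close> steps of simple random walk on the integers started at 0.\<close>

primrec srw1 :: "nat \<Rightarrow> int \<Rightarrow> real" where
  "srw1 0 y = (if y = 0 then 1 else 0)"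
| "srw1 (Suc m) y = (srw1 m (y - 1) + srw1 m (y + 1)) / 2"

lemma srw1_nonneg: "0 \<le> srw1 m y"
  by (induction m arbitrary: y) auto

lemma srw1_eq_0_far: "int m < y \<Longrightarrow> srw1 m y = 0"
  by (induction m arbitrary: y) auto

lemma srw1_eq_0_odd: "odd (int m - y) \<Longrightarrow> srw1 m y = 0"
  by (induction m arbitrary: y) auto

lemma srw1_binomial: "srw1 m (int m - 2 * int k) = real (m choose k) / 2 ^ m"
proof (induction m arbitrary: k)
  case 0
  then show ?case by (cases k) auto
next
  case (Suc m)
  have 1: "srw1 m (int (Suc m) - 2 * int k - 1) = real (m choose k) / 2 ^ m"
    using Suc[of k] by simp
  show ?case
  proof (cases k)
    case 0
    then show ?thesis using 1 by (simp add: srw1_eq_0_far)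
  next
    case (Suc j)
    then have e: "int (Suc m) - 2 * int k + 1 = int m - 2 * int j" by simp
    have 2: "srw1 m (int (Suc m) - 2 * int k + 1) = real (m choose j) / 2 ^ m"
      unfolding e by (rule Suc.IH)
    show ?thesis unfolding srw1.simps 1 2 unfolding Suc by (simp add: field_simps)
  qed
qed

lemma odd_binomial_middle: "(2 * n + 1) choose Suc n = (2 * n + 1) choose n"
  using binomial_symmetric[of n "2 * n + 1"] by (simp add: mult_2 del: binomial_Suc_Suc)

lemma central_binomial_step:
  "(real n + 1) * real ((2 * Suc n) choose Suc n) = 2 * (2 * real n + 1) * real ((2 * n) choose n)"
proof -
  define X where "X = (2 * Suc n) choose Suc n"
  define Y where "Y = (2 * n) choose n"
  define Z where "Z = (2 * n + 1) choose n"
  have a: "Suc n * X = (2 * n + 2) * Z"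
    using Suc_times_binomial_eq[of "2 * n + 1" n] by (simp add: X_def Z_def mult.commute del: binomial_Suc_Suc)
  have b: "Suc n * Z = (2 * n + 1) * Y"
    using Suc_times_binomial_eq[of "2 * n" n] odd_binomial_middle[of n]
    by (simp add: Z_def Y_def mult.commute del: binomial_Suc_Suc)
  have "Suc n * X = 2 * ((2 * n + 1) * Y)" using a b by simp
  then have "real (Suc n * X) = real (2 * ((2 * n + 1) * Y))" by (simp only:)
  then have "(real n + 1) * real X = 2 * (2 * real n + 1) * real Y"
    by (simp add: algebra_simps)
  then show ?thesis by (simp only: X_def Y_def)
qed

text \<open>In the induction step the ratio of consecutive central binomial coefficients is compared with 4
through \<open>(2 n + 1) (2 n + 3) \<le> (2 n + 2)\<^sup>2\<close>.\<close>

lemma central_binomial_le: "(2 * real n + 1) * (real ((2 * n) choose n))\<^sup>2 \<le> 16 ^ n"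
proof (induction n)
  case (Suc n)
  define c where "c = real ((2 * n) choose n)"
  define c' where "c' = real ((2 * Suc n) choose Suc n)"
  define x where "x = real n"
  have s: "(x + 1) * c' = 2 * (2 * x + 1) * c"
    unfolding c_def c'_def x_def by (rule central_binomial_step)
  have x0: "0 \<le> x" by (simp add: x_def)
  have IH: "(2 * x + 1) * c\<^sup>2 \<le> 16 ^ n" using Suc by (simp only: c_def x_def)
  have "(x + 1)\<^sup>2 * ((2 * x + 3) * c'\<^sup>2) = (2 * x + 3) * ((x + 1) * c')\<^sup>2"
    by (simp add: power_mult_distrib)
  also have "\<dots> = 4 * ((2 * x + 3) * (2 * x + 1)) * ((2 * x + 1) * c\<^sup>2)"
    unfolding s by (simp add: power2_eq_square algebra_simps)
  also have "\<dots> \<le> 4 * ((2 * x + 3) * (2 * x + 1)) * 16 ^ n"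
    using x0 by (intro mult_left_mono IH) auto
  also have "\<dots> \<le> 4 * (4 * (x + 1)\<^sup>2) * 16 ^ n"
    by (intro mult_right_mono mult_left_mono) (auto simp: power2_eq_square algebra_simps)
  also have "\<dots> = (x + 1)\<^sup>2 * 16 ^ Suc n" by simp
  finally have "(2 * x + 3) * c'\<^sup>2 \<le> 16 ^ Suc n"
    using x0 by (subst (asm) mult_le_cancel_left_pos) auto
  moreover have "2 * x + 3 = 2 * real (Suc n) + 1" by (simp add: x_def)
  ultimately show ?case by (simp only: c'_def)
qed simp

text \<open>An odd row reduces to the next even one, since its two middle coefficients are equal and add up to
the central coefficient below.\<close>

lemma middle_binomial_le: "(real m + 1) * (real (m choose (m div 2)))\<^sup>2 \<le> 4 ^ m"
proof (cases "even m")
  case True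
  then obtain n where m: "m = 2 * n" by (rule evenE)
  have "(4::real) ^ (2 * n) = 16 ^ n" by (simp add: power_mult)
  with central_binomial_le[of n] show ?thesis by (simp add: m)
next
  case False
  then obtain n where m: "m = 2 * n + 1" by (rule oddE)
  define Z where "Z = real ((2 * n + 1) choose n)"
  have "(2 * Suc n) choose Suc n = ((2 * n + 1) choose n) + ((2 * n + 1) choose Suc n)"
    using binomial_Suc_Suc[of "2 * n + 1" n] by (simp del: binomial_Suc_Suc)
  then have d: "real ((2 * Suc n) choose Suc n) = 2 * Z"
    unfolding odd_binomial_middle Z_def by simp
  have "(real m + 1) * Z\<^sup>2 \<le> (2 * real (Suc n) + 1) * Z\<^sup>2"
    by (intro mult_right_mono) (auto simp: m)
  also have "\<dots> = (2 * real (Suc n) + 1) * (2 * Z)\<^sup>2 / 4"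
    by (simp add: power_mult_distrib)
  also have "\<dots> \<le> 16 ^ Suc n / 4"
    using central_binomial_le[of "Suc n"] unfolding d by (intro divide_right_mono) auto
  also have "\<dots> = 4 ^ m" by (simp add: m power_mult)
  finally show ?thesis by (simp add: m Z_def)
qed

text \<open>The bound is uniform in the endpoint because no binomial coefficient exceeds the middle one.\<close>

lemma srw1_le: "srw1 m y \<le> 1 / sqrt (real m + 1)"
proof -
  have "srw1 m y \<le> real (m choose (m div 2)) / 2 ^ m"
  proof -
    consider "odd (int m - y)" | "int m < y" | k where "y = int m - 2 * int k"
    proof (cases "even (int m - y) \<and> y \<le> int m")
      case True
      then obtain j where "int m - y = 2 * j" by (meson dvdE)
      with True have "y = int m - 2 * int (nat j)" by auto
      then show thesis using that by blast
    qed (use that in auto)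
    then show ?thesis
    proof cases
      case 3
      have "srw1 m y = real (m choose k) / 2 ^ m" unfolding 3 by (rule srw1_binomial)
      also have "\<dots> \<le> real (m choose (m div 2)) / 2 ^ m"
        by (intro divide_right_mono) (use binomial_maximum[of m k] in auto)
      finally show ?thesis .
    qed (auto simp: srw1_eq_0_far srw1_eq_0_odd)
  qed
  also have "\<dots> \<le> 1 / sqrt (real m + 1)"
  proof -
    have "sqrt (real m + 1) * real (m choose (m div 2)) = sqrt (real (m + 1) * (real (m choose (m div 2)))\<^sup>2)"
      by (simp add: real_sqrt_mult)
    also have "\<dots> \<le> sqrt (4 ^ m)" using middle_binomial_le[of m] by (intro real_sqrt_le_mono) (simp add: add.commute)
    also have "(4::real) ^ m = (2 ^ m)\<^sup>2" by (simp add: power2_eq_square flip: power_mult_distrib)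
    finally have "sqrt (real m + 1) * real (m choose (m div 2)) \<le> 2 ^ m" by simp
    then show ?thesis by (simp add: field_simps)
  qed
  finally show ?thesis .
qed

lemma srw1_le_1: "srw1 m y \<le> 1"
proof -
  have "1 / sqrt (real m + 1) \<le> 1" by simp
  then show ?thesis using srw1_le[of m y] by linarith
qed

section \<open>Heat kernel decay in dimension at least three\<close>

text \<open>The expectation of \<open>f\<close> over the numbers of steps along the coordinate axes, when each of \<open>n\<close> steps
chooses its axis independently and uniformly.\<close>

primrec axis_avg :: "nat \<Rightarrow> (('d::finite \<Rightarrow> nat) \<Rightarrow> real) \<Rightarrow> real" where
  "axis_avg 0 f = f (\<lambda>_. 0)"
| "axis_avg (Suc n) f = (\<Sum>i\<in>UNIV. axis_avg n (\<lambda>c. f (c(i := Suc (c i))))) / CARD('d)"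

lemma axis_avg_add: "axis_avg n (\<lambda>c. f c + g c) = axis_avg n f + axis_avg n g"
  by (induction n arbitrary: f g) (simp_all add: sum.distrib add_divide_distrib)

lemma axis_avg_cmult: "axis_avg n (\<lambda>c. r * f c) = r * axis_avg n f"
  by (induction n arbitrary: f) (simp_all add: sum_distrib_left)

lemma axis_avg_const: "axis_avg n (\<lambda>c. r) = r"
  by (induction n) simp_all

lemma axis_avg_mono: "(\<And>c. f c \<le> g c) \<Longrightarrow> axis_avg n f \<le> axis_avg n g"
  by (induction n arbitrary: f g) (auto intro!: divide_right_mono sum_mono)

abbreviation walk_prod :: "('d::finite \<Rightarrow> nat) \<Rightarrow> int ^ 'd \<Rightarrow> real" where
  "walk_prod c z \<equiv> \<Prod>i\<in>UNIV. srw1 (c i) (z $ i)"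

text \<open>Given how many steps are taken along each axis, the coordinates of the walk are independent
one-dimensional walks.\<close>

lemma heat_eq_axis_avg:
  fixes z :: "int ^ 'd::finite"
  shows "heat n z = axis_avg n (\<lambda>c. walk_prod c z)"
proof (induction n arbitrary: z)
  case 0
  have "(\<Prod>i\<in>UNIV. srw1 0 (z $ i)) = (if z = 0 then 1 else 0)"
    by (auto simp: vec_eq_iff)
  then show ?case by (simp add: heat_0 del: srw1.simps)
next
  case (Suc n)
  have step: "(\<Prod>j\<in>UNIV. srw1 ((c(i := Suc (c i))) j) (z $ j)) =
      (walk_prod c (z - axis i 1) + walk_prod c (z + axis i 1)) / 2" for i c
  proof -
    have split: "(\<Prod>j\<in>UNIV. g j) = g i * (\<Prod>j\<in>UNIV - {i}. g j)" for g :: "'d \<Rightarrow> real"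
      by (rule prod.remove) auto
    have r: "(\<Prod>j\<in>UNIV - {i}. srw1 ((c(i := Suc (c i))) j) (z $ j)) = (\<Prod>j\<in>UNIV - {i}. srw1 (c j) (z $ j))"
      "(\<Prod>j\<in>UNIV - {i}. srw1 (c j) ((z - axis i 1) $ j)) = (\<Prod>j\<in>UNIV - {i}. srw1 (c j) (z $ j))"
      "(\<Prod>j\<in>UNIV - {i}. srw1 (c j) ((z + axis i 1) $ j)) = (\<Prod>j\<in>UNIV - {i}. srw1 (c j) (z $ j))"
      by (auto intro!: prod.cong simp: axis_def)
    show ?thesis unfolding split r by (simp add: axis_def algebra_simps add_divide_distrib)
  qed
  have "axis_avg (Suc n) (\<lambda>c. walk_prod c z)
      = (\<Sum>i\<in>UNIV. axis_avg n (\<lambda>c. 1/2 * (walk_prod c (z - axis i 1) + walk_prod c (z + axis i 1)))) / CARD('d)"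
    by (simp only: axis_avg.simps step) simp
  also have "\<dots> = (\<Sum>i\<in>UNIV. 1/2 * (heat n (z - axis i 1) + heat n (z + axis i 1))) / CARD('d)"
    unfolding axis_avg_cmult axis_avg_add Suc ..
  also have "\<dots> = heat (Suc n) z"
    unfolding heat_Suc_axis sum_distrib_left[symmetric] by simp
  finally show ?case ..
qed

lemma axis_avg_coord_Suc:
  fixes i :: "'d::finite"
  shows "axis_avg (Suc n) (\<lambda>c. f (c i)) =
    (axis_avg n (\<lambda>c. f (Suc (c i))) + (real CARD('d) - 1) * axis_avg n (\<lambda>c. f (c i))) / CARD('d)"
proof -
  have "(\<Sum>j\<in>UNIV. axis_avg n (\<lambda>c. f ((c(j := Suc (c j))) i)))
     = axis_avg n (\<lambda>c. f (Suc (c i))) + (\<Sum>j\<in>UNIV - {i}. axis_avg n (\<lambda>c. f (c i)))"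
    by (subst sum.remove[of _ i]) (auto intro!: sum.cong)
  also have "(\<Sum>j\<in>UNIV - {i}. axis_avg n (\<lambda>c. f (c i))) = (real CARD('d) - 1) * axis_avg n (\<lambda>c. f (c i))"
    by (simp add: of_nat_diff)
  finally show ?thesis by simp
qed

text \<open>The size-bias identity \<open>E (N f N) = n p E (f (N' + 1))\<close> of a binomial \<open>N\<close> with \<open>n\<close> trials, where
\<open>N'\<close> has one trial less and \<open>p = 1 / CARD('d)\<close>.  With \<open>f\<close> a reciprocal it yields the inverse moments
below without computing any binomial sum.\<close>

lemma axis_avg_size_bias:
  fixes i :: "'d::finite"
  shows "real CARD('d) * axis_avg (Suc n) (\<lambda>c. real (c i) * f (c i)) = real (Suc n) * axis_avg n (\<lambda>c. f (Suc (c i)))"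
proof (induction n arbitrary: f)
  case 0
  show ?case by (subst axis_avg_coord_Suc[of 0 "\<lambda>k. real k * f k"]) simp
next
  case (Suc n)
  define D where "D = real CARD('d)"
  have D: "D > 0" by (simp add: D_def)
  let ?e = "\<lambda>n f. axis_avg n (\<lambda>c. f (c i))"
  have 1: "D * ?e (Suc (Suc n)) (\<lambda>k. real k * f k) =
     ?e (Suc n) (\<lambda>k. real (Suc k) * f (Suc k)) + (D - 1) * ?e (Suc n) (\<lambda>k. real k * f k)"
    unfolding axis_avg_coord_Suc[of "Suc n" "\<lambda>k. real k * f k"] D_def by simp
  have 2: "?e (Suc n) (\<lambda>k. real (Suc k) * f (Suc k)) = ?e (Suc n) (\<lambda>k. real k * f (Suc k)) + ?e (Suc n) (\<lambda>k. f (Suc k))"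
    by (subst axis_avg_add[symmetric]) (simp add: algebra_simps)
  have 3: "D * ?e (Suc n) (\<lambda>k. real k * f (Suc k)) = real (Suc n) * ?e n (\<lambda>k. f (Suc (Suc k)))"
    unfolding D_def by (rule Suc)
  have 4: "D * ?e (Suc n) (\<lambda>k. real k * f k) = real (Suc n) * ?e n (\<lambda>k. f (Suc k))"
    unfolding D_def by (rule Suc)
  have 5: "D * ?e (Suc n) (\<lambda>k. f (Suc k)) = ?e n (\<lambda>k. f (Suc (Suc k))) + (D - 1) * ?e n (\<lambda>k. f (Suc k))"
    unfolding axis_avg_coord_Suc[of n "\<lambda>k. f (Suc k)"] D_def by simp
  have "D * (D * ?e (Suc (Suc n)) (\<lambda>k. real k * f k)) =
     D * ?e (Suc n) (\<lambda>k. real k * f (Suc k)) + D * ?e (Suc n) (\<lambda>k. f (Suc k)) + (D - 1) * (D * ?e (Suc n) (\<lambda>k. real k * f k))"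
    unfolding 1 2 by (simp add: algebra_simps del: axis_avg.simps)
  also have "\<dots> = real (Suc n) * (?e n (\<lambda>k. f (Suc (Suc k))) + (D - 1) * ?e n (\<lambda>k. f (Suc k))) + D * ?e (Suc n) (\<lambda>k. f (Suc k))"
    unfolding 3 4 by (simp add: algebra_simps del: axis_avg.simps)
  also have "\<dots> = D * (real (Suc (Suc n)) * ?e (Suc n) (\<lambda>k. f (Suc k)))"
    unfolding 5[symmetric] by (simp add: algebra_simps del: axis_avg.simps)
  finally show ?case using D unfolding D_def[symmetric] by simp
qed

lemma axis_avg_inverse_le:
  fixes i :: "'d::finite"
  shows "axis_avg n (\<lambda>c. 1 / (real (c i) + 1)) \<le> real CARD('d) / (real n + 1)"
proof -
  have "real (Suc n) * axis_avg n (\<lambda>c. 1 / real (Suc (c i))) = real CARD('d) * axis_avg (Suc n) (\<lambda>c. real (c i) * (1 / real (c i)))"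
    by (rule axis_avg_size_bias[symmetric])
  also have "\<dots> \<le> real CARD('d) * axis_avg (Suc n) (\<lambda>c :: 'd \<Rightarrow> nat. 1)"
    by (intro mult_left_mono axis_avg_mono) auto
  finally show ?thesis unfolding axis_avg_const by (simp add: field_simps)
qed

lemma axis_avg_inverse2_le:
  fixes i :: "'d::finite"
  shows "axis_avg n (\<lambda>c. 1 / ((real (c i) + 1) * (real (c i) + 2))) \<le> (real CARD('d))\<^sup>2 / ((real n + 1) * (real n + 2))"
proof -
  let ?f = "\<lambda>k. 1 / (real k * (real k + 1))"
  have "real (Suc n) * axis_avg n (\<lambda>c. ?f (Suc (c i))) = real CARD('d) * axis_avg (Suc n) (\<lambda>c. real (c i) * ?f (c i))"
    by (rule axis_avg_size_bias[symmetric])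
  also have "\<dots> \<le> real CARD('d) * axis_avg (Suc n) (\<lambda>c. 1 / (real (c i) + 1))"
    by (intro mult_left_mono axis_avg_mono) (auto simp del: axis_avg.simps)
  also have "\<dots> \<le> real CARD('d) * (real CARD('d) / (real (Suc n) + 1))"
    by (intro mult_left_mono axis_avg_inverse_le) auto
  also have "(\<lambda>c. ?f (Suc (c i))) = (\<lambda>c. 1 / ((real (c i) + 1) * (real (c i) + 2)))"
    by (simp add: add.commute)
  finally have "(real n + 1) * axis_avg n (\<lambda>c. 1 / ((real (c i) + 1) * (real (c i) + 2)))
      \<le> (real CARD('d))\<^sup>2 / (real n + 2)"
    by (simp add: power2_eq_square add.commute)
  moreover have "x \<le> q / (a * b)" if "a * x \<le> q / b" "0 < a" "0 < b" for x q a b :: real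
    using that by (simp add: pos_le_divide_eq mult.assoc mult.left_commute mult.commute)
  ultimately show ?thesis by simp
qed

lemma amgm3:
  fixes x y z :: real
  assumes "0 \<le> x" "0 \<le> y" "0 \<le> z"
  shows "x * y * z \<le> (x ^ 3 + y ^ 3 + z ^ 3) / 3"
proof -
  have "0 \<le> (x + y + z) * ((x - y)\<^sup>2 + (y - z)\<^sup>2 + (x - z)\<^sup>2) / 2"
    using assms by (intro divide_nonneg_nonneg mult_nonneg_nonneg add_nonneg_nonneg) auto
  also have "\<dots> = x ^ 3 + y ^ 3 + z ^ 3 - 3 * (x * y * z)"
    by (simp add: power2_eq_square power3_eq_cube field_simps)
  finally show ?thesis by simp
qed

text \<open>The exponent \<open>3/2\<close> is interpolated between the inverse moments of order 1 and 2.  The parameter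
\<open>r\<close> will be the square root of \<open>n + 1\<close> after \<open>n\<close> steps, which balances the two terms.\<close>

lemma inverse_sqrt_cube_le:
  assumes "0 < r"
  shows "(1 / sqrt (real k + 1)) ^ 3 \<le> r * (1 / ((real k + 1) * (real k + 2))) + 1 / (2 * r) * (1 / (real k + 1))"
proof -
  define a where "a = 1 / sqrt (real k + 1)"
  have a2: "a\<^sup>2 = 1 / (real k + 1)" by (simp add: a_def power_divide)
  have "0 \<le> a\<^sup>2 * ((a * r - 1)\<^sup>2 / (2 * r))" using assms by simp
  also have "\<dots> = r / 2 * (a\<^sup>2)\<^sup>2 + 1 / (2 * r) * a\<^sup>2 - a ^ 3"
    using assms by (simp add: power2_eq_square power3_eq_cube field_simps)
  finally have "a ^ 3 \<le> r / 2 * (a\<^sup>2)\<^sup>2 + 1 / (2 * r) * a\<^sup>2" by simp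
  moreover have "r / 2 * (a\<^sup>2)\<^sup>2 \<le> r * (1 / ((real k + 1) * (real k + 2)))"
  proof -
    have "(a\<^sup>2)\<^sup>2 / 2 = 1 / ((real k + 1) * (2 * (real k + 1)))"
      unfolding a2 by (simp add: power2_eq_square)
    also have "\<dots> \<le> 1 / ((real k + 1) * (real k + 2))"
      by (intro divide_left_mono mult_left_mono mult_pos_pos) auto
    finally have "r * ((a\<^sup>2)\<^sup>2 / 2) \<le> r * (1 / ((real k + 1) * (real k + 2)))"
      using assms by (intro mult_left_mono) auto
    then show ?thesis by simp
  qed
  ultimately have "a ^ 3 \<le> r * (1 / ((real k + 1) * (real k + 2))) + 1 / (2 * r) * a\<^sup>2" by linarith
  then show ?thesis unfolding a2 unfolding a_def .
qed

lemma axis_avg_cube_le: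
  fixes i :: "'d::finite"
  shows "axis_avg n (\<lambda>c. (1 / sqrt (real (c i) + 1)) ^ 3) \<le> 2 * (real CARD('d))\<^sup>2 / ((real n + 1) * sqrt (real n + 1))"
proof -
  define r where "r = sqrt (real n + 1)"
  define D where "D = real CARD('d)"
  have r: "0 < r" by (simp add: r_def)
  have r2: "real n + 1 = r * r" by (simp add: r_def)
  have D1: "1 \<le> D" by (simp add: D_def Suc_leI)
  have "axis_avg n (\<lambda>c. (1 / sqrt (real (c i) + 1)) ^ 3)
     \<le> axis_avg n (\<lambda>c. r * (1 / ((real (c i) + 1) * (real (c i) + 2))) + 1 / (2 * r) * (1 / (real (c i) + 1)))"
    by (intro axis_avg_mono inverse_sqrt_cube_le r)
  also have "\<dots> = r * axis_avg n (\<lambda>c. 1 / ((real (c i) + 1) * (real (c i) + 2))) + 1 / (2 * r) * axis_avg n (\<lambda>c. 1 / (real (c i) + 1))"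
    unfolding axis_avg_add axis_avg_cmult ..
  also have "\<dots> \<le> r * (D\<^sup>2 / ((real n + 1) * (real n + 2))) + 1 / (2 * r) * (D / (real n + 1))"
    unfolding D_def by (intro add_mono mult_left_mono axis_avg_inverse_le axis_avg_inverse2_le) (use r in auto)
  also have "r * (D\<^sup>2 / ((real n + 1) * (real n + 2))) \<le> r * (D\<^sup>2 / ((real n + 1) * (real n + 1)))"
    using r by (intro mult_left_mono divide_left_mono mult_pos_pos) auto
  also have "\<dots> = D\<^sup>2 / ((real n + 1) * r)"
    unfolding r2 using r by (simp add: field_simps)
  also have "1 / (2 * r) * (D / (real n + 1)) \<le> D\<^sup>2 / ((real n + 1) * r)"
  proof -
    have "D \<le> 2 * D\<^sup>2" using D1 self_le_power[of D 2] by simp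
    then have "D / (2 * ((real n + 1) * r)) \<le> 2 * D\<^sup>2 / (2 * ((real n + 1) * r))"
      using r by (intro divide_right_mono) auto
    also have "\<dots> = D\<^sup>2 / ((real n + 1) * r)" by (rule mult_divide_mult_cancel_left) simp
    finally show ?thesis by (simp add: mult_ac)
  qed
  finally show ?thesis by (simp add: r_def D_def)
qed

text \<open>Three coordinates suffice: by the inequality of arithmetic and geometric means the product of three
one-dimensional transition probabilities, each at most \<open>1 / sqrt (N + 1)\<close> in terms of its number
\<open>N\<close> of steps, is bounded by inverse moments of order \<open>3/2\<close> of single step counts.\<close>

lemma heat_le:
  fixes z :: "int ^ 'd::finite"
  assumes "3 \<le> CARD('d)"
  shows "heat n z \<le> 2 * (real CARD('d))\<^sup>2 / ((real n + 1) * sqrt (real n + 1))" (is "_ \<le> ?C")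
proof -
  \<comment> \<open>the three coordinates that are kept; the others contribute factors at most 1\<close>
  obtain T :: "'d set" where T: "card T = 3"
    using assms obtain_subset_with_card_n[of 3 UNIV] by metis
  then obtain i j k where ijk: "T = {i, j, k}" "i \<noteq> j" "j \<noteq> k" "i \<noteq> k"
    by (auto simp: card_3_iff)
  let ?s = "\<lambda>m. 1 / sqrt (real m + 1)"
  have prod_le: "walk_prod c z \<le> 1 / 3 * ((?s (c i)) ^ 3 + (?s (c j)) ^ 3 + (?s (c k)) ^ 3)" for c
  proof -
    have "walk_prod c z = (\<Prod>l\<in>T. srw1 (c l) (z $ l)) * (\<Prod>l\<in>UNIV - T. srw1 (c l) (z $ l))"
      by (metis finite mult.commute prod.subset_diff subset_UNIV)
    also have "\<dots> \<le> (\<Prod>l\<in>T. ?s (c l)) * (\<Prod>l\<in>UNIV - T. 1)"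
      by (intro mult_mono prod_mono prod_nonneg) (auto simp: srw1_nonneg srw1_le srw1_le_1)
    also have "\<dots> = ?s (c i) * ?s (c j) * ?s (c k)" using ijk by simp
    also have "\<dots> \<le> 1 / 3 * ((?s (c i)) ^ 3 + (?s (c j)) ^ 3 + (?s (c k)) ^ 3)"
      using amgm3[of "?s (c i)" "?s (c j)" "?s (c k)"] by simp
    finally show ?thesis .
  qed
  have "heat n z \<le> axis_avg n (\<lambda>c. 1 / 3 * ((?s (c i)) ^ 3 + (?s (c j)) ^ 3 + (?s (c k)) ^ 3))"
    unfolding heat_eq_axis_avg by (intro axis_avg_mono prod_le)
  also have "\<dots> = 1 / 3 * (axis_avg n (\<lambda>c. (?s (c i)) ^ 3) + axis_avg n (\<lambda>c. (?s (c j)) ^ 3) + axis_avg n (\<lambda>c. (?s (c k)) ^ 3))"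
    unfolding axis_avg_cmult axis_avg_add ..
  also have "\<dots> \<le> 1 / 3 * (?C + ?C + ?C)"
    by (intro mult_left_mono add_mono axis_avg_cube_le) auto
  finally show ?thesis by simp
qed

lemma inverse_sqrt_telescope:
  assumes "1 \<le> k"
  shows "1 / ((real k + 1) * sqrt (real k + 1)) \<le> 2 * (1 / sqrt (real k) - 1 / sqrt (real (Suc k)))"
proof -
  define a where "a = sqrt (real k)"
  define b where "b = sqrt (real k + 1)"
  have ab: "0 < a" "a \<le> b" "b\<^sup>2 = real k + 1" "b\<^sup>2 - a\<^sup>2 = 1" using assms by (auto simp: a_def b_def)
  then have b: "0 < b" by linarith
  have "(b - a) * (b + a) = 1" using ab(4) by (simp add: power2_eq_square algebra_simps)
  then have d: "b - a = 1 / (b + a)" using ab b by (simp add: field_simps)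
  have "1 / (b * b * b) \<le> 1 / (a * b * ((b + a) / 2))"
    using ab b by (intro divide_left_mono mult_mono mult_pos_pos) auto
  also have "\<dots> = 2 * ((b - a) / (a * b))" unfolding d using ab b by simp
  also have "\<dots> = 2 * (1 / a - 1 / b)" using ab b by (simp add: field_simps)
  finally show ?thesis using ab by (simp add: a_def b_def power2_eq_square add.commute)
qed

text \<open>Comparison with a telescoping series.\<close>

lemma
  fixes z :: "int ^ 'd::finite"
  assumes d: "3 \<le> CARD('d)"
  shows summable_heat: "summable (\<lambda>n. heat n z)"
    and heat_tail_le: "1 \<le> N \<Longrightarrow> (\<Sum>n. heat (n + N) z) \<le> 4 * (real CARD('d))\<^sup>2 / sqrt (real N)"
proof -
  define C where "C = 2 * (real CARD('d))\<^sup>2"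
  have C: "0 \<le> C" by (simp add: C_def)
  have tail: "summable (\<lambda>n. heat (n + N) z) \<and> (\<Sum>n. heat (n + N) z) \<le> 2 * C / sqrt (real N)" if N: "1 \<le> N" for N
  proof -
    let ?b = "\<lambda>n. 2 * C * (1 / sqrt (real (n + N)) - 1 / sqrt (real (Suc n + N)))"
    have lim: "(\<lambda>n. 1 / sqrt (real (n + N))) \<longlonglongrightarrow> 0" by real_asymp
    have "(\<lambda>n. 1 / sqrt (real (n + N)) - 1 / sqrt (real (Suc n + N))) sums (1 / sqrt (real (0 + N)) - 0)"
      by (rule telescope_sums'[OF lim])
    then have sums: "?b sums (2 * C * (1 / sqrt (real N)))" by (intro sums_mult) simp
    have le: "heat (n + N) z \<le> ?b n" for n
    proof -
      have "heat (n + N) z \<le> C * (1 / ((real (n + N) + 1) * sqrt (real (n + N) + 1)))"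
        using heat_le[OF d, of "n + N" z] by (simp add: C_def)
      also have "\<dots> \<le> C * (2 * (1 / sqrt (real (n + N)) - 1 / sqrt (real (Suc (n + N)))))"
        by (intro mult_left_mono inverse_sqrt_telescope C) (use N in auto)
      finally show ?thesis by (simp only: mult.left_commute mult.assoc add_Suc)
    qed
    have s: "summable (\<lambda>n. heat (n + N) z)"
      by (rule summable_comparison_test'[OF sums_summable[OF sums], of 0]) (use le in \<open>auto simp: heat_nonneg\<close>)
    have "(\<Sum>n. heat (n + N) z) \<le> suminf ?b"
      by (intro suminf_le le s sums_summable[OF sums])
    also have "\<dots> = 2 * C / sqrt (real N)" using sums_unique[OF sums] by simp
    finally show ?thesis using s by blast
  qed
  show "summable (\<lambda>n. heat n z)" using tail[of 1] summable_iff_shift[of "\<lambda>n. heat n z" 1] by blast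
  show "1 \<le> N \<Longrightarrow> (\<Sum>n. heat (n + N) z) \<le> 4 * (real CARD('d))\<^sup>2 / sqrt (real N)"
    using tail[of N] by (simp add: C_def)
qed

lemma heat_eq_0_far:
  fixes z :: "int ^ 'd::finite"
  shows "int n < sup_norm z \<Longrightarrow> heat n z = 0"
proof (induction n arbitrary: z)
  case 0
  then show ?case by (auto simp: heat_0)
next
  case (Suc n)
  have "heat n (z - e) = 0" if "adjacent 0 e" for e
  proof (rule Suc.IH)
    have "sup_norm z \<le> sup_norm (z - e) + sup_norm e"
      using sup_norm_triangle[of "z - e" e] by simp
    moreover have "sup_norm e \<le> 1" using adjacent_sup_norm_le[OF that] sup_norm_minus_commute[of 0 e] by simp
    ultimately show "int n < sup_norm (z - e)" using Suc.prems by simp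
  qed
  then show ?case by (simp add: heat_Suc)
qed

section \<open>Splitting the Green function into two covariances\<close>

abbreviation cov_form :: "'x set \<Rightarrow> ('x \<Rightarrow> 'x \<Rightarrow> real) \<Rightarrow> ('x \<Rightarrow> real) \<Rightarrow> real" where
  "cov_form V C a \<equiv> \<Sum>x\<in>V. \<Sum>y\<in>V. a x * a y * C x y"

definition psd_on :: "'x set \<Rightarrow> ('x \<Rightarrow> 'x \<Rightarrow> real) \<Rightarrow> bool" where
  "psd_on V C \<longleftrightarrow> (\<forall>x\<in>V. \<forall>y\<in>V. C x y = C y x) \<and> (\<forall>a. 0 \<le> cov_form V C a)"

lemma psd_on_sym: "psd_on V C \<Longrightarrow> x \<in> V \<Longrightarrow> y \<in> V \<Longrightarrow> C x y = C y x"
  by (simp add: psd_on_def)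

lemma psd_on_nonneg: "psd_on V C \<Longrightarrow> 0 \<le> cov_form V C a"
  by (simp only: psd_on_def)

lemma heat_Suc_plus:
  fixes z :: "int ^ 'd::finite"
  shows "heat (Suc n) z = (\<Sum>e | adjacent 0 e. heat n (z + e)) / (2 * CARD('d))"
proof -
  have "z + axis i (-1) = z - axis i 1" for i :: 'd
    by (simp add: vec_eq_iff axis_def)
  then show ?thesis by (simp only: heat_Suc_axis sum_neighbours add.commute)
qed

lemma heat_minus: "heat n (- z) = heat n z"
proof (induction n arbitrary: z)
  case (Suc n)
  have "heat n (- z - e) = heat n (z + e)" for e using Suc[of "z + e"] by simp
  then show ?case by (simp only: heat_Suc[of n "- z"] heat_Suc_plus[of n z])
qed (simp add: heat_0)

lemma sum_heat_le_1:
  fixes W :: "(int ^ 'd::finite) set"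
  shows "finite W \<Longrightarrow> (\<Sum>z\<in>W. heat n z) \<le> 1"
proof (induction n arbitrary: W)
  case 0
  then have "(\<Sum>z\<in>W. heat 0 z) = (\<Sum>z\<in>W. if z = 0 then 1 else 0)" by (simp add: heat_0)
  also have "\<dots> \<le> 1" using 0 by simp
  finally show ?case .
next
  case (Suc n)
  have "(\<Sum>z\<in>W. heat (Suc n) z) = (\<Sum>z\<in>W. \<Sum>e | adjacent 0 e. heat n (z - e)) / (2 * CARD('d))"
    by (simp add: heat_Suc sum_divide_distrib)
  also have "(\<Sum>z\<in>W. \<Sum>e | adjacent 0 e. heat n (z - e)) = (\<Sum>e | adjacent 0 e. \<Sum>z\<in>W. heat n (z - e))"
    by (rule sum.swap)
  also have "\<dots> \<le> (\<Sum>e | adjacent 0 (e :: int ^ 'd). 1)"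
  proof (rule sum_mono)
    fix e :: "int ^ 'd"
    have "(\<Sum>z\<in>W. heat n (z - e)) = (\<Sum>z\<in>(\<lambda>z. z - e) ` W. heat n z)"
      by (subst sum.reindex) (auto simp: inj_on_def)
    also have "\<dots> \<le> 1" by (intro Suc.IH finite_imageI Suc.prems)
    finally show "(\<Sum>z\<in>W. heat n (z - e)) \<le> 1" .
  qed
  also have "\<dots> / (2 * CARD('d)) = 1" by (simp add: card_neighbours)
  finally show ?case by (simp add: divide_right_mono)
qed

definition heat_form :: "nat \<Rightarrow> (int ^ 'd::finite) set \<Rightarrow> (int ^ 'd \<Rightarrow> real) \<Rightarrow> real" where
  "heat_form n V a = (\<Sum>x\<in>V. \<Sum>y\<in>V. a x * a y * heat n (y - x))"

lemma heat_form_0: "finite V \<Longrightarrow> heat_form 0 V a = (\<Sum>x\<in>V. (a x)\<^sup>2)"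
proof -
  assume V: "finite V"
  have "(\<Sum>y\<in>V. a x * a y * heat 0 (y - x)) = (a x)\<^sup>2" if "x \<in> V" for x
  proof -
    have "(\<Sum>y\<in>V. a x * a y * heat 0 (y - x)) = (\<Sum>y\<in>V. if y = x then (a x)\<^sup>2 else 0)"
      by (intro sum.cong) (auto simp: heat_0 power2_eq_square)
    then show ?thesis using that V by simp
  qed
  then show ?thesis by (simp add: heat_form_def)
qed

text \<open>The heat kernel is symmetric with row sums at most 1, so the form is bounded in absolute value by the
identity form (Schur test).\<close>

lemma heat_form_ge:
  assumes V: "finite V"
  shows "- heat_form 0 V a \<le> heat_form n V a"
proof -
  have row: "(\<Sum>y\<in>V. heat n (y - x)) \<le> 1" for x
  proof -
    have "(\<Sum>y\<in>V. heat n (y - x)) = (\<Sum>y\<in>(\<lambda>y. y - x) ` V. heat n y)"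
      by (subst sum.reindex) (auto simp: inj_on_def)
    also have "\<dots> \<le> 1" by (intro sum_heat_le_1 finite_imageI V)
    finally show ?thesis .
  qed
  have sym: "heat n (y - x) = heat n (x - y)" for x y :: "int ^ 'a" using heat_minus[of n "x - y"] by simp
  let ?S = "\<Sum>x\<in>V. \<Sum>y\<in>V. (a x)\<^sup>2 * heat n (y - x)"
  have S: "?S \<le> heat_form 0 V a"
    unfolding heat_form_0[OF V] sum_distrib_left[symmetric]
    by (intro sum_mono mult_left_le row) auto
  have S': "(\<Sum>x\<in>V. \<Sum>y\<in>V. (a y)\<^sup>2 * heat n (y - x)) = ?S"
    by (subst sum.swap) (simp only: sym)
  have "- heat_form n V a = (\<Sum>x\<in>V. \<Sum>y\<in>V. - (a x * a y) * heat n (y - x))"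
    by (simp add: heat_form_def sum_negf)
  also have "\<dots> \<le> (\<Sum>x\<in>V. \<Sum>y\<in>V. ((a x)\<^sup>2 + (a y)\<^sup>2) / 2 * heat n (y - x))"
  proof (intro sum_mono mult_right_mono heat_nonneg)
    fix x y
    have "0 \<le> (a x + a y)\<^sup>2" by simp
    then show "- (a x * a y) \<le> ((a x)\<^sup>2 + (a y)\<^sup>2) / 2" by (simp add: power2_eq_square algebra_simps)
  qed
  also have "\<dots> = (\<Sum>x\<in>V. \<Sum>y\<in>V. (a x)\<^sup>2 * heat n (y - x) / 2 + (a y)\<^sup>2 * heat n (y - x) / 2)"
    by (intro sum.cong refl) (simp add: field_simps)
  also have "\<dots> = ?S / 2 + (\<Sum>x\<in>V. \<Sum>y\<in>V. (a y)\<^sup>2 * heat n (y - x)) / 2"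
    by (simp add: sum.distrib sum_divide_distrib)
  also have "\<dots> \<le> heat_form 0 V a" unfolding S' using S by simp
  finally show ?thesis by simp
qed

lemma sum_image_weights:
  fixes w :: "'i \<Rightarrow> real"
  assumes "finite I"
  shows "(\<Sum>x\<in>\<phi> ` I. (\<Sum>i | i \<in> I \<and> \<phi> i = x. w i) * F x) = (\<Sum>i\<in>I. w i * F (\<phi> i))"
proof -
  have "(\<Sum>i\<in>I. w i * F (\<phi> i)) = (\<Sum>x\<in>\<phi> ` I. \<Sum>i | i \<in> I \<and> \<phi> i = x. w i * F (\<phi> i))"
    by (rule sum.image_gen[OF assms])
  also have "\<dots> = (\<Sum>x\<in>\<phi> ` I. (\<Sum>i | i \<in> I \<and> \<phi> i = x. w i) * F x)"
    by (intro sum.cong refl) (auto simp: sum_distrib_right intro!: sum.cong)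
  finally show ?thesis ..
qed

text \<open>Two steps of the walk, one attached to each argument of the form, amount to averaging the
coefficients over the neighbours.  The new set and coefficients are the same for all times; this is
what lets even and odd times be treated together.\<close>

lemma heat_form_shift:
  fixes V :: "(int ^ 'd::finite) set"
  assumes V: "finite V"
  obtains V' :: "(int ^ 'd) set" and a' where "finite V'" "\<And>n. heat_form (Suc (Suc n)) V a = heat_form n V' a'"
proof -
  define N where "N = {e :: int ^ 'd. adjacent 0 e}"
  define D where "D = 2 * real CARD('d)"
  define I where "I = V \<times> N"
  define \<phi> where "\<phi> = (\<lambda>(x :: int ^ 'd, e). x + e)"
  define w where "w = (\<lambda>(x, e :: int ^ 'd). a x / D)"
  have I: "finite I" using V by (simp add: I_def N_def finite_neighbours)
  define a' where "a' x = (\<Sum>i | i \<in> I \<and> \<phi> i = x. w i)" for x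
  have weights: "(\<Sum>x\<in>\<phi> ` I. a' x * F x) = (\<Sum>i\<in>I. w i * F (\<phi> i))" for F
    unfolding a'_def by (rule sum_image_weights[OF I])
  have hs: "heat (Suc (Suc n)) (y - x) = (\<Sum>e\<in>N. \<Sum>e'\<in>N. heat n ((y + e') - (x + e)) / (D * D))" for n x y
  proof -
    have "heat (Suc (Suc n)) (y - x) = (\<Sum>e\<in>N. \<Sum>e'\<in>N. heat n ((y - x - e) + e') / D) / D"
      unfolding N_def D_def
      by (subst heat_Suc, subst heat_Suc_plus) (simp add: sum_divide_distrib)
    also have "\<dots> = (\<Sum>e\<in>N. \<Sum>e'\<in>N. heat n ((y + e') - (x + e)) / (D * D))"
      unfolding sum_divide_distrib by (intro sum.cong refl) (simp add: algebra_simps)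
    finally show ?thesis .
  qed
  have "heat_form (Suc (Suc n)) V a = heat_form n (\<phi> ` I) a'" for n
  proof -
    have "heat_form n (\<phi> ` I) a' = (\<Sum>x\<in>\<phi> ` I. a' x * (\<Sum>y\<in>\<phi> ` I. a' y * heat n (y - x)))"
      unfolding heat_form_def by (simp add: sum_distrib_left mult.assoc)
    also have "\<dots> = (\<Sum>i\<in>I. w i * (\<Sum>j\<in>I. w j * heat n (\<phi> j - \<phi> i)))"
      unfolding weights ..
    also have "\<dots> = (\<Sum>x\<in>V. \<Sum>e\<in>N. a x / D * (\<Sum>y\<in>V. \<Sum>e'\<in>N. a y / D * heat n ((y + e') - (x + e))))"
      unfolding I_def sum.cartesian_product[symmetric] by (simp add: w_def \<phi>_def sum.cartesian_product split_beta)
    also have "\<dots> = (\<Sum>x\<in>V. \<Sum>e\<in>N. \<Sum>y\<in>V. \<Sum>e'\<in>N. a x * a y * (heat n ((y + e') - (x + e)) / (D * D)))"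
      by (simp add: sum_distrib_left field_simps)
    also have "\<dots> = (\<Sum>x\<in>V. \<Sum>y\<in>V. \<Sum>e\<in>N. \<Sum>e'\<in>N. a x * a y * (heat n ((y + e') - (x + e)) / (D * D)))"
      by (intro sum.cong refl sum.swap)
    also have "\<dots> = heat_form (Suc (Suc n)) V a"
      unfolding heat_form_def hs by (simp only: sum_distrib_left)
    finally show ?thesis ..
  qed
  then show thesis using I by (intro that[of "\<phi> ` I" a']) auto
qed

text \<open>Shifting reduces to times 0 and 1, where the identity form dominates.\<close>

lemma heat_form_pair_nonneg:
  fixes V :: "(int ^ 'd::finite) set"
  shows "finite V \<Longrightarrow> 0 \<le> heat_form (2 * n) V a + heat_form (Suc (2 * n)) V a"
proof (induction n arbitrary: V a)
  case 0
  then show ?case using heat_form_ge[of V a 1] by simp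
next
  case (Suc n)
  obtain V' :: "(int ^ 'd) set" and a' where "finite V'" "\<And>n. heat_form (Suc (Suc n)) V a = heat_form n V' a'"
    using heat_form_shift[OF Suc.prems] by metis
  then show ?case using Suc.IH[of V' a'] by simp
qed

text \<open>The cut is at \<open>2 * R\<close> steps: an even number makes both pieces sums over pairs of consecutive times,
and a walk with fewer steps does not cover distance \<open>2 * R\<close>.\<close>

definition near_cov :: "nat \<Rightarrow> int ^ 'd::finite \<Rightarrow> int ^ 'd \<Rightarrow> real" where
  "near_cov R x y = (\<Sum>k<2 * R. heat k (y - x))"

definition far_cov :: "nat \<Rightarrow> int ^ 'd::finite \<Rightarrow> int ^ 'd \<Rightarrow> real" where
  "far_cov R x y = (\<Sum>k. heat (k + 2 * R) (y - x))"

lemma green_split: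
  fixes x :: "int ^ 'd::finite"
  assumes "3 \<le> CARD('d)"
  shows "green x y = near_cov R x y + far_cov R x y"
  unfolding green_eq_heat near_cov_def far_cov_def
  by (subst suminf_split_initial_segment[OF summable_heat[OF assms], of _ "2 * R"]) simp

lemma green_translate: "green (x + a) (y + a) = green x y"
  by (simp add: green_eq_heat)

lemma near_cov_eq_0: "2 * int R \<le> sup_norm (y - x) \<Longrightarrow> near_cov R x y = 0"
  unfolding near_cov_def by (intro sum.neutral) (auto intro!: heat_eq_0_far)

lemma far_cov_diag_le:
  fixes x :: "int ^ 'd::finite"
  assumes "3 \<le> CARD('d)" "1 \<le> R"
  shows "far_cov R x x \<le> 4 * (real CARD('d))\<^sup>2 / sqrt (real R)"
proof -
  have "far_cov R x x \<le> 4 * (real CARD('d))\<^sup>2 / sqrt (real (2 * R))"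
    unfolding far_cov_def by (rule heat_tail_le) (use assms in auto)
  also have "\<dots> \<le> 4 * (real CARD('d))\<^sup>2 / sqrt (real R)"
    by (intro divide_left_mono) (use assms in auto)
  finally show ?thesis .
qed

lemma heat_form_even_sum_nonneg:
  "finite V \<Longrightarrow> 0 \<le> (\<Sum>k<2 * n. heat_form (k + 2 * R) V a)"
proof (induction n)
  case (Suc n)
  have "0 \<le> heat_form (2 * (n + R)) V a + heat_form (Suc (2 * (n + R))) V a"
    by (rule heat_form_pair_nonneg[OF Suc.prems])
  then show ?case using Suc by (simp add: algebra_simps)
qed simp

lemma psd_near_cov:
  assumes "finite V"
  shows "psd_on V (near_cov R)"
  unfolding psd_on_def
proof (intro conjI ballI allI)
  show "near_cov R x y = near_cov R y x" for x y :: "int ^ 'a"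
    unfolding near_cov_def by (metis heat_minus minus_diff_eq)
  fix a
  have "cov_form V (near_cov R) a = (\<Sum>x\<in>V. \<Sum>y\<in>V. \<Sum>k<2 * R. a x * a y * heat k (y - x))"
    by (simp add: near_cov_def sum_distrib_left)
  also have "\<dots> = (\<Sum>x\<in>V. \<Sum>k<2 * R. \<Sum>y\<in>V. a x * a y * heat k (y - x))"
    by (intro sum.cong refl sum.swap)
  also have "\<dots> = (\<Sum>k<2 * R. heat_form k V a)" unfolding heat_form_def by (rule sum.swap)
  finally show "0 \<le> cov_form V (near_cov R) a"
    using heat_form_even_sum_nonneg[OF assms, where n=R and R=0 and a=a] by simp
qed

text \<open>The partial sums over an even number of times are nonnegative, and a subsequence determines the limit.\<close>

lemma psd_far_cov:
  fixes V :: "(int ^ 'd::finite) set"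
  assumes d: "3 \<le> CARD('d)" and V: "finite V"
  shows "psd_on V (far_cov R)"
  unfolding psd_on_def
proof (intro conjI ballI allI)
  show "far_cov R x y = far_cov R y x" for x y :: "int ^ 'd"
    unfolding far_cov_def by (metis heat_minus minus_diff_eq)
  fix a
  have "(\<lambda>k. heat (k + 2 * R) (y - x)) sums far_cov R x y" for x y :: "int ^ 'd"
    unfolding far_cov_def
    by (intro summable_sums summable_ignore_initial_segment summable_heat[OF d])
  then have "(\<lambda>k. heat_form (k + 2 * R) V a) sums cov_form V (far_cov R) a"
    unfolding heat_form_def by (intro sums_sum sums_mult)
  then have "(\<lambda>n. \<Sum>k<n. heat_form (k + 2 * R) V a) \<longlonglongrightarrow> cov_form V (far_cov R) a"
    by (simp add: sums_def)
  from LIMSEQ_subseq_LIMSEQ[OF this, of "\<lambda>n. 2 * n"]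
  have "(\<lambda>n. \<Sum>k<2 * n. heat_form (k + 2 * R) V a) \<longlonglongrightarrow> cov_form V (far_cov R) a"
    by (simp add: o_def strict_mono_def)
  then show "0 \<le> cov_form V (far_cov R) a"
    by (rule LIMSEQ_le_const) (auto intro!: exI[of _ 0] heat_form_even_sum_nonneg[OF V])
qed

section \<open>Finite-dimensional laws and characteristic functions\<close>

abbreviation char_functional :: "'a measure \<Rightarrow> ('a \<Rightarrow> 'x \<Rightarrow> real) \<Rightarrow> 'x set \<Rightarrow> ('x \<Rightarrow> real) \<Rightarrow> complex" where
  "char_functional M X V t \<equiv> CLINT \<omega>|M. iexp (\<Sum>x\<in>V. t x * X \<omega> x)"

lemma (in prob_space) integrable_bounded:
  fixes f :: "'a \<Rightarrow> 'b::{banach, second_countable_topology}"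
  assumes "f \<in> borel_measurable M" "\<And>\<omega>. norm (f \<omega>) \<le> B"
  shows "integrable M f"
  using assms by (intro integrable_const_bound[of _ B]) auto

lemma (in prob_space) complex_integral_indicator:
  assumes E [measurable]: "E \<in> events"
  shows "(CLINT \<omega>|M. indicator E \<omega>) = complex_of_real (prob E)"
proof -
  have "(CLINT \<omega>|M. indicator E \<omega>) = (CLINT \<omega>|M. complex_of_real (indicator E \<omega>))"
    by (intro Bochner_Integration.integral_cong) (auto simp: indicator_def)
  also have "\<dots> = complex_of_real (\<integral>\<omega>. indicator E \<omega> \<partial>M)"
    by (intro integral_of_real integrable_real_indicator E) (simp add: emeasure_eq_measure)
  also have "(\<integral>\<omega>. indicator E \<omega> \<partial>M) = prob E"
    using sets.sets_into_space[OF E] by (simp only: Bochner_Integration.integral_indicator Int_absorb2)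
  finally show ?thesis .
qed

lemma borel_measurable_iexp [measurable]: "iexp \<in> borel_measurable borel"
  by (intro borel_measurable_continuous_onI continuous_intros)

text \<open>The one-dimensional uniqueness theorem of Levy, applied to the laws of \<open>X\<close> and \<open>Y\<close> under the
probability measures with normalised densities \<open>u\<close> and \<open>v\<close>.\<close>

lemma weighted_Levy_uniqueness:
  fixes X :: "'a \<Rightarrow> real" and Y :: "'b \<Rightarrow> real"
  assumes M: "prob_space M" and N: "prob_space N"
    and X [measurable]: "X \<in> borel_measurable M" and Y [measurable]: "Y \<in> borel_measurable N"
    and u [measurable]: "u \<in> borel_measurable M" and u_bd: "\<And>\<omega>. 0 \<le> u \<omega>" "\<And>\<omega>. u \<omega> \<le> K"
    and v [measurable]: "v \<in> borel_measurable N" and v_bd: "\<And>\<omega>. 0 \<le> v \<omega>" "\<And>\<omega>. v \<omega> \<le> K"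
    and eq: "\<And>t. (CLINT \<omega>|M. complex_of_real (u \<omega>) * iexp (t * X \<omega>)) = (CLINT \<omega>|N. complex_of_real (v \<omega>) * iexp (t * Y \<omega>))"
    and B [measurable]: "B \<in> sets borel"
  shows "(\<integral>\<omega>. u \<omega> * indicator B (X \<omega>) \<partial>M) = (\<integral>\<omega>. v \<omega> * indicator B (Y \<omega>) \<partial>N)"
proof -
  interpret M: prob_space M by fact
  interpret N: prob_space N by fact
  define m where "m = (\<integral>\<omega>. u \<omega> \<partial>M)"
  have "complex_of_real (\<integral>\<omega>. u \<omega> \<partial>M) = complex_of_real (\<integral>\<omega>. v \<omega> \<partial>N)"
    using eq[of 0] by simp
  then have m': "(\<integral>\<omega>. v \<omega> \<partial>N) = m" by (simp add: m_def)
  have K: "0 \<le> K" using u_bd[of undefined] by linarith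
  have iu: "integrable M u" by (intro M.integrable_bounded[of _ K]) (use u_bd in auto)
  have iv: "integrable N v" by (intro N.integrable_bounded[of _ K]) (use v_bd in auto)
  have iuB: "integrable M (\<lambda>\<omega>. u \<omega> * indicator B (X \<omega>))"
    by (intro M.integrable_bounded[of _ K]) (use u_bd K in \<open>auto simp: indicator_def\<close>)
  have ivB: "integrable N (\<lambda>\<omega>. v \<omega> * indicator B (Y \<omega>))"
    by (intro N.integrable_bounded[of _ K]) (use v_bd K in \<open>auto simp: indicator_def\<close>)
  have m0: "0 \<le> m" unfolding m_def by (intro integral_nonneg_AE) (use u_bd in auto)
  show ?thesis
  proof (cases "m = 0")
    case True
    have "(\<integral>\<omega>. u \<omega> * indicator B (X \<omega>) \<partial>M) \<le> m" "0 \<le> (\<integral>\<omega>. u \<omega> * indicator B (X \<omega>) \<partial>M)"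
      unfolding m_def using u_bd
      by (intro integral_mono[OF iuB iu] integral_nonneg_AE AE_I2; simp add: indicator_def)+
    moreover have "(\<integral>\<omega>. v \<omega> * indicator B (Y \<omega>) \<partial>N) \<le> m" "0 \<le> (\<integral>\<omega>. v \<omega> * indicator B (Y \<omega>) \<partial>N)"
      unfolding m'[symmetric] using v_bd
      by (intro integral_mono[OF ivB iv] integral_nonneg_AE AE_I2; simp add: indicator_def)+
    ultimately show ?thesis using True by simp
  next
    case False
    with m0 have m: "0 < m" by simp
    have key: "real_distribution (distr (density M (\<lambda>\<omega>. ennreal (u \<omega> / m))) borel X) \<and>
      (\<forall>t. char (distr (density M (\<lambda>\<omega>. ennreal (u \<omega> / m))) borel X) t = (CLINT \<omega>|M. complex_of_real (u \<omega>) * iexp (t * X \<omega>)) / m) \<and>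
      measure (distr (density M (\<lambda>\<omega>. ennreal (u \<omega> / m))) borel X) B = (\<integral>\<omega>. u \<omega> * indicator B (X \<omega>) \<partial>M) / m"
      if "prob_space M" and [measurable]: "X \<in> borel_measurable M" "u \<in> borel_measurable M"
        and u: "\<And>\<omega>. 0 \<le> u \<omega>" and iu: "integrable M u" and m: "(\<integral>\<omega>. u \<omega> \<partial>M) = m" "0 < m"
      for M :: "'c measure" and X u m
    proof -
      let ?D = "density M (\<lambda>\<omega>. ennreal (u \<omega> / m))"
      have "emeasure ?D (space ?D) = (\<integral>\<^sup>+\<omega>. ennreal (u \<omega> / m) \<partial>M)"
        by (subst emeasure_density) (auto intro!: nn_integral_cong)
      also have "\<dots> = ennreal (\<integral>\<omega>. u \<omega> / m \<partial>M)"
        by (intro nn_integral_eq_integral) (use iu u m in auto)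
      also have "\<dots> = 1" using m by simp
      finally have pD: "prob_space ?D" by (rule prob_spaceI)
      then interpret D: prob_space ?D .
      have rd: "real_distribution (distr ?D borel X)"
        by (rule D.real_distribution_distr) simp
      have nn: "AE \<omega> in M. 0 \<le> u \<omega> / m" using u m by simp
      have "char (distr ?D borel X) t = (CLINT \<omega>|?D. iexp (t * X \<omega>))" for t
        unfolding char_def by (subst integral_distr) auto
      also have "\<dots> t = (CLINT \<omega>|M. (u \<omega> / m) *\<^sub>R iexp (t * X \<omega>))" for t
        by (subst integral_density) (use nn in auto)
      also have "\<dots> t = (CLINT \<omega>|M. complex_of_real (u \<omega>) * iexp (t * X \<omega>) / m)" for t
        by (simp add: scaleR_conv_of_real)
      also have "\<dots> t = (CLINT \<omega>|M. complex_of_real (u \<omega>) * iexp (t * X \<omega>)) / m" for t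
        by (rule integral_divide_zero)
      finally have ch: "char (distr ?D borel X) t = (CLINT \<omega>|M. complex_of_real (u \<omega>) * iexp (t * X \<omega>)) / m" for t .
      have "measure (distr ?D borel X) B = (\<integral>x. indicator B x \<partial>distr ?D borel X)" by simp
      also have "\<dots> = (\<integral>\<omega>. indicator B (X \<omega>) \<partial>?D)" by (subst integral_distr) auto
      also have "\<dots> = (\<integral>\<omega>. (u \<omega> / m) *\<^sub>R indicator B (X \<omega>) \<partial>M)"
        by (subst integral_density) (use nn in auto)
      also have "\<dots> = (\<integral>\<omega>. u \<omega> * indicator B (X \<omega>) / m \<partial>M)" by simp
      also have "\<dots> = (\<integral>\<omega>. u \<omega> * indicator B (X \<omega>) \<partial>M) / m" by (rule integral_divide_zero)
      finally show ?thesis using rd ch by blast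
    qed
    note kM = key[OF M X u u_bd(1) iu m_def[symmetric] m]
    note kN = key[OF N Y v v_bd(1) iv m' m]
    have "distr (density M (\<lambda>\<omega>. ennreal (u \<omega> / m))) borel X = distr (density N (\<lambda>\<omega>. ennreal (v \<omega> / m))) borel Y"
      by (intro Levy_uniqueness ext) (use kM kN eq in auto)
    then have "(\<integral>\<omega>. u \<omega> * indicator B (X \<omega>) \<partial>M) / m = (\<integral>\<omega>. v \<omega> * indicator B (Y \<omega>) \<partial>N) / m"
      using kM kN by metis
    then show ?thesis using m by simp
  qed
qed

text \<open>A complex weight is split into real and imaginary parts, and these are made nonnegative by adding
the weight 1.\<close>

lemma complex_weighted_Levy_uniqueness:
  fixes X :: "'a \<Rightarrow> real" and Y :: "'b \<Rightarrow> real" and U :: "'a \<Rightarrow> complex" and V :: "'b \<Rightarrow> complex"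
  assumes M: "prob_space M" and N: "prob_space N"
    and X [measurable]: "X \<in> borel_measurable M" and Y [measurable]: "Y \<in> borel_measurable N"
    and U [measurable]: "U \<in> borel_measurable M" and U1: "\<And>\<omega>. norm (U \<omega>) \<le> 1"
    and V [measurable]: "V \<in> borel_measurable N" and V1: "\<And>\<omega>. norm (V \<omega>) \<le> 1"
    and eq0: "\<And>t. (CLINT \<omega>|M. iexp (t * X \<omega>)) = (CLINT \<omega>|N. iexp (t * Y \<omega>))"
    and eq: "\<And>t. (CLINT \<omega>|M. U \<omega> * iexp (t * X \<omega>)) = (CLINT \<omega>|N. V \<omega> * iexp (t * Y \<omega>))"
    and B [measurable]: "B \<in> sets borel"
  shows "(CLINT \<omega>|M. U \<omega> * indicator B (X \<omega>)) = (CLINT \<omega>|N. V \<omega> * indicator B (Y \<omega>))"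
proof -
  have expand: "(CLINT \<omega>|M. complex_of_real (1 + Re (c * U \<omega>)) * iexp (t * X \<omega>)) =
      (CLINT \<omega>|M. iexp (t * X \<omega>)) + c / 2 * (CLINT \<omega>|M. U \<omega> * iexp (t * X \<omega>))
       + cnj c / 2 * cnj (CLINT \<omega>|M. U \<omega> * iexp (- t * X \<omega>))"
    if "prob_space M" and [measurable]: "X \<in> borel_measurable M" "U \<in> borel_measurable M"
      and U1: "\<And>\<omega>. norm (U \<omega>) \<le> 1"
    for M :: "'c measure" and X U c t
  proof -
    interpret prob_space M by fact
    have i1: "integrable M (\<lambda>\<omega>. iexp (t * X \<omega>))" by (intro integrable_bounded[of _ 1]) auto
    have i2: "integrable M (\<lambda>\<omega>. U \<omega> * iexp (s * X \<omega>))" for s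
      by (intro integrable_bounded[of _ 1]) (use U1 in \<open>auto simp: norm_mult\<close>)
    have i3: "integrable M (\<lambda>\<omega>. cnj (U \<omega> * iexp (s * X \<omega>)))" for s
      using i2 by (simp only: integrable_cnj)
    have "complex_of_real (1 + Re (c * U \<omega>)) * iexp (t * X \<omega>) =
      iexp (t * X \<omega>) + c / 2 * (U \<omega> * iexp (t * X \<omega>)) + cnj c / 2 * cnj (U \<omega> * iexp (- t * X \<omega>))" for \<omega>
    proof -
      have "complex_of_real (1 + Re (c * U \<omega>)) = 1 + c * U \<omega> / 2 + cnj c * cnj (U \<omega>) / 2"
        by (simp add: complex_eq_iff field_simps)
      moreover have "cnj (iexp (- t * X \<omega>)) = iexp (t * X \<omega>)" by (simp add: exp_cnj)
      ultimately show ?thesis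
        by (simp only: complex_cnj_mult) (simp add: algebra_simps)
    qed
    then have "(CLINT \<omega>|M. complex_of_real (1 + Re (c * U \<omega>)) * iexp (t * X \<omega>)) =
      (CLINT \<omega>|M. iexp (t * X \<omega>) + c / 2 * (U \<omega> * iexp (t * X \<omega>)) + cnj c / 2 * cnj (U \<omega> * iexp (- t * X \<omega>)))"
      by presburger
    also have "\<dots> = (CLINT \<omega>|M. iexp (t * X \<omega>)) + c / 2 * (CLINT \<omega>|M. U \<omega> * iexp (t * X \<omega>))
       + cnj c / 2 * (CLINT \<omega>|M. cnj (U \<omega> * iexp (- t * X \<omega>)))"
      using i1 i2 i3 by (simp only: Bochner_Integration.integral_add integral_mult_right_zero
          Bochner_Integration.integrable_add integrable_mult_right)
    finally show ?thesis by (simp only: Bochner_Integration.integral_cnj)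
  qed
  \<comment> \<open>used with \<open>c = 1\<close> for the real part and \<open>c = - \<i>\<close> for the imaginary part of \<open>U\<close>\<close>
  have part: "(\<integral>\<omega>. Re (c * U \<omega>) * indicator B (X \<omega>) \<partial>M) = (\<integral>\<omega>. Re (c * V \<omega>) * indicator B (Y \<omega>) \<partial>N)"
    if c: "norm c = 1" for c
  proof -
    have split: "(\<integral>\<omega>. Re (c * U \<omega>) * indicator B (X \<omega>) \<partial>M) =
      (\<integral>\<omega>. (1 + Re (c * U \<omega>)) * indicator B (X \<omega>) \<partial>M) - (\<integral>\<omega>. 1 * indicator B (X \<omega>) \<partial>M)"
      if "prob_space M" and [measurable]: "X \<in> borel_measurable M" "U \<in> borel_measurable M"
        and U1: "\<And>\<omega>. norm (U \<omega>) \<le> 1"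
      for M :: "'c measure" and X U
    proof -
      interpret prob_space M by fact
      have "\<bar>Re (c * U \<omega>)\<bar> \<le> 1" for \<omega>
        using abs_Re_le_cmod[of "c * U \<omega>"] U1[of \<omega>] c by (simp add: norm_mult)
      then have i: "integrable M (\<lambda>\<omega>. Re (c * U \<omega>) * indicator B (X \<omega>))"
        by (intro integrable_bounded[of _ 1]) (auto simp: indicator_def)
      have j: "integrable M (\<lambda>\<omega>. 1 * indicator B (X \<omega>) :: real)"
        by (intro integrable_bounded[of _ 1]) (auto simp: indicator_def)
      have "(\<integral>\<omega>. (1 + Re (c * U \<omega>)) * indicator B (X \<omega>) \<partial>M) = (\<integral>\<omega>. 1 * indicator B (X \<omega>) + Re (c * U \<omega>) * indicator B (X \<omega>) \<partial>M)"
        by (simp only: distrib_right)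
      also have "\<dots> = (\<integral>\<omega>. 1 * indicator B (X \<omega>) \<partial>M) + (\<integral>\<omega>. Re (c * U \<omega>) * indicator B (X \<omega>) \<partial>M)"
        by (rule Bochner_Integration.integral_add[OF j i])
      finally show ?thesis by simp
    qed
    have bd: "0 \<le> 1 + Re (c * z)" "1 + Re (c * z) \<le> 2" if "norm z \<le> 1" for z
      using abs_Re_le_cmod[of "c * z"] that c by (auto simp: norm_mult)
    have "(\<integral>\<omega>. (1 + Re (c * U \<omega>)) * indicator B (X \<omega>) \<partial>M) = (\<integral>\<omega>. (1 + Re (c * V \<omega>)) * indicator B (Y \<omega>) \<partial>N)"
    proof (rule weighted_Levy_uniqueness[OF M N X Y _ _ _ _ _ _ _ B, where K=2])
      show "(CLINT \<omega>|M. complex_of_real (1 + Re (c * U \<omega>)) * iexp (t * X \<omega>)) =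
        (CLINT \<omega>|N. complex_of_real (1 + Re (c * V \<omega>)) * iexp (t * Y \<omega>))" for t
        unfolding expand[OF M X U U1] expand[OF N Y V V1] eq0 eq ..
    qed (use bd U1 V1 in auto)
    moreover have "(\<integral>\<omega>. (1::real) * indicator B (X \<omega>) \<partial>M) = (\<integral>\<omega>. 1 * indicator B (Y \<omega>) \<partial>N)"
      by (rule weighted_Levy_uniqueness[OF M N X Y _ _ _ _ _ _ _ B, where K=1]) (use eq0 in auto)
    ultimately show ?thesis unfolding split[OF M X U U1] split[OF N Y V V1] by simp
  qed
  have reim: "Re (CLINT \<omega>|M. U \<omega> * indicator B (X \<omega>)) = (\<integral>\<omega>. Re (1 * U \<omega>) * indicator B (X \<omega>) \<partial>M)"
       "Im (CLINT \<omega>|M. U \<omega> * indicator B (X \<omega>)) = (\<integral>\<omega>. Re (- \<i> * U \<omega>) * indicator B (X \<omega>) \<partial>M)"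
    if "prob_space M" and [measurable]: "X \<in> borel_measurable M" "U \<in> borel_measurable M"
      and U1: "\<And>\<omega>. norm (U \<omega>) \<le> 1"
    for M :: "'c measure" and X U
  proof -
    interpret prob_space M by fact
    have i: "integrable M (\<lambda>\<omega>. U \<omega> * indicator B (X \<omega>))"
      by (intro integrable_bounded[of _ 1]) (use U1 in \<open>auto simp: indicator_def\<close>)
    show "Re (CLINT \<omega>|M. U \<omega> * indicator B (X \<omega>)) = (\<integral>\<omega>. Re (1 * U \<omega>) * indicator B (X \<omega>) \<partial>M)"
      unfolding integral_Re[OF i, symmetric] by (intro Bochner_Integration.integral_cong) (auto simp: indicator_def)
    show "Im (CLINT \<omega>|M. U \<omega> * indicator B (X \<omega>)) = (\<integral>\<omega>. Re (- \<i> * U \<omega>) * indicator B (X \<omega>) \<partial>M)"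
      unfolding integral_Im[OF i, symmetric] by (intro Bochner_Integration.integral_cong) (auto simp: indicator_def)
  qed
  show ?thesis
  proof (rule complex_eqI)
    show "Re (CLINT \<omega>|M. U \<omega> * indicator B (X \<omega>)) = Re (CLINT \<omega>|N. V \<omega> * indicator B (Y \<omega>))"
      unfolding reim(1)[OF M X U U1] reim(1)[OF N Y V V1] by (rule part) simp
    show "Im (CLINT \<omega>|M. U \<omega> * indicator B (X \<omega>)) = Im (CLINT \<omega>|N. V \<omega> * indicator B (Y \<omega>))"
      unfolding reim(2)[OF M X U U1] reim(2)[OF N Y V V1] by (rule part) simp
  qed
qed

text \<open>Coordinates are moved one at a time from the exponent into an indicator.  The factor that contains
the remaining coordinates serves as the complex weight for the coordinate that is moved.\<close>

lemma Cramer_Wold_boxes: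
  fixes X :: "'a \<Rightarrow> 'x \<Rightarrow> real" and Y :: "'b \<Rightarrow> 'x \<Rightarrow> real"
  assumes V: "finite V" and M: "prob_space M" and N: "prob_space N"
    and X: "\<And>x. x \<in> V \<Longrightarrow> (\<lambda>\<omega>. X \<omega> x) \<in> borel_measurable M"
    and Y: "\<And>x. x \<in> V \<Longrightarrow> (\<lambda>\<omega>. Y \<omega> x) \<in> borel_measurable N"
    and eq: "\<And>t. char_functional M X V t = char_functional N Y V t"
    and B: "\<And>x. B x \<in> sets borel"
    and W: "W \<subseteq> V"
  shows "(CLINT \<omega>|M. iexp (\<Sum>x\<in>V - W. t x * X \<omega> x) * (\<Prod>x\<in>W. indicator (B x) (X \<omega> x)))
       = (CLINT \<omega>|N. iexp (\<Sum>x\<in>V - W. t x * Y \<omega> x) * (\<Prod>x\<in>W. indicator (B x) (Y \<omega> x)))"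
proof -
  have "finite W" using V W finite_subset by auto
  then show ?thesis using W
  proof (induction W arbitrary: t)
    case empty
    show ?case using eq[of t] by simp
  next
    case (insert a W)
    then have a: "a \<in> V" and W: "W \<subseteq> V" and aW: "a \<notin> W" and fW: "finite W" by auto
    let ?F = "\<lambda>Z :: 'x \<Rightarrow> real. iexp (\<Sum>x\<in>V - insert a W. t x * Z x) * (\<Prod>x\<in>W. indicator (B x) (Z x) :: complex)"
    note [measurable] = B
    have meas: "(\<lambda>\<omega>. ?F (Z \<omega>)) \<in> borel_measurable M'"
      if [measurable]: "\<And>x. x \<in> V \<Longrightarrow> (\<lambda>\<omega>. Z \<omega> x) \<in> borel_measurable M'" for M' :: "'c measure" and Z
    proof -
      have [measurable]: "(\<lambda>\<omega>. \<Sum>x\<in>V - insert a W. t x * Z \<omega> x) \<in> borel_measurable M'"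
        by (intro borel_measurable_sum borel_measurable_times borel_measurable_const) (use that in auto)
      have [measurable]: "(\<lambda>\<omega>. \<Prod>x\<in>W. indicator (B x) (Z \<omega> x) :: complex) \<in> borel_measurable M'"
      proof (rule borel_measurable_prod)
        fix x assume "x \<in> W"
        then have [measurable]: "(\<lambda>\<omega>. Z \<omega> x) \<in> borel_measurable M'" using W that by auto
        show "(\<lambda>\<omega>. indicator (B x) (Z \<omega> x) :: complex) \<in> borel_measurable M'" by measurable
      qed
      show ?thesis by measurable
    qed
    have bd: "norm (?F Z) \<le> 1" for Z
    proof -
      have "norm (\<Prod>x\<in>W. indicator (B x) (Z x) :: complex) \<le> 1"
        unfolding prod_norm[symmetric] by (intro prod_le_1) (auto simp: indicator_def)
      then show ?thesis by (simp add: norm_mult)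
    qed
    have split: "(\<Sum>x\<in>V - W. (t(a := s)) x * Z x) = s * Z a + (\<Sum>x\<in>V - insert a W. t x * Z x)" for s and Z :: "'x \<Rightarrow> real"
    proof -
      have e: "V - W - {a} = V - insert a W" by auto
      have "(\<Sum>x\<in>V - W. (t(a := s)) x * Z x) = (t(a := s)) a * Z a + (\<Sum>x\<in>V - W - {a}. (t(a := s)) x * Z x)"
        using V a aW by (intro sum.remove) auto
      also have "(\<Sum>x\<in>V - W - {a}. (t(a := s)) x * Z x) = (\<Sum>x\<in>V - insert a W. t x * Z x)"
        unfolding e by (intro sum.cong) auto
      finally show ?thesis by simp
    qed
    have single: "(\<Sum>x\<in>V. (if x = a then s else 0) * Z x) = s * Z a" for s and Z :: "'x \<Rightarrow> real"
    proof -
      have "(\<Sum>x\<in>V. (if x = a then s else 0) * Z x) = (\<Sum>x\<in>V. if x = a then s * Z x else 0)"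
        by (intro sum.cong) auto
      then show ?thesis using V a by simp
    qed
    have step: "?F Z * iexp (s * Z a) = iexp (\<Sum>x\<in>V - W. (t(a := s)) x * Z x) * (\<Prod>x\<in>W. indicator (B x) (Z x))" for s Z
      unfolding split by (simp add: exp_add distrib_left mult_ac)
    have "(CLINT \<omega>|M. ?F (X \<omega>) * indicator (B a) (X \<omega> a)) = (CLINT \<omega>|N. ?F (Y \<omega>) * indicator (B a) (Y \<omega> a))"
    proof (rule complex_weighted_Levy_uniqueness[OF M N X[OF a] Y[OF a] meas[OF X] bd meas[OF Y] bd _ _ B])
      show "(CLINT \<omega>|M. iexp (s * X \<omega> a)) = (CLINT \<omega>|N. iexp (s * Y \<omega> a))" for s
        using eq[of "\<lambda>x. if x = a then s else 0"] unfolding single .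
      show "(CLINT \<omega>|M. ?F (X \<omega>) * iexp (s * X \<omega> a)) = (CLINT \<omega>|N. ?F (Y \<omega>) * iexp (s * Y \<omega> a))" for s
        unfolding step by (rule insert.IH[OF W])
    qed auto
    then show ?case using fW aW by (simp add: mult_ac)
  qed
qed

text \<open>This is the uniqueness theorem for characteristic functions of random vectors, deduced from the
one-dimensional one by exhausting the coordinates.\<close>

theorem finite_dimensional_law_unique:
  fixes X :: "'a \<Rightarrow> 'x \<Rightarrow> real" and Y :: "'b \<Rightarrow> 'x \<Rightarrow> real"
  assumes V: "finite V" and M: "prob_space M" and N: "prob_space N"
    and X: "\<And>x. x \<in> V \<Longrightarrow> (\<lambda>\<omega>. X \<omega> x) \<in> borel_measurable M"
    and Y: "\<And>x. x \<in> V \<Longrightarrow> (\<lambda>\<omega>. Y \<omega> x) \<in> borel_measurable N"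
    and eq: "\<And>t. char_functional M X V t = char_functional N Y V t"
  shows "distr M (\<Pi>\<^sub>M x\<in>V. borel) (\<lambda>\<omega>. restrict (X \<omega>) V) = distr N (\<Pi>\<^sub>M x\<in>V. borel) (\<lambda>\<omega>. restrict (Y \<omega>) V)"
    (is "?P = ?Q")
proof -
  have mX: "(\<lambda>\<omega>. restrict (X \<omega>) V) \<in> measurable M (\<Pi>\<^sub>M x\<in>V. borel)"
    by (rule measurable_restrict) (rule X)
  have mY: "(\<lambda>\<omega>. restrict (Y \<omega>) V) \<in> measurable N (\<Pi>\<^sub>M x\<in>V. borel)"
    by (rule measurable_restrict) (rule Y)
  have box: "emeasure (distr M' (\<Pi>\<^sub>M x\<in>V. borel) (\<lambda>\<omega>. restrict (Z \<omega>) V)) (Pi\<^sub>E V A)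
      = ennreal (Re (CLINT \<omega>|M'. iexp (\<Sum>x\<in>V - V. 0 * Z \<omega> x) * (\<Prod>x\<in>V. indicator (A' x) (Z \<omega> x))))"
    if "prob_space M'" and m: "(\<lambda>\<omega>. restrict (Z \<omega>) V) \<in> measurable M' (\<Pi>\<^sub>M x\<in>V. borel)"
      and A: "\<And>x. x \<in> V \<Longrightarrow> A x \<in> sets borel" and A': "\<And>x. x \<in> V \<Longrightarrow> A' x = A x"
    for M' :: "'c measure" and Z A A'
  proof -
    interpret prob_space M' by fact
    have sA: "Pi\<^sub>E V A \<in> sets (\<Pi>\<^sub>M x\<in>V. borel)" using V A by (intro sets_PiM_I_finite) auto
    let ?E = "(\<lambda>\<omega>. restrict (Z \<omega>) V) -` Pi\<^sub>E V A \<inter> space M'"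
    have E: "?E \<in> sets M'" by (rule measurable_sets[OF m sA])
    have "(CLINT \<omega>|M'. iexp (\<Sum>x\<in>V - V. 0 * Z \<omega> x) * (\<Prod>x\<in>V. indicator (A' x) (Z \<omega> x))) = (CLINT \<omega>|M'. indicator ?E \<omega>)"
    proof (rule Bochner_Integration.integral_cong[OF refl])
      fix \<omega> assume w: "\<omega> \<in> space M'"
      have "(\<Prod>x\<in>V. indicator (A' x) (Z \<omega> x)) = (indicator ?E \<omega> :: complex)"
      proof (cases "\<omega> \<in> ?E")
        case True
        then have "\<forall>x\<in>V. Z \<omega> x \<in> A' x" using A' by (auto simp: PiE_iff)
        then show ?thesis using True by simp
      next
        case False
        then obtain x where "x \<in> V" "Z \<omega> x \<notin> A' x" using w A' by (auto simp: PiE_iff)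
        then have "(\<Prod>x\<in>V. indicator (A' x) (Z \<omega> x)) = (0 :: complex)"
          using V by (intro prod_zero bexI[of _ x]) auto
        then show ?thesis using False by simp
      qed
      then show "iexp (\<Sum>x\<in>V - V. 0 * Z \<omega> x) * (\<Prod>x\<in>V. indicator (A' x) (Z \<omega> x)) = indicator ?E \<omega>"
        by simp
    qed
    also have "\<dots> = complex_of_real (measure M' ?E)" by (rule complex_integral_indicator[OF E])
    finally have "Re (CLINT \<omega>|M'. iexp (\<Sum>x\<in>V - V. 0 * Z \<omega> x) * (\<Prod>x\<in>V. indicator (A' x) (Z \<omega> x))) = measure M' ?E" by simp
    then show ?thesis using emeasure_distr[OF m sA] by (simp only: emeasure_eq_measure)
  qed
  show ?thesis
  proof (rule measure_eqI_PiM_finite[OF V])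
    fix A assume A: "\<And>x. x \<in> V \<Longrightarrow> A x \<in> sets (borel :: real measure)"
    define A' where "A' x = (if x \<in> V then A x else {})" for x
    have A': "A' x = A x" if "x \<in> V" for x using that by (simp add: A'_def)
    have sA': "A' x \<in> sets borel" for x using A by (simp add: A'_def)
    show "emeasure ?P (Pi\<^sub>E V A) = emeasure ?Q (Pi\<^sub>E V A)"
      by (subst box[OF M mX A A'], assumption+, subst box[OF N mY A A'], assumption+,
          subst Cramer_Wold_boxes[OF V M N X Y eq sA' order_refl]) auto
  next
    interpret P: prob_space ?P by (rule prob_space.prob_space_distr[OF M mX])
    show "range (\<lambda>_::nat. space (\<Pi>\<^sub>M x\<in>V. (borel :: real measure))) \<subseteq> prod_algebra V (\<lambda>_. borel)"
      using V by (auto simp: space_PiM intro!: prod_algebraI_finite)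
    show "emeasure ?P (space (\<Pi>\<^sub>M x\<in>V. (borel :: real measure))) \<noteq> \<infinity>" for i :: nat by simp
  qed auto
qed

section \<open>Gaussian vectors with a given covariance\<close>

lemma quadratic_form_insert:
  fixes f :: "'x \<Rightarrow> 'x \<Rightarrow> real"
  assumes "finite V" "a \<notin> V"
  shows "(\<Sum>x\<in>insert a V. \<Sum>y\<in>insert a V. f x y) = f a a + (\<Sum>y\<in>V. f a y) + (\<Sum>x\<in>V. f x a) + (\<Sum>x\<in>V. \<Sum>y\<in>V. f x y)"
  unfolding sum.insert[OF assms] sum.distrib by (simp only: add.assoc)

lemma psd_on_insert_quadratic:
  assumes V: "finite V" "a \<notin> V" and psd: "psd_on (insert a V) C"
  shows "0 \<le> s\<^sup>2 * C a a + 2 * s * (\<Sum>y\<in>V. b y * C a y) + cov_form V C b"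
proof -
  let ?b = "b(a := s)"
  have sym: "C x a = C a x" if "x \<in> V" for x using psd_on_sym[OF psd] that by simp
  have "0 \<le> (\<Sum>x\<in>insert a V. \<Sum>y\<in>insert a V. ?b x * ?b y * C x y)"
    by (rule psd_on_nonneg[OF psd])
  also have "\<dots> = s\<^sup>2 * C a a + (\<Sum>y\<in>V. s * (b y * C a y)) + (\<Sum>x\<in>V. s * (b x * C a x)) + cov_form V C b"
    unfolding quadratic_form_insert[OF V]
    by (intro arg_cong2[where f="(+)"] sum.cong refl) (use V sym in \<open>auto simp: power2_eq_square\<close>)
  finally show ?thesis by (simp add: sum_distrib_left[symmetric])
qed

lemma psd_on_subset:
  assumes "psd_on W C" "V \<subseteq> W" "finite W"
  shows "psd_on V C"
  unfolding psd_on_def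
proof (intro conjI ballI allI)
  show "C x y = C y x" if "x \<in> V" "y \<in> V" for x y using psd_on_sym[OF assms(1)] assms(2) that by blast
  fix a :: "'a \<Rightarrow> real"
  let ?b = "\<lambda>x. if x \<in> V then a x else 0"
  have "0 \<le> (\<Sum>x\<in>W. \<Sum>y\<in>W. ?b x * ?b y * C x y)" by (rule psd_on_nonneg[OF assms(1)])
  also have "\<dots> = (\<Sum>x\<in>V. \<Sum>y\<in>W. ?b x * ?b y * C x y)"
    using assms by (intro sum.mono_neutral_right) auto
  also have "\<dots> = (\<Sum>x\<in>V. \<Sum>y\<in>V. ?b x * ?b y * C x y)"
    using assms by (intro sum.cong refl sum.mono_neutral_right) auto
  also have "\<dots> = cov_form V C a" by (intro sum.cong) auto
  finally show "0 \<le> cov_form V C a" .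
qed

text \<open>Induction on the index set; the Schur complement of the added point is positive semidefinite on the
remaining points.\<close>

lemma Cholesky_factor:
  assumes "finite V" "psd_on V C"
  shows "\<exists>v. \<forall>x\<in>V. \<forall>y\<in>V. C x y = (\<Sum>z\<in>V. v x z * v y z)"
  using assms
proof (induction V arbitrary: C rule: finite_induct)
  case empty
  then show ?case by simp
next
  case (insert a V)
  note quad = psd_on_insert_quadratic[OF insert.hyps insert.prems]
  have sym: "C x a = C a x" if "x \<in> V" for x using psd_on_sym[OF insert.prems] that by simp
  define c where "c = C a a"
  have c0: "0 \<le> c" using quad[of 1 "\<lambda>_. 0"] by (simp add: c_def)
  \<comment> \<open>for \<open>c = 0\<close> division by zero makes this \<open>C\<close> itself, as needed, since then \<open>C a x = 0\<close>\<close>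
  define C' where "C' x y = C x y - C a x * C a y / c" for x y
  have "psd_on V C'"
    unfolding psd_on_def
  proof (intro conjI ballI allI)
    show "C' x y = C' y x" if "x \<in> V" "y \<in> V" for x y
      using psd_on_sym[OF insert.prems] that by (simp add: C'_def)
    fix b
    define S where "S = (\<Sum>y\<in>V. b y * C a y)"
    have "cov_form V C' b = (\<Sum>x\<in>V. \<Sum>y\<in>V. b x * b y * C x y - (b x * C a x) * (b y * C a y) / c)"
      by (intro sum.cong refl) (simp add: C'_def field_simps)
    also have "\<dots> = cov_form V C b - S * S / c"
      unfolding S_def sum_product by (simp add: sum_subtractf sum_divide_distrib)
    also have "\<dots> \<ge> 0"
    proof (cases "c = 0")
      case False
      have "(- S / c)\<^sup>2 * c + 2 * (- S / c) * S = - (S * S / c)"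
        using False by (simp add: power2_eq_square field_simps)
      then show ?thesis using quad[of "- S / c" b] by (simp add: S_def c_def)
    qed (use quad[of 0 b] in simp)
    finally show "0 \<le> cov_form V C' b" .
  qed
  then obtain v where v: "\<And>x y. x \<in> V \<Longrightarrow> y \<in> V \<Longrightarrow> C' x y = (\<Sum>z\<in>V. v x z * v y z)"
    using insert.IH by blast
  have c_zero: "C a x = 0" if "c = 0" "x \<in> V" for x
  proof (rule ccontr)
    assume nz: "C a x \<noteq> 0"
    \<comment> \<open>the form is affine in \<open>s\<close>, and this value makes it equal to \<open>-1\<close>\<close>
    define s where "s = - (C x x + 1) / (2 * C a x)"
    let ?b = "\<lambda>y. if y = x then 1 else 0 :: real"
    have 1: "(\<Sum>y\<in>V. ?b y * C a y) = C a x" using insert.hyps that by (simp add: if_distrib[of "\<lambda>r. r * _"] cong: if_cong)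
    have "(\<Sum>z\<in>V. \<Sum>y\<in>V. ?b z * ?b y * C z y) = (\<Sum>z\<in>V. if z = x then C x x else 0)"
    proof (intro sum.cong refl)
      fix z
      have "(\<Sum>y\<in>V. ?b z * ?b y * C z y) = (\<Sum>y\<in>V. if y = x then ?b z * C z x else 0)"
        by (intro sum.cong) auto
      then show "(\<Sum>y\<in>V. ?b z * ?b y * C z y) = (if z = x then C x x else 0)"
        using insert.hyps that by simp
    qed
    then have 2: "(\<Sum>z\<in>V. \<Sum>y\<in>V. ?b z * ?b y * C z y) = C x x" using insert.hyps that by simp
    have "0 \<le> s\<^sup>2 * c + 2 * s * C a x + C x x" using quad[of s ?b] unfolding 1 2 c_def by simp
    moreover have "2 * s * C a x = - (C x x + 1)" using nz by (simp add: s_def)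
    ultimately show False using that by simp
  qed
  define w where "w x z = (if z = a then (if x = a then sqrt c else C a x / sqrt c) else if x = a then 0 else v x z)" for x z
  have "C x y = (\<Sum>z\<in>insert a V. w x z * w y z)" if "x \<in> insert a V" "y \<in> insert a V" for x y
  proof -
    have wz: "(\<Sum>z\<in>V. w x z * w y z) = (if x = a \<or> y = a then 0 else (\<Sum>z\<in>V. v x z * v y z))"
      using insert.hyps by (auto simp: w_def intro!: sum.neutral sum.cong)
    have sq: "sqrt c * sqrt c = c" using c0 by simp
    have "(\<Sum>z\<in>insert a V. w x z * w y z) = w x a * w y a + (if x = a \<or> y = a then 0 else (\<Sum>z\<in>V. v x z * v y z))"
      using insert.hyps by (simp add: wz)
    also have "\<dots> = C x y"
    proof (cases "c = 0")
      case True
      then show ?thesis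
        using that v[of x y] c_zero[of x] c_zero[of y] sym[of x] by (auto simp: w_def C'_def c_def)
    next
      case False
      then have "sqrt c > 0" using c0 by simp
      then show ?thesis
        using that v[of x y] sym[of x] sq insert.hyps by (auto simp: w_def C'_def c_def)
    qed
    finally show ?thesis ..
  qed
  then show ?case by blast
qed

text \<open>The definition by the characteristic functional covers degenerate covariances.\<close>

definition gaussian_vector :: "'a measure \<Rightarrow> ('a \<Rightarrow> 'x \<Rightarrow> real) \<Rightarrow> 'x set \<Rightarrow> ('x \<Rightarrow> 'x \<Rightarrow> real) \<Rightarrow> bool" where
  "gaussian_vector M X V C \<longleftrightarrow> prob_space M \<and> (\<forall>x\<in>V. (\<lambda>\<omega>. X \<omega> x) \<in> borel_measurable M) \<and>
     (\<forall>t. char_functional M X V t = complex_of_real (exp (- cov_form V C t / 2)))"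

lemma prob_space_std_normal: "prob_space std_normal_distribution"
  by (rule prob_space_normal_density) simp

text \<open>Completing the square.\<close>

lemma std_normal_exp:
  shows "integrable std_normal_distribution (\<lambda>x. exp (l * x))"
    and "(\<integral>x. exp (l * x) \<partial>std_normal_distribution) = exp (l\<^sup>2 / 2)"
proof -
  have eq: "std_normal_density x * exp (l * x) = exp (l\<^sup>2 / 2) * normal_density l 1 x" for x
  proof -
    have "- x\<^sup>2 / 2 + l * x = l\<^sup>2 / 2 + - (x - l)\<^sup>2 / 2"
      by (simp add: power2_eq_square field_simps)
    then have "exp (- x\<^sup>2 / 2) * exp (l * x) = exp (l\<^sup>2 / 2) * exp (- (x - l)\<^sup>2 / 2)"
      by (simp only: exp_add[symmetric])
    then show ?thesis by (simp add: std_normal_density_def normal_density_def)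
  qed
  show "integrable std_normal_distribution (\<lambda>x. exp (l * x))"
    by (subst integrable_density) (auto simp: eq)
  show "(\<integral>x. exp (l * x) \<partial>std_normal_distribution) = exp (l\<^sup>2 / 2)"
    by (subst integral_density) (auto simp: eq)
qed

definition white_noise :: "'x set \<Rightarrow> ('x \<Rightarrow> real) measure" where
  "white_noise V = (\<Pi>\<^sub>M x\<in>V. std_normal_distribution)"

lemma prob_space_white_noise: "prob_space (white_noise V)"
  unfolding white_noise_def by (intro prob_space_PiM prob_space_std_normal)

lemma measurable_white_noise: "z \<in> V \<Longrightarrow> (\<lambda>\<omega>. \<omega> z) \<in> borel_measurable (white_noise V)"
  unfolding white_noise_def
  by (rule measurable_compose[OF measurable_component_singleton]) auto

lemma white_noise_char:
  assumes "finite V"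
  shows "(CLINT \<omega>|white_noise V. iexp (\<Sum>z\<in>V. \<tau> z * \<omega> z)) = complex_of_real (exp (- (\<Sum>z\<in>V. (\<tau> z)\<^sup>2) / 2))"
proof -
  interpret product_sigma_finite "\<lambda>_::'a. std_normal_distribution"
    by (intro product_sigma_finite.intro prob_space_imp_sigma_finite prob_space_std_normal)
  interpret N: prob_space std_normal_distribution by (rule prob_space_std_normal)
  have "(CLINT \<omega>|white_noise V. iexp (\<Sum>z\<in>V. \<tau> z * \<omega> z)) = (CLINT \<omega>|white_noise V. \<Prod>z\<in>V. iexp (\<tau> z * \<omega> z))"
    using assms by (simp add: sum_distrib_left exp_sum)
  also have "\<dots> = (\<Prod>z\<in>V. CLINT x|std_normal_distribution. iexp (\<tau> z * x))"
    unfolding white_noise_def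
    by (rule product_integral_prod[OF assms]) (auto intro!: N.integrable_bounded[of _ 1])
  also have "\<dots> = (\<Prod>z\<in>V. complex_of_real (exp (- (\<tau> z)\<^sup>2 / 2)))"
    using char_std_normal_distribution by (simp add: char_def fun_eq_iff)
  also have "\<dots> = complex_of_real (exp (\<Sum>z\<in>V. - (\<tau> z)\<^sup>2 / 2))"
    using assms by (simp add: exp_sum)
  also have "(\<Sum>z\<in>V. - (\<tau> z)\<^sup>2 / 2) = - (\<Sum>z\<in>V. (\<tau> z)\<^sup>2) / 2"
    by (simp add: sum_negf sum_divide_distrib)
  finally show ?thesis .
qed

lemma white_noise_exp:
  assumes "finite V"
  shows "integrable (white_noise V) (\<lambda>\<omega>. exp (\<Sum>z\<in>V. \<tau> z * \<omega> z))"
    and "(\<integral>\<omega>. exp (\<Sum>z\<in>V. \<tau> z * \<omega> z) \<partial>white_noise V) = exp ((\<Sum>z\<in>V. (\<tau> z)\<^sup>2) / 2)"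
proof -
  interpret product_sigma_finite "\<lambda>_::'a. std_normal_distribution"
    by (intro product_sigma_finite.intro prob_space_imp_sigma_finite prob_space_std_normal)
  have eq: "exp (\<Sum>z\<in>V. \<tau> z * \<omega> z) = (\<Prod>z\<in>V. exp (\<tau> z * \<omega> z))" for \<omega>
    using assms by (simp add: exp_sum)
  show "integrable (white_noise V) (\<lambda>\<omega>. exp (\<Sum>z\<in>V. \<tau> z * \<omega> z))"
    unfolding eq white_noise_def by (intro product_integrable_prod assms std_normal_exp)
  have "(\<integral>\<omega>. exp (\<Sum>z\<in>V. \<tau> z * \<omega> z) \<partial>white_noise V) = (\<Prod>z\<in>V. exp ((\<tau> z)\<^sup>2 / 2))"
    unfolding eq white_noise_def
    by (subst product_integral_prod[OF assms]) (simp_all only: std_normal_exp)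
  also have "\<dots> = exp ((\<Sum>z\<in>V. (\<tau> z)\<^sup>2) / 2)"
    using assms by (simp add: exp_sum sum_divide_distrib)
  finally show "(\<integral>\<omega>. exp (\<Sum>z\<in>V. \<tau> z * \<omega> z) \<partial>white_noise V) = exp ((\<Sum>z\<in>V. (\<tau> z)\<^sup>2) / 2)" .
qed

text \<open>The exponential Markov inequality.\<close>

lemma white_noise_tail:
  assumes V: "finite V" and var: "(\<Sum>z\<in>V. (\<tau> z)\<^sup>2) \<le> \<kappa>" and k: "0 < \<kappa>" and e: "0 < \<epsilon>"
  shows "\<P>(\<omega> in white_noise V. \<epsilon> \<le> (\<Sum>z\<in>V. \<tau> z * \<omega> z)) \<le> exp (- \<epsilon>\<^sup>2 / (2 * \<kappa>))"
proof -
  interpret prob_space "white_noise V" by (rule prob_space_white_noise)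
  \<comment> \<open>the minimiser of the exponent \<open>l\<^sup>2 * \<kappa> / 2 - l * \<epsilon>\<close>\<close>
  define l where "l = \<epsilon> / \<kappa>"
  have l: "0 < l" using k e by (simp add: l_def)
  let ?X = "\<lambda>\<omega>. exp (\<Sum>z\<in>V. (l * \<tau> z) * \<omega> z)"
  have X: "?X \<omega> = exp (l * (\<Sum>z\<in>V. \<tau> z * \<omega> z))" for \<omega> by (simp add: sum_distrib_left mult.assoc)
  have "\<P>(\<omega> in white_noise V. \<epsilon> \<le> (\<Sum>z\<in>V. \<tau> z * \<omega> z)) = \<P>(\<omega> in white_noise V. exp (l * \<epsilon>) \<le> ?X \<omega>)"
    unfolding X using l by (simp add: mult_le_cancel_left_pos)
  also have "\<dots> \<le> expectation ?X / exp (l * \<epsilon>)"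
    by (rule integral_Markov_inequality_measure[where A="{}"]) (auto intro!: white_noise_exp(1)[OF V])
  also have "\<dots> = exp ((\<Sum>z\<in>V. (l * \<tau> z)\<^sup>2) / 2 - l * \<epsilon>)"
    unfolding white_noise_exp(2)[OF V] by (simp add: exp_diff)
  also have "\<dots> \<le> exp (- \<epsilon>\<^sup>2 / (2 * \<kappa>))"
  proof -
    have "(\<Sum>z\<in>V. (l * \<tau> z)\<^sup>2) = l\<^sup>2 * (\<Sum>z\<in>V. (\<tau> z)\<^sup>2)" by (simp add: power_mult_distrib sum_distrib_left)
    also have "\<dots> \<le> l\<^sup>2 * \<kappa>" by (intro mult_left_mono var) auto
    finally have "(\<Sum>z\<in>V. (l * \<tau> z)\<^sup>2) / 2 - l * \<epsilon> \<le> l\<^sup>2 * \<kappa> / 2 - l * \<epsilon>" by simp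
    also have "\<dots> = - \<epsilon>\<^sup>2 / (2 * \<kappa>)" using k by (simp add: l_def power2_eq_square field_simps)
    finally show ?thesis by simp
  qed
  finally show ?thesis .
qed

text \<open>White noise is transformed by a Cholesky factor of the covariance.  The tail bound is part of the
statement because it is read off from this construction.\<close>

lemma gaussian_vector_exists:
  assumes V: "finite V" and psd: "psd_on V C"
  obtains X where "gaussian_vector (white_noise V) X V C"
    and "\<And>x \<epsilon> \<kappa>. \<lbrakk>x \<in> V; C x x \<le> \<kappa>; 0 < \<kappa>; 0 < \<epsilon>\<rbrakk> \<Longrightarrow>
      \<P>(\<omega> in white_noise V. \<epsilon> \<le> \<bar>X \<omega> x\<bar>) \<le> 2 * exp (- \<epsilon>\<^sup>2 / (2 * \<kappa>))"
proof -
  obtain v where v: "\<And>x y. x \<in> V \<Longrightarrow> y \<in> V \<Longrightarrow> C x y = (\<Sum>z\<in>V. v x z * v y z)"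
    using Cholesky_factor[OF V psd] by blast
  define X where "X \<omega> x = (\<Sum>z\<in>V. v x z * \<omega> z)" for \<omega> x
  interpret prob_space "white_noise V" by (rule prob_space_white_noise)
  have lin: "(\<Sum>x\<in>V. t x * X \<omega> x) = (\<Sum>z\<in>V. (\<Sum>x\<in>V. t x * v x z) * \<omega> z)" for t \<omega>
    unfolding X_def sum_distrib_left sum_distrib_right
    by (subst sum.swap) (simp only: mult.assoc)
  have sq: "(\<Sum>z\<in>V. (\<Sum>x\<in>V. t x * v x z)\<^sup>2) = cov_form V C t" for t
  proof -
    have "(\<Sum>z\<in>V. (\<Sum>x\<in>V. t x * v x z)\<^sup>2) = (\<Sum>z\<in>V. \<Sum>x\<in>V. \<Sum>y\<in>V. (t x * v x z) * (t y * v y z))"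
      by (simp only: power2_eq_square sum_product)
    also have "\<dots> = (\<Sum>x\<in>V. \<Sum>z\<in>V. \<Sum>y\<in>V. (t x * v x z) * (t y * v y z))" by (rule sum.swap)
    also have "\<dots> = (\<Sum>x\<in>V. \<Sum>y\<in>V. \<Sum>z\<in>V. (t x * v x z) * (t y * v y z))"
      by (rule sum.cong[OF refl], rule sum.swap)
    also have "\<dots> = cov_form V C t"
      by (intro sum.cong refl) (simp add: v sum_distrib_left mult_ac)
    finally show ?thesis .
  qed
  have Xm: "(\<lambda>\<omega>. X \<omega> x) \<in> borel_measurable (white_noise V)" for x
    unfolding X_def by (intro borel_measurable_sum borel_measurable_times borel_measurable_const measurable_white_noise)
  have gv: "gaussian_vector (white_noise V) X V C"
    unfolding gaussian_vector_def
    by (intro conjI ballI allI prob_space_white_noise Xm) (simp only: lin white_noise_char[OF V] sq)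
  show thesis
  proof (rule that[OF gv])
    fix x and \<epsilon> \<kappa> :: real assume x: "x \<in> V" "C x x \<le> \<kappa>" "0 < \<kappa>" "0 < \<epsilon>"
    have "C x x = (\<Sum>z\<in>V. (v x z)\<^sup>2)" unfolding power2_eq_square by (rule v) (use x in auto)
    then have var: "(\<Sum>z\<in>V. (v x z)\<^sup>2) \<le> \<kappa>" "(\<Sum>z\<in>V. (- v x z)\<^sup>2) \<le> \<kappa>"
      using x(2) by (simp_all only: power2_minus)
    let ?U = "{\<omega> \<in> space (white_noise V). \<epsilon> \<le> X \<omega> x}" and ?L = "{\<omega> \<in> space (white_noise V). \<epsilon> \<le> - X \<omega> x}"
    have sets: "?U \<in> events"
        "?L \<in> events"
      by (intro borel_measurable_le borel_measurable_const borel_measurable_uminus Xm)+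
    have "\<P>(\<omega> in white_noise V. \<epsilon> \<le> \<bar>X \<omega> x\<bar>) \<le>
       measure (white_noise V) (?U \<union> ?L)"
    proof (rule finite_measure_mono)
      have "\<epsilon> \<le> r \<or> \<epsilon> \<le> - r" if "\<epsilon> \<le> \<bar>r\<bar>" for r using that by linarith
      then show "{\<omega> \<in> space (white_noise V). \<epsilon> \<le> \<bar>X \<omega> x\<bar>} \<subseteq>
        ?U \<union> ?L"
        by blast
    qed (intro sets.Un sets)
    also have "\<dots> \<le> prob ?U + prob ?L"
      by (intro measure_Un_le sets)
    also have "\<dots> \<le> exp (- \<epsilon>\<^sup>2 / (2 * \<kappa>)) + exp (- \<epsilon>\<^sup>2 / (2 * \<kappa>))"
      using white_noise_tail[OF V var(1) x(3,4)] white_noise_tail[OF V var(2) x(3,4)]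
      unfolding X_def sum_negf[symmetric] mult_minus_left[symmetric] by (rule add_mono)
    finally show "\<P>(\<omega> in white_noise V. \<epsilon> \<le> \<bar>X \<omega> x\<bar>) \<le> 2 * exp (- \<epsilon>\<^sup>2 / (2 * \<kappa>))" by simp
  qed
qed

section \<open>The Gaussian free field as a Gaussian vector\<close>

lemma gaussian_rv_square_integrable:
  assumes "prob_space M" "gaussian_rv M X"
  shows "integrable M X" "integrable M (\<lambda>\<omega>. (X \<omega>)\<^sup>2)"
proof -
  interpret prob_space M by fact
  consider \<mu> \<sigma> where "0 < \<sigma>" "distributed M lborel X (normal_density \<mu> \<sigma>)"
    | \<mu> where "X \<in> borel_measurable M" "AE \<omega> in M. X \<omega> = \<mu>"
    using assms(2) unfolding gaussian_rv_def by blast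
  then have "integrable M X \<and> integrable M (\<lambda>\<omega>. (X \<omega>)\<^sup>2)"
  proof cases
    case 1
    have i: "integrable M (\<lambda>\<omega>. (X \<omega> - \<mu>) ^ k)" for k
      using integrable_normal_moment[OF 1(1), of \<mu> k]
        distributed_integrable[OF 1(2), of "\<lambda>x. (x - \<mu>) ^ k"] by simp
    have "integrable M (\<lambda>\<omega>. (X \<omega> - \<mu>) ^ 1 + \<mu> * (X \<omega> - \<mu>) ^ 0)"
      by (intro Bochner_Integration.integrable_add integrable_mult_right i)
    then have iX: "integrable M X" by simp
    have eq: "(X \<omega>)\<^sup>2 = (X \<omega> - \<mu>) ^ 2 + (2 * \<mu> * (X \<omega> - \<mu>) ^ 1 + \<mu>\<^sup>2 * (X \<omega> - \<mu>) ^ 0)" for \<omega>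
      by (simp add: power2_eq_square algebra_simps)
    have "integrable M (\<lambda>\<omega>. (X \<omega>)\<^sup>2)"
      unfolding eq by (intro Bochner_Integration.integrable_add integrable_mult_right i)
    with iX show ?thesis by blast
  next
    case 2
    have "integrable M X"
      using integrable_cong_AE[OF 2(1) borel_measurable_const 2(2)] by simp
    moreover have "AE \<omega> in M. (X \<omega>)\<^sup>2 = \<mu>\<^sup>2" using 2(2) by eventually_elim simp
    then have "integrable M (\<lambda>\<omega>. (X \<omega>)\<^sup>2)"
      by (subst integrable_cong_AE[OF borel_measurable_power[OF 2(1)] borel_measurable_const]) simp_all
    ultimately show ?thesis by blast
  qed
  then show "integrable M X" "integrable M (\<lambda>\<omega>. (X \<omega>)\<^sup>2)" by auto
qed

lemma gaussian_rv_char: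
  assumes "prob_space M" "gaussian_rv M X" and mean: "(\<integral>\<omega>. X \<omega> \<partial>M) = 0"
  shows "(CLINT \<omega>|M. iexp (X \<omega>)) = complex_of_real (exp (- (\<integral>\<omega>. (X \<omega>)\<^sup>2 \<partial>M) / 2))"
proof -
  interpret prob_space M by fact
  consider \<mu> \<sigma> where "0 < \<sigma>" "distributed M lborel X (normal_density \<mu> \<sigma>)"
    | \<mu> where "X \<in> borel_measurable M" "AE \<omega> in M. X \<omega> = \<mu>"
    using assms(2) unfolding gaussian_rv_def by blast
  then show ?thesis
  proof cases
    case 1
    have mu: "\<mu> = 0" using normal_distributed_expectation[OF 1] mean by (simp only:)
    have var: "(\<integral>\<omega>. (X \<omega>)\<^sup>2 \<partial>M) = \<sigma>\<^sup>2"
      using normal_distributed_variance[OF 1] by (simp only: mean diff_zero)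
    define Z where "Z = (\<lambda>\<omega>. X \<omega> / \<sigma>)"
    have Z: "distributed M lborel Z std_normal_density"
      using iffD1[OF normal_standard_normal_convert[OF 1(1)] 1(2)] by (simp only: mu Z_def diff_zero)
    have Zm [measurable]: "Z \<in> borel_measurable M" using distributed_measurable[OF Z] by simp
    have "distr M borel Z = distr M lborel Z" by (rule distr_cong) auto
    also have "\<dots> = std_normal_distribution" using distributed_distr_eq_density[OF Z] .
    finally have dZ: "distr M borel Z = std_normal_distribution" .
    have "(CLINT \<omega>|M. iexp (X \<omega>)) = (CLINT \<omega>|M. iexp (\<sigma> * Z \<omega>))"
      using 1(1) by (simp add: Z_def)
    also have "\<dots> = char (distr M borel Z) \<sigma>"
      unfolding char_def by (subst integral_distr) auto
    also have "\<dots> = complex_of_real (exp (- \<sigma>\<^sup>2 / 2))"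
      unfolding dZ char_std_normal_distribution by simp
    finally show ?thesis unfolding var .
  next
    case 2
    have "(\<integral>\<omega>. X \<omega> \<partial>M) = (\<integral>\<omega>. \<mu> \<partial>M)"
      by (rule integral_cong_AE[OF 2(1) borel_measurable_const 2(2)])
    then have mu: "\<mu> = 0" using mean by (simp add: prob_space)
    have AE0: "AE \<omega> in M. (X \<omega>)\<^sup>2 = 0" "AE \<omega> in M. iexp (X \<omega>) = 1"
      using 2(2) unfolding mu by (eventually_elim, simp)+
    have i1: "(\<integral>\<omega>. (X \<omega>)\<^sup>2 \<partial>M) = (\<integral>\<omega>. 0 \<partial>M)"
      by (rule integral_cong_AE[OF borel_measurable_power[OF 2(1)] borel_measurable_const AE0(1)])
    have i2: "(CLINT \<omega>|M. iexp (X \<omega>)) = (CLINT \<omega>|M. 1)"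
      by (rule integral_cong_AE[OF measurable_compose[OF 2(1) borel_measurable_iexp] borel_measurable_const AE0(2)])
    show ?thesis unfolding i1 i2 by (simp add: prob_space)
  qed
qed

lemma
  assumes "gff_law P"
  shows gff_prob_space: "prob_space P"
    and gff_measurable: "(\<lambda>\<phi>. \<phi> x) \<in> borel_measurable P"
proof -
  show "prob_space P" using assms by (simp add: gff_law_def gaussian_field_law_def)
  have s: "sets P = sets (\<Pi>\<^sub>M x\<in>UNIV. borel)" using assms by (simp add: gff_law_def gaussian_field_law_def)
  have "(\<lambda>\<phi>. \<phi> x) \<in> borel_measurable (\<Pi>\<^sub>M x\<in>UNIV. (borel :: real measure))"
    by (rule measurable_component_singleton) simp
  then show "(\<lambda>\<phi>. \<phi> x) \<in> borel_measurable P" using measurable_cong_sets[OF s refl] by blast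
qed

text \<open>Linear combinations of the field are Gaussian by assumption, and their variances are given by the
Green function; so the characteristic functional is known.\<close>

lemma gff_gaussian_vector:
  assumes P: "gff_law P" and V: "finite V"
  shows "gaussian_vector P (\<lambda>\<phi>. \<phi>) V green"
  unfolding gaussian_vector_def
proof (intro conjI ballI allI gff_prob_space[OF P] gff_measurable[OF P])
  fix t
  interpret prob_space P by (rule gff_prob_space[OF P])
  have grv: "gaussian_rv P (\<lambda>\<phi>. \<Sum>x\<in>F. a x * \<phi> x)" if "finite F" for F a
    using P that by (simp add: gff_law_def gaussian_field_law_def)
  have "gaussian_rv P (\<lambda>\<phi>. \<phi> x)" for x using grv[of "{x}" "\<lambda>_. 1"] by simp
  note si = gaussian_rv_square_integrable[OF prob_space_axioms this]
  have prod: "integrable P (\<lambda>\<phi>. \<phi> x * \<phi> y)" for x y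
  proof (rule Bochner_Integration.integrable_bound)
    show "integrable P (\<lambda>\<phi>. (\<phi> x)\<^sup>2 + (\<phi> y)\<^sup>2)" by (intro Bochner_Integration.integrable_add si)
    have "\<bar>a * b\<bar> \<le> a\<^sup>2 + b\<^sup>2" for a b :: real
    proof -
      have "0 \<le> (\<bar>a\<bar> - \<bar>b\<bar>)\<^sup>2" "0 \<le> a\<^sup>2 + b\<^sup>2" by auto
      moreover have "(\<bar>a\<bar> - \<bar>b\<bar>)\<^sup>2 = a\<^sup>2 + b\<^sup>2 - 2 * \<bar>a * b\<bar>" by (simp add: power2_diff abs_mult)
      ultimately show ?thesis by linarith
    qed
    then show "AE \<phi> in P. norm (\<phi> x * \<phi> y) \<le> norm ((\<phi> x)\<^sup>2 + (\<phi> y)\<^sup>2)" by simp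
  qed (intro borel_measurable_times gff_measurable[OF P])
  have mean: "(\<integral>\<phi>. (\<Sum>x\<in>V. t x * \<phi> x) \<partial>P) = 0"
  proof -
    have "(\<integral>\<phi>. (\<Sum>x\<in>V. t x * \<phi> x) \<partial>P) = (\<Sum>x\<in>V. \<integral>\<phi>. t x * \<phi> x \<partial>P)"
      by (intro Bochner_Integration.integral_sum integrable_mult_right si)
    also have "\<dots> = 0" using P by (simp add: gff_law_def)
    finally show ?thesis .
  qed
  have "(\<integral>\<phi>. (\<Sum>x\<in>V. t x * \<phi> x)\<^sup>2 \<partial>P) = (\<integral>\<phi>. (\<Sum>x\<in>V. \<Sum>y\<in>V. t x * t y * (\<phi> x * \<phi> y)) \<partial>P)"
    unfolding power2_eq_square sum_product
    by (intro Bochner_Integration.integral_cong sum.cong refl) (simp only: mult_ac)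
  also have "\<dots> = (\<Sum>x\<in>V. \<Sum>y\<in>V. \<integral>\<phi>. t x * t y * (\<phi> x * \<phi> y) \<partial>P)"
    by (simp only: Bochner_Integration.integral_sum Bochner_Integration.integrable_sum integrable_mult_right prod)
  also have "\<dots> = cov_form V green t"
    using P by (simp add: gff_law_def)
  finally have sq: "(\<integral>\<phi>. (\<Sum>x\<in>V. t x * \<phi> x)\<^sup>2 \<partial>P) = cov_form V green t" .
  show "(CLINT \<phi>|P. iexp (\<Sum>x\<in>V. t x * \<phi> x)) = complex_of_real (exp (- cov_form V green t / 2))"
    using gaussian_rv_char[OF prob_space_axioms grv[OF V] mean] unfolding sq .
qed

lemma gaussian_vector_reindex:
  assumes g: "gaussian_vector M X (f ` V) C" and inj: "inj_on f V"
  shows "gaussian_vector M (\<lambda>\<omega> x. X \<omega> (f x)) V (\<lambda>x y. C (f x) (f y))"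
  unfolding gaussian_vector_def
proof (intro conjI ballI allI)
  show "prob_space M" using g by (simp add: gaussian_vector_def)
  show "(\<lambda>\<omega>. X \<omega> (f x)) \<in> borel_measurable M" if "x \<in> V" for x
    using g that by (simp add: gaussian_vector_def)
  fix t :: "_ \<Rightarrow> real"
  define t' where "t' y = t (the_inv_into V f y)" for y
  have t': "t' (f x) = t x" if "x \<in> V" for x using that inj by (simp add: t'_def the_inv_into_f_f)
  have r: "(\<Sum>y\<in>f ` V. F y) = (\<Sum>x\<in>V. F (f x))" for F :: "_ \<Rightarrow> real"
    using sum.reindex[OF inj, of F] by simp
  have "(CLINT \<omega>|M. iexp (\<Sum>y\<in>f ` V. t' y * X \<omega> y)) = complex_of_real (exp (- cov_form (f ` V) C t' / 2))"
    using g by (simp only: gaussian_vector_def)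
  then show "(CLINT \<omega>|M. iexp (\<Sum>x\<in>V. t x * X \<omega> (f x))) = complex_of_real (exp (- (\<Sum>x\<in>V. \<Sum>y\<in>V. t x * t y * C (f x) (f y)) / 2))"
    by (simp add: r t')
qed

lemma gaussian_vector_cov_cong:
  assumes "gaussian_vector M X V C" "\<And>x y. x \<in> V \<Longrightarrow> y \<in> V \<Longrightarrow> C x y = D x y"
  shows "gaussian_vector M X V D"
proof -
  have "cov_form V C t = cov_form V D t" for t
    by (intro sum.cong refl) (simp add: assms(2))
  then show ?thesis using assms(1) unfolding gaussian_vector_def by presburger
qed

lemma char_pair:
  assumes M: "prob_space M" and N: "prob_space N"
    and f [measurable]: "f \<in> borel_measurable M" and g [measurable]: "g \<in> borel_measurable N"
  shows "(CLINT z|M \<Otimes>\<^sub>M N. iexp (f (fst z) + g (snd z))) = (CLINT \<omega>|M. iexp (f \<omega>)) * (CLINT \<eta>|N. iexp (g \<eta>))"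
proof -
  interpret M: prob_space M by fact
  interpret N: prob_space N by fact
  interpret pair_prob_space M N ..
  have i: "integrable (M \<Otimes>\<^sub>M N) (\<lambda>z. iexp (f (fst z) + g (snd z)))"
    by (rule P.integrable_bounded[of _ 1]) auto
  have "(CLINT z|M \<Otimes>\<^sub>M N. iexp (f (fst z) + g (snd z))) = (CLINT \<omega>|M. CLINT \<eta>|N. iexp (f \<omega>) * iexp (g \<eta>))"
    unfolding integral_fst'[OF i, symmetric] by (simp add: distrib_left exp_add)
  then show ?thesis by simp
qed

lemma gaussian_vector_sum:
  assumes X: "gaussian_vector M X V A" and Y: "gaussian_vector N Y V B"
  shows "gaussian_vector (M \<Otimes>\<^sub>M N) (\<lambda>z x. X (fst z) x + Y (snd z) x) V (\<lambda>x y. A x y + B x y)"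
  unfolding gaussian_vector_def
proof (intro conjI ballI allI)
  interpret M: prob_space M using X by (simp add: gaussian_vector_def)
  interpret N: prob_space N using Y by (simp add: gaussian_vector_def)
  interpret pair_prob_space M N ..
  show "prob_space (M \<Otimes>\<^sub>M N)" by (rule P.prob_space_axioms)
  have Xm: "(\<lambda>\<omega>. X \<omega> x) \<in> borel_measurable M" if "x \<in> V" for x
    using X that by (simp add: gaussian_vector_def)
  have Ym: "(\<lambda>\<omega>. Y \<omega> x) \<in> borel_measurable N" if "x \<in> V" for x
    using Y that by (simp add: gaussian_vector_def)
  show "(\<lambda>z. X (fst z) x + Y (snd z) x) \<in> borel_measurable (M \<Otimes>\<^sub>M N)" if "x \<in> V" for x
    by (intro borel_measurable_add measurable_compose[OF measurable_fst Xm[OF that]]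
        measurable_compose[OF measurable_snd Ym[OF that]])
  fix t
  have lX: "(\<lambda>\<omega>. \<Sum>x\<in>V. t x * X \<omega> x) \<in> borel_measurable M"
    by (intro borel_measurable_sum borel_measurable_times borel_measurable_const Xm)
  have lY: "(\<lambda>\<omega>. \<Sum>x\<in>V. t x * Y \<omega> x) \<in> borel_measurable N"
    by (intro borel_measurable_sum borel_measurable_times borel_measurable_const Ym)
  have "(CLINT z|M \<Otimes>\<^sub>M N. iexp (\<Sum>x\<in>V. t x * (X (fst z) x + Y (snd z) x)))
    = (CLINT z|M \<Otimes>\<^sub>M N. iexp ((\<Sum>x\<in>V. t x * X (fst z) x) + (\<Sum>x\<in>V. t x * Y (snd z) x)))"
    by (simp only: distrib_left sum.distrib)
  also have "\<dots> = char_functional M X V t * char_functional N Y V t"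
    by (rule char_pair[OF M.prob_space_axioms N.prob_space_axioms lX lY])
  also have "\<dots> = complex_of_real (exp (- cov_form V A t / 2) * exp (- cov_form V B t / 2))"
    using X Y by (simp only: gaussian_vector_def of_real_mult)
  also have "\<dots> = complex_of_real (exp (- (\<Sum>x\<in>V. \<Sum>y\<in>V. t x * t y * (A x y + B x y)) / 2))"
    unfolding exp_add[symmetric] by (simp add: distrib_left sum.distrib add_divide_distrib diff_divide_distrib)
  finally show "(CLINT z|M \<Otimes>\<^sub>M N. iexp (\<Sum>x\<in>V. t x * (X (fst z) x + Y (snd z) x))) =
    complex_of_real (exp (- (\<Sum>x\<in>V. \<Sum>y\<in>V. t x * t y * (A x y + B x y)) / 2))" .
qed

lemma gaussian_vector_extend:
  assumes X: "gaussian_vector M X V A" and W: "V \<subseteq> W" "finite W"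
  shows "gaussian_vector M (\<lambda>\<omega> x. if x \<in> V then X \<omega> x else 0) W (\<lambda>x y. if x \<in> V \<and> y \<in> V then A x y else 0)"
  unfolding gaussian_vector_def
proof (intro conjI ballI allI)
  show "prob_space M" using X by (simp add: gaussian_vector_def)
  show "(\<lambda>\<omega>. if x \<in> V then X \<omega> x else 0) \<in> borel_measurable M" for x
    using X by (cases "x \<in> V") (auto simp: gaussian_vector_def)
  fix t
  have e: "(\<Sum>x\<in>W. F x) = (\<Sum>x\<in>V. G x)" if "\<And>x. x \<in> V \<Longrightarrow> F x = G x" "\<And>x. x \<notin> V \<Longrightarrow> F x = 0" for F G :: "_ \<Rightarrow> real"
  proof -
    have "(\<Sum>x\<in>W. F x) = (\<Sum>x\<in>V. F x)" using W that(2) by (intro sum.mono_neutral_right) auto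
    then show ?thesis using that(1) by simp
  qed
  have 1: "(\<Sum>x\<in>W. t x * (if x \<in> V then X \<omega> x else 0)) = (\<Sum>x\<in>V. t x * X \<omega> x)" for \<omega>
    by (rule e) auto
  have 2: "(\<Sum>x\<in>W. \<Sum>y\<in>W. t x * t y * (if x \<in> V \<and> y \<in> V then A x y else 0)) = cov_form V A t"
    by (rule e, rule e) auto
  show "(CLINT \<omega>|M. iexp (\<Sum>x\<in>W. t x * (if x \<in> V then X \<omega> x else 0))) =
    complex_of_real (exp (- (\<Sum>x\<in>W. \<Sum>y\<in>W. t x * t y * (if x \<in> V \<and> y \<in> V then A x y else 0)) / 2))"
    unfolding 1 2 using X by (simp only: gaussian_vector_def)
qed

text \<open>Two independent vectors on disjoint index sets form one Gaussian vector for any kernel without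
correlations between the two sets.\<close>

lemma gaussian_vector_join:
  assumes X: "gaussian_vector M X V A" and Y: "gaussian_vector N Y W A"
    and VW: "finite V" "finite W" "V \<inter> W = {}"
    and cross: "\<And>x y. x \<in> V \<Longrightarrow> y \<in> W \<Longrightarrow> A x y = 0 \<and> A y x = 0"
  shows "gaussian_vector (M \<Otimes>\<^sub>M N) (\<lambda>z x. (if x \<in> V then X (fst z) x else 0) + (if x \<in> W then Y (snd z) x else 0)) (V \<union> W) A"
  by (rule gaussian_vector_cov_cong, rule gaussian_vector_sum[OF gaussian_vector_extend[OF X] gaussian_vector_extend[OF Y]])
     (use VW cross in auto)

section \<open>Decoupling increasing events by sprinkling\<close>

text \<open>An increasing event at level \<open>h\<close> is encoded by the family of vertex sets on which the field has to be
at least \<open>h\<close>.  In this form, adding a constant to the field is the same as lowering the level.\<close>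

definition above :: "'x set set \<Rightarrow> real \<Rightarrow> ('x \<Rightarrow> real) \<Rightarrow> bool" where
  "above S h \<phi> \<longleftrightarrow> (\<exists>A\<in>S. \<forall>x\<in>A. h \<le> \<phi> x)"

lemma above_mono:
  assumes "above S h \<phi>" "\<And>x. x \<in> \<Union>S \<Longrightarrow> h \<le> \<phi> x \<Longrightarrow> h' \<le> \<psi> x"
  shows "above S h' \<psi>"
proof -
  from assms(1) obtain A where A: "A \<in> S" "\<And>x. x \<in> A \<Longrightarrow> h \<le> \<phi> x"
    unfolding above_def by blast
  have "\<forall>x\<in>A. h' \<le> \<psi> x" using A assms(2) by blast
  then show ?thesis using A(1) unfolding above_def by blast
qed

lemma above_cong:
  assumes "\<And>x. x \<in> \<Union>S \<Longrightarrow> \<phi> x = \<psi> x"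
  shows "above S h \<phi> \<longleftrightarrow> above S h \<psi>"
proof
  show "above S h \<phi> \<Longrightarrow> above S h \<psi>" by (erule above_mono) (simp add: assms)
  show "above S h \<psi> \<Longrightarrow> above S h \<phi>" by (erule above_mono) (simp add: assms)
qed

lemma above_measurable:
  assumes V: "finite V" and S: "S \<subseteq> Pow V"
    and X: "\<And>x. x \<in> V \<Longrightarrow> (\<lambda>\<omega>. X \<omega> x) \<in> borel_measurable M"
  shows "{\<omega> \<in> space M. above S h (X \<omega>)} \<in> sets M"
proof -
  have fin: "finite S" using finite_subset[OF S] V by simp
  have "{\<omega> \<in> space M. \<forall>x\<in>A. h \<le> X \<omega> x} \<in> sets M" if "A \<in> S" for A
  proof (rule sets.sets_Collect_finite_All)
    show "finite A" using that S V finite_subset by blast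
    show "{\<omega> \<in> space M. h \<le> X \<omega> x} \<in> sets M" if "x \<in> A" for x
      using that \<open>A \<in> S\<close> S by (intro borel_measurable_le borel_measurable_const X) auto
  qed
  then show ?thesis unfolding above_def by (intro sets.sets_Collect_finite_Ex fin)
qed

lemma gaussian_vectorD:
  assumes "gaussian_vector M X V C"
  shows "prob_space M" "x \<in> V \<Longrightarrow> (\<lambda>\<omega>. X \<omega> x) \<in> borel_measurable M"
    "char_functional M X V t = complex_of_real (exp (- cov_form V C t / 2))"
  using assms unfolding gaussian_vector_def by blast+

text \<open>The coordinates outside \<open>V\<close> are arbitrary, which is why the event has to be local.\<close>

lemma gaussian_vector_law_cong:
  assumes V: "finite V" and X: "gaussian_vector M X V C" and Y: "gaussian_vector N Y V C"
    and Q: "{f \<in> space (\<Pi>\<^sub>M x\<in>V. borel). Q f} \<in> sets (\<Pi>\<^sub>M x\<in>V. (borel :: real measure))"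
    and loc: "\<And>f. Q f \<longleftrightarrow> Q (restrict f V)"
  shows "\<P>(\<omega> in M. Q (X \<omega>)) = \<P>(\<eta> in N. Q (Y \<eta>))"
proof -
  have Xm: "(\<lambda>\<omega>. X \<omega> x) \<in> borel_measurable M" if "x \<in> V" for x
    using gaussian_vectorD(2)[OF X that] .
  have Ym: "(\<lambda>\<omega>. Y \<omega> x) \<in> borel_measurable N" if "x \<in> V" for x
    using gaussian_vectorD(2)[OF Y that] .
  have mX: "(\<lambda>\<omega>. restrict (X \<omega>) V) \<in> measurable M (\<Pi>\<^sub>M x\<in>V. borel)"
    by (rule measurable_restrict) (rule Xm)
  have mY: "(\<lambda>\<omega>. restrict (Y \<omega>) V) \<in> measurable N (\<Pi>\<^sub>M x\<in>V. borel)"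
    by (rule measurable_restrict) (rule Ym)
  have law: "distr M (\<Pi>\<^sub>M x\<in>V. borel) (\<lambda>\<omega>. restrict (X \<omega>) V) = distr N (\<Pi>\<^sub>M x\<in>V. borel) (\<lambda>\<omega>. restrict (Y \<omega>) V)"
    by (rule finite_dimensional_law_unique[OF V gaussian_vectorD(1)[OF X] gaussian_vectorD(1)[OF Y] Xm Ym])
      (simp_all only: gaussian_vectorD(3)[OF X] gaussian_vectorD(3)[OF Y])
  let ?S = "{f \<in> space (\<Pi>\<^sub>M x\<in>V. (borel :: real measure)). Q f}"
  have v: "(\<lambda>\<omega>. restrict (Z \<omega>) V) -` ?S \<inter> space M' = {\<omega> \<in> space M'. Q (Z \<omega>)}" for Z and M' :: "'m measure"
    using loc by (auto simp: space_PiM)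
  have "\<P>(\<omega> in M. Q (X \<omega>)) = measure (distr M (\<Pi>\<^sub>M x\<in>V. borel) (\<lambda>\<omega>. restrict (X \<omega>) V)) ?S"
    by (subst measure_distr[OF mX Q]) (rule arg_cong[where f="measure M", OF v[symmetric]])
  also have "\<dots> = \<P>(\<eta> in N. Q (Y \<eta>))"
    unfolding law by (subst measure_distr[OF mY Q]) (rule arg_cong[where f="measure N", OF v])
  finally show ?thesis .
qed

lemma prob_above_cong:
  assumes V: "finite V" and X: "gaussian_vector M X V C" and Y: "gaussian_vector N Y V C"
    and S: "S \<subseteq> Pow V"
  shows "\<P>(\<omega> in M. above S h (X \<omega>)) = \<P>(\<eta> in N. above S h (Y \<eta>))"
proof (rule gaussian_vector_law_cong[OF V X Y])
  have "(\<lambda>f. f x) \<in> borel_measurable (\<Pi>\<^sub>M x\<in>V. (borel :: real measure))" if "x \<in> V" for x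
    using that by (rule measurable_component_singleton)
  then show "{f \<in> space (\<Pi>\<^sub>M x\<in>V. borel). above S h f} \<in> sets (\<Pi>\<^sub>M x\<in>V. (borel :: real measure))"
    by (rule above_measurable[OF V S])
  show "above S h f \<longleftrightarrow> above S h (restrict f V)" for f
    by (rule above_cong) (use S in auto)
qed

lemma above_both: "above ((\<lambda>(A, B). A \<union> B) ` (S \<times> T)) h \<phi> \<longleftrightarrow> above S h \<phi> \<and> above T h \<phi>"
  unfolding above_def by (auto simp: ball_Un)

lemma prob_pair_Times:
  assumes "prob_space M" "prob_space N" "A \<in> sets M" "B \<in> sets N"
  shows "measure (M \<Otimes>\<^sub>M N) (A \<times> B) = measure M A * measure N B"
proof -
  interpret M: prob_space M by fact
  interpret N: prob_space N by fact
  show ?thesis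
    unfolding measure_def N.emeasure_pair_measure_Times[OF assms(3,4)] by (rule enn2real_mult)
qed

text \<open>Moving the field by at most \<open>\<epsilon>\<close> outside a bad event is paid for by lowering the level by \<open>\<epsilon>\<close>.\<close>

lemma (in prob_space) prob_above_perturb:
  assumes Z: "{\<omega> \<in> space M. above S (h - \<epsilon>) (Z \<omega>)} \<in> events" and B: "B \<in> events"
    and close: "\<And>\<omega> x. \<omega> \<in> space M \<Longrightarrow> \<omega> \<notin> B \<Longrightarrow> x \<in> \<Union>S \<Longrightarrow> Y \<omega> x - \<epsilon> \<le> Z \<omega> x"
  shows "\<P>(\<omega> in M. above S h (Y \<omega>)) \<le> \<P>(\<omega> in M. above S (h - \<epsilon>) (Z \<omega>)) + prob B"
proof -
  have "{\<omega> \<in> space M. above S h (Y \<omega>)} \<subseteq> {\<omega> \<in> space M. above S (h - \<epsilon>) (Z \<omega>)} \<union> B"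
  proof
    fix \<omega> assume "\<omega> \<in> {\<omega> \<in> space M. above S h (Y \<omega>)}"
    then have \<omega>: "\<omega> \<in> space M" and ab: "above S h (Y \<omega>)" by auto
    show "\<omega> \<in> {\<omega> \<in> space M. above S (h - \<epsilon>) (Z \<omega>)} \<union> B"
    proof (cases "\<omega> \<in> B")
      case False
      have "above S (h - \<epsilon>) (Z \<omega>)"
      proof (rule above_mono[OF ab])
        fix x assume "x \<in> \<Union>S" "h \<le> Y \<omega> x"
        then show "h - \<epsilon> \<le> Z \<omega> x" using close[OF \<omega> False, of x] by linarith
      qed
      then show ?thesis using \<omega> by blast
    qed blast
  qed
  then have "\<P>(\<omega> in M. above S h (Y \<omega>)) \<le> prob ({\<omega> \<in> space M. above S (h - \<epsilon>) (Z \<omega>)} \<union> B)"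
    by (intro finite_measure_mono sets.Un Z B)
  also have "\<dots> \<le> \<P>(\<omega> in M. above S (h - \<epsilon>) (Z \<omega>)) + prob B"
    by (intro measure_Un_le Z B)
  finally show ?thesis .
qed

text \<open>The vector is realised as \<open>Y + Y3\<close> with \<open>Y\<close> of covariance \<open>A\<close>, hence independent on \<open>V\<close> and \<open>W\<close>, and \<open>Y3\<close>
independent of \<open>Y\<close> with small variances.  One \<open>\<epsilon>\<close> is spent to pass from the vector to \<open>Y\<close>, where the
probability factorises, and another one to return from each factor to the vector.\<close>

lemma sprinkled_decoupling:
  fixes X :: "'a \<Rightarrow> 'x \<Rightarrow> real"
  assumes V: "finite V" "finite W" "V \<inter> W = {}"
    and psd: "psd_on (V \<union> W) A" "psd_on (V \<union> W) B"
    and cross: "\<And>x y. x \<in> V \<Longrightarrow> y \<in> W \<Longrightarrow> A x y = 0"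
    and var: "\<And>x. x \<in> V \<union> W \<Longrightarrow> B x x \<le> \<kappa>" and k: "0 < \<kappa>" and e: "0 < \<epsilon>"
    and X: "gaussian_vector M X (V \<union> W) (\<lambda>x y. A x y + B x y)"
    and S: "S \<subseteq> Pow V" and T: "T \<subseteq> Pow W"
  defines "err \<equiv> 2 * real (card (V \<union> W)) * exp (- \<epsilon>\<^sup>2 / (2 * \<kappa>))"
  shows "\<P>(\<omega> in M. above S h (X \<omega>) \<and> above T h (X \<omega>)) \<le>
     (\<P>(\<omega> in M. above S (h - 2 * \<epsilon>) (X \<omega>)) + err) * (\<P>(\<omega> in M. above T (h - 2 * \<epsilon>) (X \<omega>)) + err) + err"
proof -
  have VW: "finite (V \<union> W)" using V by simp
  have ST: "S \<subseteq> Pow (V \<union> W)" "T \<subseteq> Pow (V \<union> W)" using S T by auto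
  obtain Y1 where Y1: "gaussian_vector (white_noise V) Y1 V A"
    by (rule gaussian_vector_exists[OF V(1) psd_on_subset[OF psd(1) Un_upper1 VW]])
  obtain Y2 where Y2: "gaussian_vector (white_noise W) Y2 W A"
    by (rule gaussian_vector_exists[OF V(2) psd_on_subset[OF psd(1) Un_upper2 VW]])
  obtain Y3 where Y3: "gaussian_vector (white_noise (V \<union> W)) Y3 (V \<union> W) B"
    and tail: "\<And>x \<epsilon> \<kappa>. \<lbrakk>x \<in> V \<union> W; B x x \<le> \<kappa>; 0 < \<kappa>; 0 < \<epsilon>\<rbrakk> \<Longrightarrow>
      \<P>(\<omega> in white_noise (V \<union> W). \<epsilon> \<le> \<bar>Y3 \<omega> x\<bar>) \<le> 2 * exp (- \<epsilon>\<^sup>2 / (2 * \<kappa>))"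
    by (rule gaussian_vector_exists[OF VW psd(2)]) blast
  let ?N1 = "white_noise V :: ('x \<Rightarrow> real) measure"
  let ?N2 = "white_noise W :: ('x \<Rightarrow> real) measure"
  let ?N3 = "white_noise (V \<union> W) :: ('x \<Rightarrow> real) measure"
  let ?N12 = "?N1 \<Otimes>\<^sub>M ?N2"
  let ?N = "?N12 \<Otimes>\<^sub>M ?N3"
  define Y where "Y z x = (if x \<in> V then Y1 (fst z) x else 0) + (if x \<in> W then Y2 (snd z) x else 0)"
    for z :: "('x \<Rightarrow> real) \<times> ('x \<Rightarrow> real)" and x
  define Z where "Z z x = Y (fst z) x + Y3 (snd z) x" for z :: "(('x \<Rightarrow> real) \<times> ('x \<Rightarrow> real)) \<times> ('x \<Rightarrow> real)" and x
  have cross': "A x y = 0 \<and> A y x = 0" if "x \<in> V" "y \<in> W" for x y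
    using cross[OF that] psd_on_sym[OF psd(1), of x y] that by auto
  have Z: "gaussian_vector ?N Z (V \<union> W) (\<lambda>x y. A x y + B x y)"
    unfolding Z_def Y_def by (rule gaussian_vector_sum[OF gaussian_vector_join[OF Y1 Y2 V cross'] Y3])
  have p1: "prob_space ?N1" and p2: "prob_space ?N2" and p3: "prob_space ?N3"
    by (rule prob_space_white_noise)+
  have p12: "prob_space ?N12" by (rule prob_space_pair[OF p1 p2])
  have pN: "prob_space ?N" by (rule prob_space_pair[OF p12 p3])
  interpret N: prob_space ?N by (rule pN)
  define h' where "h' = h - \<epsilon>"
  define E1 where "E1 = {\<omega> \<in> space ?N1. above S h' (Y1 \<omega>)}"
  define E2 where "E2 = {\<omega> \<in> space ?N2. above T h' (Y2 \<omega>)}"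
  \<comment> \<open>the event that the discarded field is not small\<close>
  define bad where "bad = {\<omega> \<in> space ?N3. \<exists>x\<in>V \<union> W. \<epsilon> \<le> \<bar>Y3 \<omega> x\<bar>}"
  have sE1: "E1 \<in> sets ?N1" unfolding E1_def by (rule above_measurable[OF V(1) S gaussian_vectorD(2)[OF Y1]])
  have sE2: "E2 \<in> sets ?N2" unfolding E2_def by (rule above_measurable[OF V(2) T gaussian_vectorD(2)[OF Y2]])
  have sb: "{\<omega> \<in> space ?N3. \<epsilon> \<le> \<bar>Y3 \<omega> x\<bar>} \<in> sets ?N3" if "x \<in> V \<union> W" for x
    by (intro borel_measurable_le borel_measurable_const borel_measurable_abs gaussian_vectorD(2)[OF Y3 that])
  have bad_eq: "bad = (\<Union>x\<in>V \<union> W. {\<omega> \<in> space ?N3. \<epsilon> \<le> \<bar>Y3 \<omega> x\<bar>})" by (auto simp: bad_def)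
  have sbad: "bad \<in> sets ?N3" unfolding bad_eq by (intro sets.finite_UN VW sb)
  have pbad: "measure ?N3 bad \<le> err"
  proof -
    have "measure ?N3 bad \<le> (\<Sum>x\<in>V \<union> W. \<P>(\<omega> in ?N3. \<epsilon> \<le> \<bar>Y3 \<omega> x\<bar>))"
      unfolding bad_eq by (intro finite_measure.finite_measure_subadditive_finite prob_space.finite_measure p3 VW) (use sb in auto)
    also have "\<dots> \<le> (\<Sum>x\<in>V \<union> W. 2 * exp (- \<epsilon>\<^sup>2 / (2 * \<kappa>)))"
      by (intro sum_mono tail var k e)
    also have "\<dots> = err" by (simp add: err_def)
    finally show ?thesis .
  qed
  let ?F = "(E1 \<times> E2) \<times> space ?N3"
  let ?B = "space ?N12 \<times> bad"
  have sp12: "space ?N12 \<in> sets ?N12" and sp3: "space ?N3 \<in> sets ?N3" and sp1: "space ?N1 \<in> sets ?N1" and sp2: "space ?N2 \<in> sets ?N2"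
    by (rule sets.top)+
  have sE12: "E1 \<times> E2 \<in> sets ?N12" by (rule pair_measureI[OF sE1 sE2])
  have sF: "?F \<in> sets ?N" by (rule pair_measureI[OF sE12 sp3])
  have sB: "?B \<in> sets ?N" by (rule pair_measureI[OF sp12 sbad])
  have mB: "measure ?N ?B \<le> err"
    using pbad by (simp add: prob_pair_Times[OF p12 p3 sp12 sbad] prob_space.prob_space[OF p12])
  have mF: "measure ?N ?F = measure ?N1 E1 * measure ?N2 E2"
    by (simp add: prob_pair_Times[OF p12 p3 sE12 sp3] prob_pair_Times[OF p1 p2 sE1 sE2] prob_space.prob_space[OF p3])
  have Zs: "{z \<in> space ?N. above S' r (Z z)} \<in> sets ?N" if "S' \<subseteq> Pow (V \<union> W)" for S' r
    by (rule above_measurable[OF VW that gaussian_vectorD(2)[OF Z]])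
  have single: "\<P>(\<omega> in M. above S' r (X \<omega>)) = \<P>(z in ?N. above S' r (Z z))" if "S' \<subseteq> Pow (V \<union> W)" for S' r
    by (rule prob_above_cong[OF VW X Z that])
  have Y_V: "Y z x = Y1 (fst z) x" if "x \<in> V" for z x
    using that V(3) by (auto simp: Y_def)
  have Y_W: "Y z x = Y2 (snd z) x" if "x \<in> W" for z x
    using that V(3) by (auto simp: Y_def)
  have good: "\<bar>Y3 (snd z) x\<bar> < \<epsilon>" if "z \<in> space ?N" "z \<notin> ?B" "x \<in> V \<union> W" for z x
    using that by (cases z) (auto simp: space_pair_measure bad_def not_le)
  have err0: "0 \<le> err" by (simp add: err_def)
  have h': "h' - \<epsilon> = h - 2 * \<epsilon>" by (simp add: h'_def)
  have up1: "measure ?N1 E1 \<le> \<P>(\<omega> in M. above S (h - 2 * \<epsilon>) (X \<omega>)) + err"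
  proof -
    have "measure ?N1 E1 = measure ?N ((E1 \<times> space ?N2) \<times> space ?N3)"
      by (simp add: prob_pair_Times[OF p12 p3 pair_measureI[OF sE1 sp2] sp3] prob_pair_Times[OF p1 p2 sE1 sp2]
          prob_space.prob_space[OF p3] prob_space.prob_space[OF p2])
    also have "(E1 \<times> space ?N2) \<times> space ?N3 = {z \<in> space ?N. above S h' (Y1 (fst (fst z)))}"
      by (auto simp: E1_def space_pair_measure)
    also have "measure ?N \<dots> \<le> \<P>(z in ?N. above S (h' - \<epsilon>) (Z z)) + measure ?N ?B"
    proof (rule N.prob_above_perturb[OF Zs[OF ST(1)] sB])
      fix z x assume z: "z \<in> space ?N" "z \<notin> ?B" and "x \<in> \<Union>S"
      then have "x \<in> V" using S by auto
      then show "Y1 (fst (fst z)) x - \<epsilon> \<le> Z z x" using good[OF z, of x] Y_V[of x] by (auto simp: Z_def)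
    qed
    finally show ?thesis unfolding single[OF ST(1)] h' using mB by simp
  qed
  have up2: "measure ?N2 E2 \<le> \<P>(\<omega> in M. above T (h - 2 * \<epsilon>) (X \<omega>)) + err"
  proof -
    have "measure ?N2 E2 = measure ?N ((space ?N1 \<times> E2) \<times> space ?N3)"
      by (simp add: prob_pair_Times[OF p12 p3 pair_measureI[OF sp1 sE2] sp3] prob_pair_Times[OF p1 p2 sp1 sE2]
          prob_space.prob_space[OF p3] prob_space.prob_space[OF p1])
    also have "(space ?N1 \<times> E2) \<times> space ?N3 = {z \<in> space ?N. above T h' (Y2 (snd (fst z)))}"
      by (auto simp: E2_def space_pair_measure)
    also have "measure ?N \<dots> \<le> \<P>(z in ?N. above T (h' - \<epsilon>) (Z z)) + measure ?N ?B"
    proof (rule N.prob_above_perturb[OF Zs[OF ST(2)] sB])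
      fix z x assume z: "z \<in> space ?N" "z \<notin> ?B" and "x \<in> \<Union>T"
      then have "x \<in> W" using T by auto
      then show "Y2 (snd (fst z)) x - \<epsilon> \<le> Z z x" using good[OF z, of x] Y_W[of x] by (auto simp: Z_def)
    qed
    finally show ?thesis unfolding single[OF ST(2)] h' using mB by simp
  qed
  let ?J = "(\<lambda>(A, B). A \<union> B) ` (S \<times> T)"
  have J: "?J \<subseteq> Pow (V \<union> W)" using S T by auto
  have "above ?J h' (Y z) \<longleftrightarrow> above S h' (Y1 (fst z)) \<and> above T h' (Y2 (snd z))" for z
  proof -
    have "above S h' (Y z) \<longleftrightarrow> above S h' (Y1 (fst z))" by (rule above_cong) (use S in \<open>auto intro: Y_V\<close>)
    moreover have "above T h' (Y z) \<longleftrightarrow> above T h' (Y2 (snd z))" by (rule above_cong) (use T in \<open>auto intro: Y_W\<close>)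
    ultimately show ?thesis unfolding above_both by blast
  qed
  then have F_eq: "{z \<in> space ?N. above ?J (h - \<epsilon>) (Y (fst z))} = ?F"
    unfolding h'_def[symmetric] by (auto simp: E1_def E2_def space_pair_measure)
  have "\<P>(\<omega> in M. above S h (X \<omega>) \<and> above T h (X \<omega>)) = \<P>(z in ?N. above ?J h (Z z))"
    unfolding above_both[symmetric] by (rule single[OF J])
  also have "\<dots> \<le> \<P>(z in ?N. above ?J (h - \<epsilon>) (Y (fst z))) + measure ?N ?B"
  proof (rule N.prob_above_perturb[OF _ sB])
    show "{z \<in> space ?N. above ?J (h - \<epsilon>) (Y (fst z))} \<in> sets ?N" unfolding F_eq by (rule sF)
    fix z x assume z: "z \<in> space ?N" "z \<notin> ?B" and "x \<in> \<Union>?J"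
    then have "x \<in> V \<union> W" using J by blast
    then show "Z z x - \<epsilon> \<le> Y (fst z) x" using good[OF z, of x] by (auto simp: Z_def)
  qed
  also have "\<dots> = measure ?N ?F + measure ?N ?B" unfolding F_eq ..
  also have "\<dots> \<le> measure ?N1 E1 * measure ?N2 E2 + err" using mF mB by simp
  also have "\<dots> \<le> (\<P>(\<omega> in M. above S (h - 2 * \<epsilon>) (X \<omega>)) + err) * (\<P>(\<omega> in M. above T (h - 2 * \<epsilon>) (X \<omega>)) + err) + err"
    using up1 up2 err0 by (intro add_right_mono mult_mono) (auto intro: add_nonneg_nonneg)
  finally show ?thesis .
qed

section \<open>Crossings of boxes\<close>

definition sup_box :: "int ^ 'd::finite \<Rightarrow> nat \<Rightarrow> (int ^ 'd) set" where
  "sup_box c r = {y. sup_norm (y - c) \<le> int r}"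

text \<open>The paths are confined to the box of radius \<open>2 * L\<close>, so that a crossing is determined by finitely many
values of the field.\<close>

definition crossings :: "int ^ 'd::finite \<Rightarrow> nat \<Rightarrow> (int ^ 'd) set set" where
  "crossings c L = {set p | p. p \<noteq> [] \<and> successively adjacent p \<and> set p \<subseteq> sup_box c (2 * L) \<and>
      hd p \<in> sup_box c L \<and> sup_norm (last p - c) = 2 * int L}"

lemma crossings_subset: "crossings c L \<subseteq> Pow (sup_box c (2 * L))"
  by (auto simp: crossings_def)

lemma sup_box_eq_image: "sup_box c r = (\<lambda>y. y + c) ` {y. sup_norm y \<le> int r}"
proof (intro set_eqI iffI)
  fix y assume "y \<in> sup_box c r"
  then show "y \<in> (\<lambda>y. y + c) ` {y. sup_norm y \<le> int r}"
    by (intro image_eqI[of _ _ "y - c"]) (auto simp: sup_box_def)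
qed (auto simp: sup_box_def)

lemma finite_sup_box: "finite (sup_box c r)"
  unfolding sup_box_eq_image by (intro finite_imageI finite_sup_norm_ball)

lemma card_sup_box:
  fixes c :: "int ^ 'd::finite"
  shows "card (sup_box c r) = (2 * r + 1) ^ CARD('d)"
  unfolding sup_box_eq_image by (subst card_image) (auto simp: inj_on_def card_sup_norm_ball)

text \<open>The path is stopped when it first leaves the interior of the box of radius \<open>2 * L\<close>; as steps have length
1, it cannot jump over the boundary.\<close>

lemma path_contains_crossing:
  assumes p: "p \<noteq> []" "successively adjacent p" and L: "1 \<le> L"
    and hd: "sup_norm (hd p - c) \<le> int L" and last: "2 * int L \<le> sup_norm (last p - c)"
  shows "\<exists>A\<in>crossings c L. A \<subseteq> set p"
proof -
  let ?in = "\<lambda>y. sup_norm (y - c) < 2 * int L"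
  define q where "q = takeWhile ?in p"
  have "last p \<in> set p" using p by simp
  then have "dropWhile ?in p \<noteq> []" using last by (auto intro!: bexI[of _ "last p"])
  then obtain y r where yr: "dropWhile ?in p = y # r" by (cases "dropWhile ?in p") auto
  have pq: "p = (q @ [y]) @ r" using takeWhile_dropWhile_id[of ?in p] yr by (simp add: q_def)
  have y: "2 * int L \<le> sup_norm (y - c)" using hd_dropWhile[of ?in p] yr by auto
  have q: "?in x" if "x \<in> set q" for x using that unfolding q_def by (auto dest: set_takeWhileD)
  have "q \<noteq> []"
  proof
    assume "q = []"
    then have "hd p = y" using pq by simp
    then show False using hd y L by simp
  qed
  have s: "successively adjacent (q @ [y])" using p(2) unfolding pq successively_append_iff[of _ "q @ [y]"] by simp
  then have adj: "adjacent (last q) y" using \<open>q \<noteq> []\<close> by (simp add: successively_append_iff)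
  have "sup_norm (y - c) \<le> sup_norm (y - last q) + sup_norm (last q - c)"
    by (rule sup_norm_triangle_diff)
  moreover have "sup_norm (y - last q) \<le> 1"
    using adjacent_sup_norm_le[OF adj] by (simp add: sup_norm_minus_commute)
  moreover have "?in (last q)" using q \<open>q \<noteq> []\<close> by simp
  ultimately have y2: "sup_norm (y - c) = 2 * int L" using y by linarith
  have "set (q @ [y]) \<in> crossings c L"
    unfolding crossings_def
  proof (intro CollectI exI[of _ "q @ [y]"] conjI refl)
    show "set (q @ [y]) \<subseteq> sup_box c (2 * L)" using q y2 by (force simp: sup_box_def)
    show "hd (q @ [y]) \<in> sup_box c L" using hd \<open>q \<noteq> []\<close> unfolding pq by (simp add: sup_box_def)
  qed (use s y2 in auto)
  moreover have "set (q @ [y]) \<subseteq> set p" unfolding pq by auto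
  ultimately show ?thesis by blast
qed

lemma connected_above_iff_crossing:
  assumes "1 \<le> L"
  shows "connected_above h (Ball_inf L) (Sphere_inf (2 * L)) \<phi> \<longleftrightarrow> above (crossings 0 L) h \<phi>"
proof
  assume "connected_above h (Ball_inf L) (Sphere_inf (2 * L)) \<phi>"
  then obtain p where p: "p \<noteq> []" "set p \<subseteq> excursion_set h \<phi>" "successively adjacent p" "hd p \<in> Ball_inf L" "last p \<in> Sphere_inf (2 * L)"
    unfolding connected_above_def by blast
  then obtain A where A: "A \<in> crossings 0 L" "A \<subseteq> set p"
    using path_contains_crossing[OF p(1,3) assms, of 0] by (auto simp: Ball_inf_eq Sphere_inf_eq)
  have "\<forall>x\<in>A. h \<le> \<phi> x" using A(2) p(2) by (auto simp: excursion_set_def)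
  then show "above (crossings 0 L) h \<phi>" using A(1) unfolding above_def by blast
next
  assume "above (crossings 0 L) h \<phi>"
  then obtain A where "A \<in> crossings 0 L" "\<forall>x\<in>A. h \<le> \<phi> x" unfolding above_def by blast
  then obtain p where p: "p \<noteq> []" "successively adjacent p" "hd p \<in> sup_box 0 L" "sup_norm (last p - 0) = 2 * int L" "\<forall>x\<in>set p. h \<le> \<phi> x"
    unfolding crossings_def by auto
  show "connected_above h (Ball_inf L) (Sphere_inf (2 * L)) \<phi>"
    unfolding connected_above_def
    by (intro exI[of _ p]) (use p in \<open>auto simp: Ball_inf_eq Sphere_inf_eq sup_box_def excursion_set_def\<close>)
qed

lemma crossings_translate: "crossings c L = (\<lambda>A. (\<lambda>x. x + c) ` A) ` crossings 0 L"
proof -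
  have sub: "(\<lambda>x. x + b) ` A \<in> crossings (a + b) L" if "A \<in> crossings a L" for a b :: "int ^ 'a" and A
  proof -
    from that obtain p where p: "A = set p" "p \<noteq> []" "successively adjacent p" "set p \<subseteq> sup_box a (2 * L)"
      "hd p \<in> sup_box a L" "sup_norm (last p - a) = 2 * int L"
      unfolding crossings_def by blast
    show ?thesis unfolding crossings_def
    proof (intro CollectI exI[of _ "map (\<lambda>x. x + b) p"] conjI)
      show "successively adjacent (map (\<lambda>x. x + b) p)"
        using p(3) by (simp add: successively_map adjacent_translate)
      show "sup_norm (last (map (\<lambda>x. x + b) p) - (a + b)) = 2 * int L"
        using p(2,6) by (simp add: last_map)
      show "hd (map (\<lambda>x. x + b) p) \<in> sup_box (a + b) L"
        using p(2,5) by (simp add: hd_map sup_box_def)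
    qed (use p in \<open>auto simp: sup_box_def\<close>)
  qed
  show ?thesis
  proof (intro set_eqI iffI)
    fix A assume "A \<in> crossings c L"
    from sub[OF this, of "- c"] show "A \<in> (\<lambda>A. (\<lambda>x. x + c) ` A) ` crossings 0 L"
      by (intro image_eqI[of _ _ "(\<lambda>x. x + - c) ` A"]) (auto simp: image_image)
  next
    fix A assume "A \<in> (\<lambda>A. (\<lambda>x. x + c) ` A) ` crossings 0 L"
    then show "A \<in> crossings c L" using sub[of _ 0 c] by auto
  qed
qed

lemma above_crossings_translate: "above (crossings c L) h \<phi> \<longleftrightarrow> above (crossings 0 L) h (\<lambda>x. \<phi> (x + c))"
  unfolding crossings_translate[of c] above_def by auto

text \<open>Centres of boxes of radius \<open>L\<close> that cover the box of radius \<open>m * L\<close>.\<close>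

definition grid :: "nat \<Rightarrow> nat \<Rightarrow> (int ^ 'd::finite) set" where
  "grid L m = (\<lambda>k. \<chi> i. int L * k $ i) ` {k. sup_norm k \<le> int m}"

lemma finite_grid: "finite (grid L m)"
  unfolding grid_def by (intro finite_imageI finite_sup_norm_ball)

lemma card_grid_le: "card (grid L m :: (int ^ 'd::finite) set) \<le> (2 * m + 1) ^ CARD('d)"
  unfolding grid_def by (rule order_trans[OF card_image_le[OF finite_sup_norm_ball]]) (simp add: card_sup_norm_ball)

lemma grid_point_near:
  fixes y :: "int ^ 'd::finite"
  assumes L: "1 \<le> L" and y: "sup_norm y \<le> int m * int L"
  obtains c where "c \<in> grid L m" "sup_norm (y - c) \<le> int L"
proof -
  define k where "k = (\<chi> i. y $ i div int L)"
  have "\<bar>k $ i\<bar> \<le> int m" for i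
  proof -
    have "\<bar>y $ i\<bar> \<le> int m * int L" using y component_le_sup_norm[of y i] by linarith
    then have "- int m * int L \<le> y $ i" "y $ i \<le> int m * int L" by auto
    moreover have "0 < int L" using L by simp
    ultimately have "(- int m * int L) div int L \<le> y $ i div int L" "y $ i div int L \<le> (int m * int L) div int L"
      by (blast intro: zdiv_mono1)+
    moreover have "(- int m * int L) div int L = - int m" "(int m * int L) div int L = int m"
      using L by (intro nonzero_mult_div_cancel_right; simp)+
    ultimately have "- int m \<le> y $ i div int L" "y $ i div int L \<le> int m" by simp_all
    then show ?thesis unfolding k_def vec_lambda_beta by linarith
  qed
  then have k: "sup_norm k \<le> int m" by (simp add: sup_norm_le_iff)
  let ?c = "\<chi> i. int L * k $ i"
  have "\<bar>(y - ?c) $ i\<bar> \<le> int L" for i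
  proof -
    have "(y - ?c) $ i = y $ i mod int L" by (simp add: k_def minus_mult_div_eq_mod)
    moreover have "0 \<le> y $ i mod int L" "y $ i mod int L < int L" using L by auto
    ultimately show ?thesis by linarith
  qed
  then have "sup_norm (y - ?c) \<le> int L" by (simp only: sup_norm_le_iff) blast
  then show thesis using that k unfolding grid_def by blast
qed

lemma path_contains_grid_crossing:
  fixes p :: "(int ^ 'd::finite) list"
  assumes p: "p \<noteq> []" "successively adjacent p" and L: "1 \<le> L"
    and hd: "sup_norm (hd p) \<le> int m * int L" and far: "3 * int L \<le> sup_norm (last p - hd p)"
  obtains c A where "c \<in> grid L m" "sup_norm (hd p - c) \<le> int L" "A \<in> crossings c L" "A \<subseteq> set p"
proof -
  obtain c where c: "c \<in> grid L m" "sup_norm (hd p - c) \<le> int L"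
    using grid_point_near[OF L hd] by blast
  have "sup_norm (last p - hd p) \<le> sup_norm (last p - c) + sup_norm (c - hd p)"
    by (rule sup_norm_triangle_diff)
  then have "2 * int L \<le> sup_norm (last p - c)"
    using far c(2) sup_norm_minus_commute[of c "hd p"] by linarith
  then obtain A where "A \<in> crossings c L" "A \<subseteq> set p"
    using path_contains_crossing[OF p L c(2)] by blast
  then show thesis using that c by blast
qed

lemma above_subset: "A \<in> S \<Longrightarrow> A \<subseteq> B \<Longrightarrow> \<forall>x\<in>B. h \<le> \<phi> x \<Longrightarrow> above S h \<phi>"
  unfolding above_def by blast

lemma crossing_path:
  assumes "above (crossings 0 L) h \<phi>"
  obtains p where "p \<noteq> []" "successively adjacent p" "sup_norm (hd p) \<le> int L" "sup_norm (last p) = 2 * int L"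
    "\<forall>x\<in>set p. h \<le> \<phi> x" "int L \<le> sup_norm (last p - hd p)"
proof -
  from assms obtain A where "A \<in> crossings 0 L" "\<forall>x\<in>A. h \<le> \<phi> x" unfolding above_def by blast
  then obtain p where p: "p \<noteq> []" "successively adjacent p" "hd p \<in> sup_box 0 L" "sup_norm (last p - 0) = 2 * int L" "\<forall>x\<in>set p. h \<le> \<phi> x"
    unfolding crossings_def by auto
  have "sup_norm (last p) \<le> sup_norm (last p - hd p) + sup_norm (hd p)"
    using sup_norm_triangle[of "last p - hd p" "hd p"] by simp
  then have "int L \<le> sup_norm (last p - hd p)" using p(3,4) by (simp add: sup_box_def)
  then show thesis using that p by (simp add: sup_box_def)
qed

lemma crossing_contains_crossing:
  fixes \<phi> :: "int ^ 'd::finite \<Rightarrow> real"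
  assumes L: "1 \<le> L" and L': "3 * L \<le> L'" "L' \<le> m * L" and ab: "above (crossings 0 L') h \<phi>"
  shows "\<exists>c\<in>grid L m. above (crossings c L) h \<phi>"
proof -
  obtain p where p: "p \<noteq> []" "successively adjacent p" "sup_norm (hd p) \<le> int L'" "sup_norm (last p) = 2 * int L'"
    "\<forall>x\<in>set p. h \<le> \<phi> x" "int L' \<le> sup_norm (last p - hd p)"
    using crossing_path[OF ab] by blast
  have "int L' \<le> int m * int L" "3 * int L \<le> int L'" using L' by (simp_all flip: of_nat_mult)
  then have "sup_norm (hd p) \<le> int m * int L" "3 * int L \<le> sup_norm (last p - hd p)" using p by linarith+
  from path_contains_grid_crossing[OF p(1,2) L this]
  obtain c A where "c \<in> grid L m" "A \<in> crossings c L" "A \<subseteq> set p" by blast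
  then show ?thesis using above_subset[of A] p(5) by blast
qed

text \<open>The two small boxes are placed at the two ends of the large crossing; the second crossing is found by
running through the path backwards.\<close>

lemma crossing_contains_two_crossings:
  fixes \<phi> :: "int ^ 'd::finite \<Rightarrow> real"
  assumes L: "1 \<le> L" and m: "3 \<le> m" and ab: "above (crossings 0 (m * L)) h \<phi>"
  shows "\<exists>c\<in>grid L (2 * m). \<exists>c'\<in>grid L (2 * m). (int m - 2) * int L \<le> sup_norm (c - c') \<and>
    above (crossings c L) h \<phi> \<and> above (crossings c' L) h \<phi>"
proof -
  obtain p where p: "p \<noteq> []" "successively adjacent p" "sup_norm (hd p) \<le> int (m * L)" "sup_norm (last p) = 2 * int (m * L)"
    "\<forall>x\<in>set p. h \<le> \<phi> x" "int (m * L) \<le> sup_norm (last p - hd p)"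
    using crossing_path[OF ab] by blast
  have far: "3 * int L \<le> sup_norm (last p - hd p)"
    using p(6) mult_right_mono[of 3 "int m" "int L"] m by simp
  have "int (2 * m) * int L = 2 * int (m * L)" by simp
  then have h: "sup_norm (hd p) \<le> int (2 * m) * int L" using p(3) by linarith
  obtain c A where c: "c \<in> grid L (2 * m)" "sup_norm (hd p - c) \<le> int L" "A \<in> crossings c L" "A \<subseteq> set p"
    using path_contains_grid_crossing[OF p(1,2) L h far] by blast
  have r: "rev p \<noteq> []" "successively adjacent (rev p)" "hd (rev p) = last p" "last (rev p) = hd p" "set (rev p) = set p"
  proof -
    show "successively adjacent (rev p)"
    proof -
      have "successively (\<lambda>x y. adjacent y x) p = successively adjacent p"
        by (rule successively_cong[OF adjacent_sym refl])
      then show ?thesis using p(2) by (simp only: successively_rev)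
    qed
  qed (use p(1) in \<open>auto simp: hd_rev last_rev\<close>)
  have l: "sup_norm (last p) \<le> int (2 * m) * int L" using p(4) by simp
  have far': "3 * int L \<le> sup_norm (hd p - last p)" using far sup_norm_minus_commute[of "hd p"] by simp
  obtain c' A' where c': "c' \<in> grid L (2 * m)" "sup_norm (last p - c') \<le> int L" "A' \<in> crossings c' L" "A' \<subseteq> set p"
    using path_contains_grid_crossing[OF r(1,2) L, of "2 * m"] l far' unfolding r(3,4,5) by blast
  have "sup_norm (last p - hd p) \<le> sup_norm (last p - c') + sup_norm (c' - hd p)" by (rule sup_norm_triangle_diff)
  also have "sup_norm (c' - hd p) \<le> sup_norm (c' - c) + sup_norm (c - hd p)" by (rule sup_norm_triangle_diff)
  finally have "int (m * L) \<le> sup_norm (c' - c) + 2 * int L"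
    using c(2) c'(2) p(6) sup_norm_minus_commute[of c "hd p"] by linarith
  then have "(int m - 2) * int L \<le> sup_norm (c - c')"
    using sup_norm_minus_commute[of c c'] by (simp add: algebra_simps)
  moreover have "above (crossings c L) h \<phi>" by (rule above_subset[OF c(3,4) p(5)])
  moreover have "above (crossings c' L) h \<phi>" by (rule above_subset[OF c'(3,4) p(5)])
  ultimately show ?thesis using c(1) c'(1) by blast
qed

lemma sup_box_separation:
  assumes "x \<in> sup_box c r" "y \<in> sup_box c' r" "s + 2 * int r \<le> sup_norm (c - c')"
  shows "s \<le> sup_norm (y - x)"
proof -
  have "sup_norm (c - c') \<le> sup_norm (c - x) + sup_norm (x - c')" by (rule sup_norm_triangle_diff)
  also have "sup_norm (x - c') \<le> sup_norm (x - y) + sup_norm (y - c')" by (rule sup_norm_triangle_diff)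
  finally show ?thesis
    using assms sup_norm_minus_commute[of c x] sup_norm_minus_commute[of x y] by (simp add: sup_box_def)
qed

section \<open>The recursion between scales\<close>

definition crossing_prob :: "(int ^ 'd::finite \<Rightarrow> real) measure \<Rightarrow> nat \<Rightarrow> real \<Rightarrow> real" where
  "crossing_prob P L h = \<P>(\<phi> in P. above (crossings 0 L) h \<phi>)"

lemma gff_above_sets:
  assumes "gff_law P"
  shows "{\<phi> \<in> space P. above (crossings c L) h \<phi>} \<in> sets P"
  by (rule above_measurable[OF finite_sup_box crossings_subset gff_measurable[OF assms]])

lemma crossing_prob_le_1:
  assumes P: "gff_law P"
  shows "crossing_prob P L h \<le> 1"
  unfolding crossing_prob_def using gff_prob_space[OF P] by (rule prob_space.prob_le_1)

lemma crossing_prob_nonneg: "0 \<le> crossing_prob P L h"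
  unfolding crossing_prob_def by (rule measure_nonneg)

lemma crossing_prob_antimono:
  assumes P: "gff_law P" and h: "h \<le> h'"
  shows "crossing_prob P L h' \<le> crossing_prob P L h"
  unfolding crossing_prob_def
proof (rule finite_measure.finite_measure_mono[OF prob_space.finite_measure[OF gff_prob_space[OF P]] _ gff_above_sets[OF P]])
  show "{\<phi> \<in> space P. above (crossings 0 L) h' \<phi>} \<subseteq> {\<phi> \<in> space P. above (crossings 0 L) h \<phi>}"
    using above_mono[of "crossings 0 L" h' _ h] h by fastforce
qed

text \<open>The Green function is translation invariant, and the covariance determines the law.\<close>

lemma crossing_prob_translate:
  fixes P :: "(int ^ 'd::finite \<Rightarrow> real) measure"
  assumes P: "gff_law P"
  shows "\<P>(\<phi> in P. above (crossings c L) h \<phi>) = crossing_prob P L h"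
proof -
  let ?V = "sup_box (0 :: int ^ 'd) (2 * L)"
  have "gaussian_vector P (\<lambda>\<phi>. \<phi>) ((\<lambda>x. x + c) ` ?V) green"
    by (intro gff_gaussian_vector[OF P] finite_imageI finite_sup_box)
  then have "gaussian_vector P (\<lambda>\<phi> x. \<phi> (x + c)) ?V (\<lambda>x y. green (x + c) (y + c))"
    by (rule gaussian_vector_reindex) (simp add: inj_on_def)
  then have g: "gaussian_vector P (\<lambda>\<phi> x. \<phi> (x + c)) ?V green"
    unfolding green_translate .
  show ?thesis
    unfolding crossing_prob_def above_crossings_translate[of c]
    by (rule prob_above_cong[OF finite_sup_box g gff_gaussian_vector[OF P finite_sup_box] crossings_subset])
qed

text \<open>The error of \<open>sprinkled_decoupling\<close> for two boxes of radius \<open>2 * L\<close>, when the variances of the discarded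
field are at most \<open>4 * d\<^sup>2 / sqrt L\<close>.\<close>

definition decoupling_error :: "nat \<Rightarrow> nat \<Rightarrow> real \<Rightarrow> real" where
  "decoupling_error d L \<epsilon> = 4 * (4 * real L + 1) ^ d * exp (- \<epsilon>\<^sup>2 * sqrt (real L) / (8 * (real d)\<^sup>2))"

lemma decoupling_error_nonneg: "0 \<le> decoupling_error d L \<epsilon>"
  by (simp add: decoupling_error_def)

lemma two_crossings_prob_le:
  fixes P :: "(int ^ 'd::finite \<Rightarrow> real) measure"
  assumes d: "3 \<le> CARD('d)" and P: "gff_law P" and L: "1 \<le> L" and e: "0 < \<epsilon>"
    and far: "6 * int L \<le> sup_norm (c - c')"
  shows "\<P>(\<phi> in P. above (crossings c L) h \<phi> \<and> above (crossings c' L) h \<phi>) \<le>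
    (crossing_prob P L (h - 2 * \<epsilon>) + decoupling_error CARD('d) L \<epsilon>)\<^sup>2 + decoupling_error CARD('d) L \<epsilon>"
proof -
  let ?V = "sup_box c (2 * L)" and ?W = "sup_box c' (2 * L)"
  define \<kappa> where "\<kappa> = 4 * (real CARD('d))\<^sup>2 / sqrt (real L)"
  define err where "err = 2 * real (card (?V \<union> ?W)) * exp (- \<epsilon>\<^sup>2 / (2 * \<kappa>))"
  define err' where "err' = decoupling_error CARD('d) L \<epsilon>"
  have k: "0 < \<kappa>" using L by (simp add: \<kappa>_def)
  have sep: "2 * int L \<le> sup_norm (y - x)" if "x \<in> ?V" "y \<in> ?W" for x y
    by (rule sup_box_separation[OF that]) (use far in simp)
  have disj: "?V \<inter> ?W = {}"
  proof (rule ccontr)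
    assume "?V \<inter> ?W \<noteq> {}"
    then obtain x where "x \<in> ?V" "x \<in> ?W" by blast
    then show False using sep[of x x] L by simp
  qed
  have fin: "finite (?V \<union> ?W)" by (simp add: finite_sup_box)
  have cov: "gaussian_vector P (\<lambda>\<phi>. \<phi>) (?V \<union> ?W) (\<lambda>x y. near_cov L x y + far_cov L x y)"
    by (rule gaussian_vector_cov_cong[OF gff_gaussian_vector[OF P fin] green_split[OF d]])
  have dec: "\<P>(\<phi> in P. above (crossings c L) h \<phi> \<and> above (crossings c' L) h \<phi>) \<le>
    (\<P>(\<phi> in P. above (crossings c L) (h - 2 * \<epsilon>) \<phi>) + err) * (\<P>(\<phi> in P. above (crossings c' L) (h - 2 * \<epsilon>) \<phi>) + err) + err"
    unfolding err_def
    by (rule sprinkled_decoupling[OF finite_sup_box finite_sup_box disj psd_near_cov[OF fin] psd_far_cov[OF d fin] _ _ k e cov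
          crossings_subset crossings_subset])
      (use sep near_cov_eq_0[of L] far_cov_diag_le[OF d L] in \<open>auto simp: \<kappa>_def\<close>)
  have "err \<le> err'"
  proof -
    have "card (?V \<union> ?W) \<le> card ?V + card ?W" by (rule card_Un_le)
    also have "\<dots> = 2 * (4 * L + 1) ^ CARD('d)" by (simp add: card_sup_box)
    finally have "real (card (?V \<union> ?W)) \<le> real (2 * (4 * L + 1) ^ CARD('d))" by (simp only: of_nat_le_iff)
    then have "2 * real (card (?V \<union> ?W)) \<le> 4 * (4 * real L + 1) ^ CARD('d)" by (simp add: add.commute)
    moreover have "- \<epsilon>\<^sup>2 / (2 * \<kappa>) = - \<epsilon>\<^sup>2 * sqrt (real L) / (8 * (real CARD('d))\<^sup>2)"
      by (simp add: \<kappa>_def)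
    ultimately show ?thesis unfolding err_def err'_def decoupling_error_def by (simp add: mult_right_mono)
  qed
  moreover have "0 \<le> err" by (simp add: err_def)
  ultimately show ?thesis
    using dec unfolding crossing_prob_translate[OF P] err'_def[symmetric]
    by (elim order_trans) (auto simp: power2_eq_square intro!: add_mono mult_mono crossing_prob_nonneg add_nonneg_nonneg)
qed

text \<open>A bound for the number of pairs of points in \<open>grid L 128\<close>, as \<open>257 = 2 * 128 + 1\<close>.\<close>

definition pair_count :: "nat \<Rightarrow> real" where
  "pair_count d = (257 ^ d)\<^sup>2"

lemma pair_count_ge_1: "1 \<le> pair_count d"
  by (simp add: pair_count_def)

text \<open>A union bound over the pairs of small boxes.  If the error exceeds 1 there is nothing to prove; else
its square can be absorbed.\<close>

lemma crossing_prob_recursion: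
  fixes P :: "(int ^ 'd::finite \<Rightarrow> real) measure"
  assumes d: "3 \<le> CARD('d)" and P: "gff_law P" and L: "1 \<le> L" and e: "0 < \<epsilon>"
  shows "crossing_prob P (64 * L) h \<le>
    pair_count CARD('d) * (2 * (crossing_prob P L (h - 2 * \<epsilon>))\<^sup>2 + 3 * decoupling_error CARD('d) L \<epsilon>)"
proof -
  define K where "K = pair_count CARD('d)"
  define p where "p = crossing_prob P L (h - 2 * \<epsilon>)"
  define r where "r = decoupling_error CARD('d) L \<epsilon>"
  have K: "1 \<le> K" unfolding K_def by (rule pair_count_ge_1)
  have r0: "0 \<le> r" unfolding r_def by (rule decoupling_error_nonneg)
  have p0: "0 \<le> p" unfolding p_def by (rule crossing_prob_nonneg)
  interpret prob_space P by (rule gff_prob_space[OF P])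
  have "crossing_prob P (64 * L) h \<le> K * (2 * p\<^sup>2 + 3 * r)"
  proof (cases "r \<le> 1")
    case True
    let ?G = "grid L (2 * 64) :: (int ^ 'd) set"
    define I where "I = {(c, c') \<in> ?G \<times> ?G. (int 64 - 2) * int L \<le> sup_norm (c - c')}"
    let ?E = "\<lambda>(c, c'). {\<phi> \<in> space P. above (crossings c L) h \<phi> \<and> above (crossings c' L) h \<phi>}"
    have finI: "finite I" unfolding I_def by (rule finite_subset[of _ "?G \<times> ?G"]) (auto simp: finite_grid)
    have "card I \<le> card (?G \<times> ?G)" unfolding I_def by (rule card_mono) (auto simp: finite_grid)
    also have "\<dots> \<le> 257 ^ CARD('d) * 257 ^ CARD('d)"
      unfolding card_cartesian_product using card_grid_le[of L "2 * 64", where 'd='d] by (intro mult_mono) auto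
    finally have "real (card I) \<le> real (257 ^ CARD('d) * 257 ^ CARD('d))" by (simp only: of_nat_le_iff)
    then have cI: "real (card I) \<le> K" by (simp add: K_def pair_count_def power2_eq_square)
    have sE: "?E i \<in> sets P" for i
      using gff_above_sets[OF P] by (cases i) (auto intro: sets.sets_Collect_conj)
    have "crossing_prob P (64 * L) h \<le> measure P (\<Union>i\<in>I. ?E i)"
      unfolding crossing_prob_def
    proof (rule finite_measure_mono)
      show "{\<phi> \<in> space P. above (crossings 0 (64 * L)) h \<phi>} \<subseteq> (\<Union>i\<in>I. ?E i)"
      proof
        fix \<phi> assume "\<phi> \<in> {\<phi> \<in> space P. above (crossings 0 (64 * L)) h \<phi>}"
        then have sp: "\<phi> \<in> space P" and ab: "above (crossings 0 (64 * L)) h \<phi>" by auto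
        from crossing_contains_two_crossings[OF L _ ab] obtain c c' where
          "c \<in> ?G" "c' \<in> ?G" "(int 64 - 2) * int L \<le> sup_norm (c - c')"
          "above (crossings c L) h \<phi>" "above (crossings c' L) h \<phi>"
          by auto
        then show "\<phi> \<in> (\<Union>i\<in>I. ?E i)" using sp by (intro UN_I[of "(c, c')"]) (auto simp: I_def)
      qed
    qed (intro sets.finite_UN finI sE)
    also have "\<dots> \<le> (\<Sum>i\<in>I. measure P (?E i))"
      by (intro finite_measure_subadditive_finite finI) (use sE in auto)
    also have "\<dots> \<le> (\<Sum>i\<in>I. (p + r)\<^sup>2 + r)"
    proof (rule sum_mono)
      fix i assume i: "i \<in> I"
      obtain c c' where ic: "i = (c, c')" by (cases i)
      have "6 * int L \<le> (int 64 - 2) * int L" using L by simp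
      also have "\<dots> \<le> sup_norm (c - c')" using i ic by (simp add: I_def)
      finally show "measure P (?E i) \<le> (p + r)\<^sup>2 + r"
        unfolding ic p_def r_def prod.case by (rule two_crossings_prob_le[OF d P L e])
    qed
    also have "\<dots> = real (card I) * ((p + r)\<^sup>2 + r)" by simp
    also have "\<dots> \<le> K * ((p + r)\<^sup>2 + r)" by (intro mult_right_mono cI) (simp add: r0)
    also have "\<dots> \<le> K * (2 * p\<^sup>2 + 3 * r)"
    proof (rule mult_left_mono)
      have "0 \<le> (p - r)\<^sup>2" by simp
      moreover have "r\<^sup>2 \<le> r" using True r0 by (simp add: power2_eq_square mult_left_le)
      ultimately show "(p + r)\<^sup>2 + r \<le> 2 * p\<^sup>2 + 3 * r" by (simp add: power2_sum power2_diff)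
    qed (use K in simp)
    finally show ?thesis .
  next
    case False
    have "1 \<le> 2 * p\<^sup>2 + 3 * r" using False zero_le_power2[of p] by linarith
    then have "1 * 1 \<le> K * (2 * p\<^sup>2 + 3 * r)" using K by (intro mult_mono) auto
    then show ?thesis using crossing_prob_le_1[OF P, of "64 * L" h] by linarith
  qed
  then show ?thesis by (simp only: K_def p_def r_def)
qed

lemma crossing_prob_le_smaller_scale:
  fixes P :: "(int ^ 'd::finite \<Rightarrow> real) measure"
  assumes P: "gff_law P" and L: "1 \<le> L" "3 * L \<le> L'" "L' \<le> m * L"
  shows "crossing_prob P L' h \<le> real ((2 * m + 1) ^ CARD('d)) * crossing_prob P L h"
proof -
  interpret prob_space P by (rule gff_prob_space[OF P])
  let ?G = "grid L m :: (int ^ 'd) set"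
  have "crossing_prob P L' h \<le> measure P (\<Union>c\<in>?G. {\<phi> \<in> space P. above (crossings c L) h \<phi>})"
    unfolding crossing_prob_def
    by (rule finite_measure_mono) (use crossing_contains_crossing[OF L] in \<open>auto intro!: sets.finite_UN finite_grid gff_above_sets[OF P]\<close>)
  also have "\<dots> \<le> (\<Sum>c\<in>?G. \<P>(\<phi> in P. above (crossings c L) h \<phi>))"
    by (intro finite_measure_subadditive_finite finite_grid) (auto intro: gff_above_sets[OF P])
  also have "\<dots> = real (card ?G) * crossing_prob P L h"
    by (simp add: crossing_prob_translate[OF P])
  also have "\<dots> \<le> real ((2 * m + 1) ^ CARD('d)) * crossing_prob P L h"
    using card_grid_le[of L m, where 'd='d] by (intro mult_right_mono crossing_prob_nonneg) (simp only: of_nat_le_iff)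
  finally show ?thesis .
qed

section \<open>Iterating over the scales\<close>

text \<open>At scale \<open>L * 64 ^ n\<close> the square root in the exponent contributes \<open>8 ^ n\<close>, while the squared sprinkling
parameter contributes \<open>(1 / 4) ^ n\<close>.  The exponent therefore grows like \<open>sqrt L * 2 ^ n\<close>, which for
large \<open>L\<close> beats both \<open>2 ^ Suc n\<close> and the logarithm of the volume.  This is what determines
the factor 64 between scales.\<close>

lemma eventually_decoupling_error_small:
  assumes \<delta>: "0 < \<delta>" and d: "1 \<le> d" and K: "1 \<le> K"
  shows "\<forall>\<^sub>F L in sequentially. \<forall>n. 24 * K\<^sup>2 * decoupling_error d (L * 64 ^ n) (\<delta> / 4 * (1 / 2) ^ n) \<le> exp (- (2 ^ Suc n))"
proof -
  define D where "D = real d"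
  define a where "a = \<delta>\<^sup>2 / (128 * D\<^sup>2)"
  define C where "C = ln (96 * K\<^sup>2) + D * ln 5 + D * ln 64 + 2"
  have D: "0 < D" using d by (simp add: D_def)
  have a: "0 < a" using \<delta> D by (simp add: a_def)
  have "\<forall>\<^sub>F L in sequentially. C + D * ln (real L) \<le> a * sqrt (real L)" using a by real_asymp
  then show ?thesis using eventually_ge_at_top[of 1]
  proof eventually_elim
    case (elim L)
    show ?case
    proof
      fix n
      define s where "s = sqrt (real L)"
      have n2: "real n \<le> 2 ^ n" by (simp add: less_imp_le)
      have one: "(1::real) \<le> 2 ^ n" by simp
      have L0: "0 < real L" using elim by simp
      have lnL: "0 \<le> ln (real L)" using elim by simp
      have poly: "(4 * real (L * 64 ^ n) + 1) ^ d \<le> exp (D * ln 5 + D * ln (real L) + real n * (D * ln 64))"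
      proof -
        have "1 \<le> real L * 64 ^ n" using mult_mono[of 1 "real L" 1 "64 ^ n"] elim by simp
        then have "4 * real (L * 64 ^ n) + 1 \<le> 5 * real L * 64 ^ n" by simp
        then have "(4 * real (L * 64 ^ n) + 1) ^ d \<le> (5 * real L * 64 ^ n) ^ d" by (intro power_mono) auto
        also have "5 * real L * 64 ^ n = exp (ln 5 + ln (real L) + real n * ln 64)"
          using L0 by (simp add: exp_add exp_of_nat_mult)
        also have "(exp (ln 5 + ln (real L) + real n * ln 64)) ^ d = exp (D * (ln 5 + ln (real L) + real n * ln 64))"
          unfolding D_def by (rule exp_of_nat_mult[symmetric])
        finally show ?thesis by (simp add: algebra_simps)
      qed
      have "sqrt (real (L * 64 ^ n)) = s * 8 ^ n"
      proof -
        have "(64::real) ^ n = (8 ^ n)\<^sup>2" by (simp add: power2_eq_square flip: power_mult_distrib)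
        then show ?thesis by (simp add: s_def real_sqrt_mult)
      qed
      moreover have "(\<delta> / 4 * (1 / 2) ^ n)\<^sup>2 * 8 ^ n = \<delta>\<^sup>2 / 16 * 2 ^ n"
      proof -
        have "((1 / 2 :: real) ^ n)\<^sup>2 * 8 ^ n = (((1 / 2)\<^sup>2) * 8) ^ n"
          by (simp only: power_mult_distrib power_mult[symmetric] mult.commute)
        also have "\<dots> = 2 ^ n" by (simp add: power2_eq_square)
        finally have "(\<delta> / 4 * (1 / 2) ^ n)\<^sup>2 * 8 ^ n = (\<delta> / 4)\<^sup>2 * 2 ^ n"
          by (simp only: power_mult_distrib mult.assoc)
        then show ?thesis by (simp add: power_divide)
      qed
      ultimately have "(\<delta> / 4 * (1 / 2) ^ n)\<^sup>2 * sqrt (real (L * 64 ^ n)) = \<delta>\<^sup>2 / 16 * 2 ^ n * s"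
        by (metis mult.assoc mult.commute)
      then have "- (\<delta> / 4 * (1 / 2) ^ n)\<^sup>2 * sqrt (real (L * 64 ^ n)) = - (\<delta>\<^sup>2 / 16 * 2 ^ n * s)"
        by (simp only: mult_minus_left)
      then have ex: "- (\<delta> / 4 * (1 / 2) ^ n)\<^sup>2 * sqrt (real (L * 64 ^ n)) / (8 * D\<^sup>2) = - (a * s * 2 ^ n)"
        by (simp only:) (simp add: a_def)
      have "24 * K\<^sup>2 * decoupling_error d (L * 64 ^ n) (\<delta> / 4 * (1 / 2) ^ n)
          = 96 * K\<^sup>2 * (4 * real (L * 64 ^ n) + 1) ^ d * exp (- (a * s * 2 ^ n))"
        unfolding decoupling_error_def D_def[symmetric] ex by simp
      also have "\<dots> \<le> 96 * K\<^sup>2 * exp (D * ln 5 + D * ln (real L) + real n * (D * ln 64)) * exp (- (a * s * 2 ^ n))"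
        by (intro mult_right_mono mult_left_mono poly) auto
      also have "96 * K\<^sup>2 = exp (ln (96 * K\<^sup>2))" using K by simp
      also have "exp (ln (96 * K\<^sup>2)) * exp (D * ln 5 + D * ln (real L) + real n * (D * ln 64)) * exp (- (a * s * 2 ^ n))
        = exp ((ln (96 * K\<^sup>2) + D * ln 5 + D * ln (real L)) + real n * (D * ln 64) - a * s * 2 ^ n)"
        by (simp add: exp_add exp_diff exp_minus field_simps)
      also have "\<dots> \<le> exp (- (2 ^ Suc n))"
      proof -
        have K0: "0 \<le> ln (96 * K\<^sup>2)" using K one_le_power[of K 2] by (intro ln_ge_zero) linarith
        have "(ln (96 * K\<^sup>2) + D * ln 5 + D * ln (real L)) * 1 \<le> (ln (96 * K\<^sup>2) + D * ln 5 + D * ln (real L)) * 2 ^ n"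
          using K0 D lnL by (intro mult_left_mono one add_nonneg_nonneg mult_nonneg_nonneg) auto
        moreover have "real n * (D * ln 64) \<le> 2 ^ n * (D * ln 64)" using D by (intro mult_right_mono n2) auto
        ultimately have "(ln (96 * K\<^sup>2) + D * ln 5 + D * ln (real L)) + real n * (D * ln 64) + 2 * 2 ^ n
            \<le> (C + D * ln (real L)) * 2 ^ n"
          by (simp add: C_def algebra_simps)
        also have "\<dots> \<le> (a * s) * 2 ^ n" using elim(1) by (intro mult_right_mono) (auto simp: s_def)
        finally show ?thesis by simp
      qed
      finally show "24 * K\<^sup>2 * decoupling_error d (L * 64 ^ n) (\<delta> / 4 * (1 / 2) ^ n) \<le> exp (- (2 ^ Suc n))" .
    qed
  qed
qed

text \<open>With \<open>q n = 2 * K * p n\<close> the recursion reads \<open>q (Suc n) \<le> (q n)\<^sup>2 + 6 * K\<^sup>2 * error\<close>, and the bound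
\<open>q n \<le> exp (- (2 ^ n)) / 2\<close> reproduces itself: the factor \<open>1/2\<close> leaves half of the target for the error.\<close>

lemma crossing_prob_scales:
  fixes P :: "(int ^ 'd::finite \<Rightarrow> real) measure"
  assumes d: "3 \<le> CARD('d)" and P: "gff_law P" and L: "1 \<le> L" and \<delta>: "0 < \<delta>"
    and err: "\<And>n. 24 * (pair_count CARD('d))\<^sup>2 * decoupling_error CARD('d) (L * 64 ^ n) (\<delta> / 4 * (1 / 2) ^ n) \<le> exp (- (2 ^ Suc n))"
    and init: "4 * pair_count CARD('d) * crossing_prob P L h \<le> exp (- 1)"
  shows "crossing_prob P (L * 64 ^ n) (h + \<delta>) \<le> exp (- (2 ^ n))"
proof -
  define K where "K = pair_count CARD('d)"
  have K: "1 \<le> K" unfolding K_def by (rule pair_count_ge_1)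
  \<comment> \<open>the level rises by \<open>\<delta> / 2 * (1 / 2) ^ n\<close> in step \<open>n\<close>, that is by twice the \<open>\<epsilon>\<close> used there\<close>
  define lev where "lev n = h + \<delta> * (1 - (1 / 2) ^ n)" for n :: nat
  have claim: "2 * K * crossing_prob P (L * 64 ^ n) (lev n) \<le> exp (- (2 ^ n)) / 2" for n
  proof (induction n)
    case 0
    then show ?case using init by (simp add: lev_def K_def)
  next
    case (Suc n)
    define \<epsilon> where "\<epsilon> = \<delta> / 4 * (1 / 2) ^ n"
    define p where "p = crossing_prob P (L * 64 ^ n) (lev n)"
    define r where "r = decoupling_error CARD('d) (L * 64 ^ n) \<epsilon>"
    have e: "0 < \<epsilon>" using \<delta> by (simp add: \<epsilon>_def)
    have lev: "lev (Suc n) - 2 * \<epsilon> = lev n" by (simp add: lev_def \<epsilon>_def field_simps)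
    have Ln: "1 \<le> L * 64 ^ n" using L by simp
    have p0: "0 \<le> p" unfolding p_def by (rule crossing_prob_nonneg)
    have "crossing_prob P (64 * (L * 64 ^ n)) (lev (Suc n)) \<le> K * (2 * p\<^sup>2 + 3 * r)"
      using crossing_prob_recursion[OF d P Ln e, of "lev (Suc n)"] unfolding lev by (simp only: K_def p_def r_def)
    then have "2 * K * crossing_prob P (L * 64 ^ Suc n) (lev (Suc n)) \<le> 2 * K * (K * (2 * p\<^sup>2 + 3 * r))"
      using K by (intro mult_left_mono) (auto simp: mult_ac)
    also have "\<dots> = (2 * K * p)\<^sup>2 + 24 * K\<^sup>2 * r / 4" by (simp add: power2_eq_square algebra_simps)
    also have "(2 * K * p)\<^sup>2 \<le> (exp (- (2 ^ n)) / 2)\<^sup>2"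
      using Suc p0 K by (intro power_mono) (auto simp: p_def)
    also have "(exp (- (2 ^ n)) / 2 :: real)\<^sup>2 = exp (- (2 ^ Suc n)) / 4"
      by (simp add: power_divide exp_double[symmetric])
    also have "24 * K\<^sup>2 * r / 4 \<le> exp (- (2 ^ Suc n)) / 4"
      unfolding K_def r_def \<epsilon>_def by (rule divide_right_mono[OF err]) simp
    finally show ?case by simp
  qed
  have "lev n \<le> h + \<delta>" using \<delta> by (simp add: lev_def)
  then have "crossing_prob P (L * 64 ^ n) (h + \<delta>) \<le> crossing_prob P (L * 64 ^ n) (lev n)"
    by (rule crossing_prob_antimono[OF P])
  also have "\<dots> \<le> 2 * K * crossing_prob P (L * 64 ^ n) (lev n)"
    using K mult_right_mono[of 1 "2 * K" "crossing_prob P (L * 64 ^ n) (lev n)"] crossing_prob_nonneg[of P] by simp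
  also have "\<dots> \<le> exp (- (2 ^ n)) / 2" by (rule claim)
  also have "\<dots> \<le> exp (- (2 ^ n))" by simp
  finally show ?thesis .
qed

definition stretched_decay :: "(int ^ 'd::finite \<Rightarrow> real) measure \<Rightarrow> real \<Rightarrow> bool" where
  "stretched_decay P h \<longleftrightarrow> (\<exists>c c'. 0 < c \<and> 0 < c' \<and>
     (\<forall>L\<ge>1. crossing_prob P L h \<le> c * exp (- c' * real L powr (1 / 6))))"

text \<open>A scale beyond \<open>3 * L\<close> is compared with the largest \<open>L * 64 ^ n\<close> that is at most a third of it, at the
cost of a bounded number of boxes; and \<open>2 ^ n\<close> is the sixth root of \<open>64 ^ n\<close>.\<close>

lemma stretched_decay_interpolate:
  fixes P :: "(int ^ 'd::finite \<Rightarrow> real) measure"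
  assumes P: "gff_law P" and L: "1 \<le> L"
    and scales: "\<And>n. crossing_prob P (L * 64 ^ n) h \<le> exp (- (2 ^ n))"
  shows "stretched_decay P h"
proof -
  define c where "c = 385 ^ CARD('d) * exp (1::real)"
  define b where "b = (1 / (192 * real L)) powr (1 / 6)"
  have L0: "0 < real L" using L by simp
  have b0: "0 < b" using L by (simp add: b_def)
  have c0: "0 < c" by (simp add: c_def)
  have c1: "exp 1 \<le> c" unfolding c_def using mult_right_mono[of 1 "385 ^ CARD('d)" "exp 1 :: real"] by simp
  have bL: "b * real L' powr (1 / 6) = (real L' / (192 * real L)) powr (1 / 6)" for L'
    by (simp add: b_def powr_mult[symmetric])
  have "crossing_prob P L' h \<le> c * exp (- b * real L' powr (1 / 6))" if L': "1 \<le> L'" for L'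
  proof (cases "L' < 3 * L")
    case True
    then have "real L' \<le> 192 * real L" by linarith
    then have "real L' / (192 * real L) \<le> 1" using L0 by simp
    then have "(real L' / (192 * real L)) powr (1 / 6) \<le> 1"
      using powr_mono2[of "1 / 6" "real L' / (192 * real L)" 1] by simp
    then have "exp 1 * exp (- 1) \<le> c * exp (- b * real L' powr (1 / 6))"
      using c0 c1 by (intro mult_mono) (auto simp: bL)
    then show ?thesis using crossing_prob_le_1[OF P, of L' h] by (simp flip: exp_add)
  next
    case False
    \<comment> \<open>the power of 64 is taken from the quotient, so that \<open>3 * (L * 64 ^ n) \<le> L' < 192 * (L * 64 ^ n)\<close>\<close>
    define k where "k = L' div (3 * L)"
    have "1 \<le> k" using False L by (simp add: k_def Suc_le_eq div_greater_zero_iff)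
    then obtain n where n: "64 ^ n \<le> k" "k < 64 ^ (n + 1)" using ex_power_ivl1[of 64 k] by auto
    have lo: "3 * (L * 64 ^ n) \<le> L'"
    proof -
      have "3 * (L * 64 ^ n) = 64 ^ n * (3 * L)" by simp
      also have "\<dots> \<le> k * (3 * L)" using n(1) by (rule mult_right_mono) simp
      also have "\<dots> \<le> L'" unfolding k_def by (rule div_times_less_eq_dividend)
      finally show ?thesis .
    qed
    have hi: "L' \<le> 192 * (L * 64 ^ n)"
    proof -
      have "L' < (k + 1) * (3 * L)" unfolding k_def using L by (simp add: dividend_less_div_times)
      also have "\<dots> \<le> 64 ^ (n + 1) * (3 * L)" using n(2) by (intro mult_right_mono) auto
      finally show ?thesis by (simp add: mult_ac)
    qed
    have Ln: "1 \<le> L * 64 ^ n" using L by simp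
    have "crossing_prob P L' h \<le> real ((2 * 192 + 1) ^ CARD('d)) * crossing_prob P (L * 64 ^ n) h"
      by (rule crossing_prob_le_smaller_scale[OF P Ln lo hi])
    also have "\<dots> \<le> real ((2 * 192 + 1) ^ CARD('d)) * exp (- (2 ^ n))"
      by (intro mult_left_mono scales) simp
    also have "\<dots> \<le> c * exp (- b * real L' powr (1 / 6))"
    proof (rule mult_mono)
      have "385 ^ CARD('d) * 1 \<le> 385 ^ CARD('d) * exp (1::real)" by (intro mult_left_mono) auto
      then show "real ((2 * 192 + 1) ^ CARD('d)) \<le> c" by (simp add: c_def)
      have "real L' \<le> real (192 * (L * 64 ^ n))" using hi by (simp only: of_nat_le_iff)
      then have "real L' / (192 * real L) \<le> 64 ^ n" using L0 by (simp add: field_simps)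
      then have "b * real L' powr (1 / 6) \<le> (64 ^ n) powr (1 / 6)"
        unfolding bL by (intro powr_mono2) auto
      also have "(64 ^ n :: real) = (2 ^ n) powr 6"
      proof -
        have "(2 ^ n :: real) ^ 6 = (2 ^ 6) ^ n" by (simp only: power_mult[symmetric] mult.commute)
        then show ?thesis by simp
      qed
      also have "((2 ^ n :: real) powr 6) powr (1 / 6) = 2 ^ n" by (simp only: powr_powr) simp
      finally show "exp (- (2 ^ n)) \<le> exp (- b * real L' powr (1 / 6))" by simp
    qed (use c0 in auto)
    finally show ?thesis .
  qed
  then show ?thesis unfolding stretched_decay_def using b0 c0 by blast
qed

text \<open>The constant \<open>\<eta>\<close> depends on the dimension alone, in particular neither on \<open>L\<close> nor on \<open>\<delta>\<close>.  This is
why smallness at one large scale is enough.\<close>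

theorem crossing_prob_threshold:
  fixes P :: "(int ^ 'd::finite \<Rightarrow> real) measure"
  assumes d: "3 \<le> CARD('d)" and P: "gff_law P"
  obtains \<eta> where "0 < \<eta>"
    "\<And>\<delta>. 0 < \<delta> \<Longrightarrow> \<forall>\<^sub>F L in sequentially. \<forall>h. crossing_prob P L h \<le> \<eta> \<longrightarrow> stretched_decay P (h + \<delta>)"
proof
  let ?K = "pair_count CARD('d)"
  have K: "0 < ?K" using pair_count_ge_1[of "CARD('d)"] by linarith
  show "0 < exp (- 1) / (4 * ?K)" using K by simp
  fix \<delta> :: real assume \<delta>: "0 < \<delta>"
  show "\<forall>\<^sub>F L in sequentially. \<forall>h. crossing_prob P L h \<le> exp (- 1) / (4 * ?K) \<longrightarrow> stretched_decay P (h + \<delta>)"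
  proof -
    have "1 \<le> CARD('d)" using d by simp
    from eventually_decoupling_error_small[OF \<delta> this pair_count_ge_1[of "CARD('d)"]] eventually_ge_at_top[of 1]
    show ?thesis
    proof eventually_elim
      case (elim L)
      show ?case
      proof (intro allI impI)
        fix h assume "crossing_prob P L h \<le> exp (- 1) / (4 * ?K)"
        then have init: "4 * ?K * crossing_prob P L h \<le> exp (- 1)"
          using K by (simp add: pos_le_divide_eq mult.commute)
        show "stretched_decay P (h + \<delta>)"
          by (rule stretched_decay_interpolate[OF P elim(2) crossing_prob_scales[OF d P elim(2) \<delta> _ init]])
            (use elim(1) in blast)
      qed
    qed
  qed
qed

section \<open>The critical parameter and the decay of connections\<close>

text \<open>A union bound over the box and the inequality of Chebyshev.\<close>

lemma crossing_prob_small_at_high_level: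
  fixes P :: "(int ^ 'd::finite \<Rightarrow> real) measure"
  assumes P: "gff_law P" and \<eta>: "0 < \<eta>"
  shows "\<exists>h. crossing_prob P L h \<le> \<eta>"
proof -
  interpret prob_space P by (rule gff_prob_space[OF P])
  let ?V = "sup_box (0 :: int ^ 'd) (2 * L)"
  have grv: "gaussian_rv P (\<lambda>\<phi>. \<Sum>y\<in>F. a y * \<phi> y)" if "finite F" for F a
    using P that by (simp add: gff_law_def gaussian_field_law_def)
  have "gaussian_rv P (\<lambda>\<phi>. \<phi> x)" for x using grv[of "{x}" "\<lambda>_. 1"] by simp
  then have si: "integrable P (\<lambda>\<phi>. (\<phi> x)\<^sup>2)" for x
    by (rule gaussian_rv_square_integrable(2)[OF prob_space_axioms])
  define v where "v = (\<Sum>x\<in>?V. \<integral>\<phi>. (\<phi> x)\<^sup>2 \<partial>P)"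
  have v0: "0 \<le> v" unfolding v_def by (intro sum_nonneg integral_nonneg_AE) auto
  \<comment> \<open>the summand 1 keeps \<open>h\<close> positive if all variances vanish\<close>
  define h where "h = sqrt (v / \<eta>) + 1"
  have h: "0 < h" using v0 \<eta> by (simp add: h_def add_nonneg_pos)
  have sets: "{\<phi> \<in> space P. h\<^sup>2 \<le> (\<phi> x)\<^sup>2} \<in> events" for x
    by (intro borel_measurable_le borel_measurable_const borel_measurable_power gff_measurable[OF P])
  have "crossing_prob P L h \<le> measure P (\<Union>x\<in>?V. {\<phi> \<in> space P. h\<^sup>2 \<le> (\<phi> x)\<^sup>2})"
    unfolding crossing_prob_def
  proof (rule finite_measure_mono)
    show "{\<phi> \<in> space P. above (crossings 0 L) h \<phi>} \<subseteq> (\<Union>x\<in>?V. {\<phi> \<in> space P. h\<^sup>2 \<le> (\<phi> x)\<^sup>2})"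
    proof
      fix \<phi> assume "\<phi> \<in> {\<phi> \<in> space P. above (crossings 0 L) h \<phi>}"
      then obtain A where A: "A \<in> crossings 0 L" "\<forall>x\<in>A. h \<le> \<phi> x" and sp: "\<phi> \<in> space P"
        unfolding above_def by blast
      have "A \<noteq> {}" using A(1) by (auto simp: crossings_def)
      then obtain x where "x \<in> A" by blast
      moreover from this have "x \<in> ?V" using A(1) crossings_subset by blast
      ultimately show "\<phi> \<in> (\<Union>x\<in>?V. {\<phi> \<in> space P. h\<^sup>2 \<le> (\<phi> x)\<^sup>2})"
        using A(2) h sp by (intro UN_I[of x]) (auto intro!: power_mono)
    qed
  qed (intro sets.finite_UN finite_sup_box sets)
  also have "\<dots> \<le> (\<Sum>x\<in>?V. \<P>(\<phi> in P. h\<^sup>2 \<le> (\<phi> x)\<^sup>2))"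
    by (intro finite_measure_subadditive_finite finite_sup_box) (use sets in auto)
  also have "\<dots> \<le> (\<Sum>x\<in>?V. (\<integral>\<phi>. (\<phi> x)\<^sup>2 \<partial>P) / h\<^sup>2)"
    by (intro sum_mono integral_Markov_inequality_measure[where A="{}"] si) (use h in auto)
  also have "\<dots> = v / h\<^sup>2" by (simp add: v_def sum_divide_distrib)
  also have "\<dots> \<le> \<eta>"
  proof -
    have "v / \<eta> = (sqrt (v / \<eta>))\<^sup>2" using v0 \<eta> by simp
    also have "\<dots> \<le> h\<^sup>2" using v0 \<eta> by (intro power_mono) (auto simp: h_def)
    finally have "v \<le> \<eta> * h\<^sup>2" using \<eta> by (simp add: pos_divide_le_eq mult.commute)
    then show ?thesis using h by (simp add: pos_divide_le_eq)
  qed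
  finally show ?thesis by blast
qed

abbreviation connection_prob :: "(int ^ 'd::finite \<Rightarrow> real) measure \<Rightarrow> nat \<Rightarrow> real \<Rightarrow> real" where
  "connection_prob P L h \<equiv> \<P>(\<phi> in P. connected_above h (Ball_inf L) (Sphere_inf (2 * L)) \<phi>)"

lemma connection_prob_eq_crossing_prob:
  assumes "1 \<le> L"
  shows "connection_prob P L h = crossing_prob P L h"
  unfolding crossing_prob_def connected_above_iff_crossing[OF assms] ..

lemma stretched_decay_imp_h_star_star_less_top:
  assumes "stretched_decay P h"
  shows "h_star_star P < \<infinity>"
proof -
  obtain c c' where c: "0 < c" "0 < c'" "\<And>L. 1 \<le> L \<Longrightarrow> crossing_prob P L h \<le> c * exp (- c' * real L powr (1 / 6))"
    using assms unfolding stretched_decay_def by blast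
  have "(\<lambda>L. real L powr 1 * connection_prob P L h) \<longlonglongrightarrow> 0"
  proof (rule tendsto_sandwich)
    show "\<forall>\<^sub>F L in sequentially. 0 \<le> real L powr 1 * connection_prob P L h"
      by (intro always_eventually allI mult_nonneg_nonneg) auto
    show "\<forall>\<^sub>F L in sequentially. real L powr 1 * connection_prob P L h
        \<le> real L powr 1 * (c * exp (- c' * real L powr (1 / 6)))"
      using eventually_ge_at_top[of 1]
    proof eventually_elim
      case (elim L)
      show ?case unfolding connection_prob_eq_crossing_prob[OF elim]
        by (intro mult_left_mono c(3) elim) auto
    qed
    show "(\<lambda>L. real L powr 1 * (c * exp (- c' * real L powr (1 / 6)))) \<longlonglongrightarrow> 0"
      using c(1,2) by real_asymp
  qed simp
  then have "h_star_star P \<le> ereal h"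
    unfolding h_star_star_def by (intro Inf_lower imageI CollectI exI[of _ 1]) simp
  then show ?thesis by (rule order.strict_trans1) simp
qed

lemma connected_above_point_imp_crossing:
  assumes L: "1 \<le> L" "2 * int L \<le> sup_norm x" and con: "connected_above h {0} {x} \<phi>"
  shows "above (crossings 0 L) h \<phi>"
proof -
  obtain p where p: "p \<noteq> []" "set p \<subseteq> excursion_set h \<phi>" "successively adjacent p" "hd p = 0" "last p = x"
    using con unfolding connected_above_def by auto
  obtain A where "A \<in> crossings 0 L" "A \<subseteq> set p"
    using path_contains_crossing[OF p(1,3) L(1), of 0] L(2) p(4,5) by auto
  then show ?thesis using p(2) unfolding above_def excursion_set_def by blast
qed

text \<open>A connection from 0 to \<open>x\<close> crosses from the box whose radius is half the sup norm of
\<open>x\<close>, rounded down.  The constant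
\<open>exp c'\<close> takes care of the points close to 0.\<close>

lemma connection_prob_point_le:
  fixes P :: "(int ^ 'd::finite \<Rightarrow> real) measure" and x :: "int ^ 'd"
  assumes P: "gff_law P" and c: "0 < c" "0 < c'"
    and decay: "\<And>L. 1 \<le> L \<Longrightarrow> crossing_prob P L h \<le> c * exp (- c' * real L powr (1 / 6))"
  shows "\<P>(\<phi> in P. connected_above h {0} {x} \<phi>)
    \<le> (c + exp c') * exp (- (c' * (1 / (3 * sqrt CARD('d))) powr (1 / 6)) * norm (lat x) powr (1 / 6))"
proof -
  interpret prob_space P by (rule gff_prob_space[OF P])
  define s where "s = norm (lat x) / (3 * sqrt CARD('d))"
  define N where "N = nat (sup_norm x)"
  have N: "sup_norm x = int N" using sup_norm_nonneg[of x] by (simp add: N_def)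
  have s0: "0 \<le> s" by (simp add: s_def)
  have expo: "- (c' * (1 / (3 * sqrt CARD('d))) powr (1 / 6)) * norm (lat x) powr (1 / 6) = - c' * s powr (1 / 6)"
    by (simp add: s_def powr_divide powr_mult)
  have "norm (lat x) \<le> sqrt (real CARD('d)) * infnorm (lat x)"
    using norm_le_infnorm[of "lat x"] by simp
  then have sN: "s \<le> real N / 3"
    by (simp add: s_def infnorm_lat N field_simps)
  have "\<P>(\<phi> in P. connected_above h {0} {x} \<phi>) \<le> (c + exp c') * exp (- c' * s powr (1 / 6))"
  proof (cases "N \<le> 3")
    case True
    then have "s powr (1 / 6) \<le> 1" using sN s0 powr_mono2[of "1 / 6" s 1] by simp
    then have "c' * s powr (1 / 6) \<le> c'" using c by simp
    then have "1 \<le> exp c' * exp (- c' * s powr (1 / 6))" by (simp flip: exp_add)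
    also have "\<dots> \<le> (c + exp c') * exp (- c' * s powr (1 / 6))"
      using c by (intro mult_right_mono) auto
    finally show ?thesis using prob_le_1 by (rule order_trans[rotated])
  next
    case False
    define L where "L = N div 2"
    have L: "1 \<le> L" "2 * int L \<le> sup_norm x" using False unfolding L_def N by auto
    have "N \<le> 3 * L" using False unfolding L_def by linarith
    then have sL: "s \<le> real L" using sN by linarith
    have "\<P>(\<phi> in P. connected_above h {0} {x} \<phi>) \<le> crossing_prob P L h"
      unfolding crossing_prob_def
      by (rule finite_measure_mono) (use connected_above_point_imp_crossing[OF L] gff_above_sets[OF P] in auto)
    also have "\<dots> \<le> c * exp (- c' * real L powr (1 / 6))" by (rule decay[OF L(1)])
    also have "\<dots> \<le> (c + exp c') * exp (- c' * s powr (1 / 6))"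
      using c s0 sL by (intro mult_mono) (auto intro!: powr_mono2)
    finally show ?thesis .
  qed
  then show ?thesis unfolding expo .
qed

theorem theorem2p6:
  fixes P :: "(int ^ 'd::finite \<Rightarrow> real) measure"
  assumes "3 \<le> CARD('d)"
    and "gff_law P"
  shows "h_star_star P < \<infinity> \<and>
    (\<forall>h::real. ereal h > h_star_star P \<longrightarrow>
      (\<exists>c c' c'' \<rho>. 0 < c \<and> 0 < c' \<and> 0 < c'' \<and> 0 < \<rho> \<and> \<rho> < 1 \<and>
        (\<forall>L::nat. 1 \<le> L \<longrightarrow>
          \<P>(\<phi> in P. connected_above h (Ball_inf L) (Sphere_inf (2 * L)) \<phi>)
            \<le> c * exp (- c' * real L powr \<rho>)) \<and>
        (\<forall>x::int ^ 'd.
          \<P>(\<phi> in P. connected_above h {0} {x} \<phi>)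
            \<le> c * exp (- c'' * norm (lat x) powr \<rho>))))"
proof -
  note d = assms(1) and P = assms(2)
  obtain \<eta> where \<eta>: "0 < \<eta>" and thr: "\<And>\<delta>. 0 < \<delta> \<Longrightarrow> \<forall>\<^sub>F L in sequentially. \<forall>h. crossing_prob P L h \<le> \<eta> \<longrightarrow> stretched_decay P (h + \<delta>)"
    by (rule crossing_prob_threshold[OF d P]) blast
  have finite: "h_star_star P < \<infinity>"
  proof -
    obtain L where L: "\<And>h. crossing_prob P L h \<le> \<eta> \<Longrightarrow> stretched_decay P (h + 1)"
      using eventually_happens[OF thr[of 1]] by auto
    obtain h where "crossing_prob P L h \<le> \<eta>" using crossing_prob_small_at_high_level[OF P \<eta>] by blast
    then show ?thesis by (rule stretched_decay_imp_h_star_star_less_top[OF L])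
  qed
  have decay: "stretched_decay P h" if h: "h_star_star P < ereal h" for h
  proof -
    obtain h0 \<alpha> where h0: "h0 < h" and \<alpha>: "0 < \<alpha>"
      and lim: "(\<lambda>L. real L powr \<alpha> * connection_prob P L h0) \<longlonglongrightarrow> 0"
      using h unfolding h_star_star_def Inf_less_iff by auto
    have "\<forall>\<^sub>F L in sequentially. real L powr \<alpha> * connection_prob P L h0 < \<eta>"
      by (rule order_tendstoD(2)[OF lim \<eta>])
    then have small: "\<forall>\<^sub>F L in sequentially. crossing_prob P L h0 \<le> \<eta>"
      using eventually_ge_at_top[of 1]
    proof eventually_elim
      case (elim L)
      have "1 \<le> real L powr \<alpha>" using elim(2) \<alpha> by (intro ge_one_powr_ge_zero) auto
      then have "1 * crossing_prob P L h0 \<le> real L powr \<alpha> * crossing_prob P L h0"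
        by (intro mult_right_mono crossing_prob_nonneg)
      then show ?case using elim(1) unfolding connection_prob_eq_crossing_prob[OF elim(2)] by simp
    qed
    have "\<forall>\<^sub>F L in sequentially. \<forall>h'. crossing_prob P L h' \<le> \<eta> \<longrightarrow> stretched_decay P (h' + (h - h0))"
      by (rule thr) (use h0 in simp)
    with small have "\<forall>\<^sub>F L in sequentially. stretched_decay P (h0 + (h - h0))"
      by eventually_elim blast
    then show ?thesis by (simp add: eventually_const_iff)
  qed
  show ?thesis
  proof (intro conjI finite allI impI)
    fix h :: real assume "h_star_star P < ereal h"
    then obtain c c' where c: "0 < c" "0 < c'"
      and cr: "\<And>L. 1 \<le> L \<Longrightarrow> crossing_prob P L h \<le> c * exp (- c' * real L powr (1 / 6))"
      using decay unfolding stretched_decay_def by blast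
    have "connection_prob P L h
            \<le> (c + exp c') * exp (- c' * real L powr (1 / 6))" if "1 \<le> L" for L
      unfolding connection_prob_eq_crossing_prob[OF that]
      using order_trans[OF cr[OF that] mult_right_mono[of c "c + exp c'"]] by simp
    moreover have "\<P>(\<phi> in P. connected_above h {0} {x} \<phi>)
            \<le> (c + exp c') * exp (- (c' * (1 / (3 * sqrt CARD('d))) powr (1 / 6)) * norm (lat x) powr (1 / 6))" for x
      by (rule connection_prob_point_le[OF P c cr])
    moreover have "0 < c' * (1 / (3 * sqrt CARD('d))) powr (1 / 6)" using c by simp
    moreover have "0 < c + exp c'" using c by (intro add_pos_pos) auto
    ultimately show "\<exists>c c' c'' \<rho>. 0 < c \<and> 0 < c' \<and> 0 < c'' \<and> 0 < \<rho> \<and> \<rho> < 1 \<and>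
        (\<forall>L::nat. 1 \<le> L \<longrightarrow>
          connection_prob P L h
            \<le> c * exp (- c' * real L powr \<rho>)) \<and>
        (\<forall>x::int ^ 'd.
          \<P>(\<phi> in P. connected_above h {0} {x} \<phi>)
            \<le> c * exp (- c'' * norm (lat x) powr \<rho>))"
      using c by (intro exI[of _ "c + exp c'"] exI[of _ c'] exI[of _ "c' * (1 / (3 * sqrt CARD('d))) powr (1 / 6)"]
          exI[of _ "1 / 6"] conjI allI impI) auto
  qed
qed

end
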